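(* Let $(\Gamma,o)$ be a labeled graph and $G=W(\Gamma,o)$. Then $\operatorname{Aut}^\star G$ is the subgroup of $\operatorname{Aut} G$ generated by $\mathcal G^\star$, where $\operatorname{Aut}^\star G$ is the subgroup of all $\theta\in\operatorname{Aut}G$ such that for every maximal complete subgraph $\Delta$ of $\Gamma$ the subgroup $\theta(W(\Delta))$ is a conjugate of $W(\Theta)$ for some maximal complete subgraph $\Theta$ of $\Gamma$, and $\mathcal G^\star$ is the set of all labeled graph automorphisms, factor automorphisms, $\star$-transvections and partial conjugations of $G$.
   Context: A graph $\Gamma=(V,E)$ has a finite vertex set $V$ and a set $E$ of edges that are 2-element subsets of $V$. Let $P$ be the set of all prime powers greater than $1$ together with $\infty$. A labeled graph $(\Gamma,o)$ is a graph with a map $o:V\to P$; $W(\Gamma,o)$ denotes the graph product of the cyclic groups $\langle v\rangle$ of order $o(v)$ (infinite cyclic if $o(v)=\infty$), i.e. the free product of the $\langle v\rangle$, $v\in V$, modulo the normal subgroup generated by all $[x,y]$ with $\{x,y\}\in E$. For an induced subgraph $\Delta$ of $\Gamma$, $W(\Delta)$ denotes the subgroup of $G$ generated by the vertices of $\Delta$. Complete subgraphs are those in which all distinct vertices are adjacent; maximal means maximal under inclusion. For $v\in V$, $\operatorname{lk} v$ is the set of vertices adjacent to $v$, $v^\star=\operatorname{lk} v\cup\{v\}$, and $\Gamma\setminus v^\star$ is the subgraph induced on $V\setminus v^\star$. A map $\phi:V\to G$ is called well-defined if it extends to an endomorphism of $G$, also denoted $\phi$. (1) Labeled graph automorphisms: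 automorphisms of $G$ induced by label-preserving graph automorphisms of $\Gamma$. (2) Factor automorphisms: for $v\in V$, $v\mapsto v^m$ and $z\mapsto z$ for $z\in V$, $z\ne v$, where $m=-1$ if $o(v)=\infty$, and $m\neq 1$, $\gcd(m,o(v))=1$ if $o(v)<\infty$. (3) Dominated transvections: for distinct $x,y\in V$ and $q\ge1$ let $\tau_{x,y}^q$ be the map $x\mapsto xy^q$, $z\mapsto z$ for $z\in V$, $z\neq x$. Whenever $\tau_{x,y}^q$ is well-defined for some $q\ge 1$, one takes the dominated transvection $\tau_{x,y}^q$ with the minimal such $q\ge1$. It is a $\star$-transvection if $x$ is adjacent to $y$. (4) Partial conjugations: for $v\in V$ and $K$ a connected component of $\Gamma\setminus v^\star$, $\sigma_{K,v}(z)=vzv^{-1}$ for $z\in K$ and $\sigma_{K,v}(z)=z$ for $z\in V\setminus K$. *)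

theory Defs
  imports
    "HOL-Algebra.Algebra"
    "HOL-Number_Theory.Prime_Powers"
    "HOL-Library.Extended_Nat"
    "HOL-Library.Ramsey"
begin

subsection \<open>Free products of groups\<close>

text \<open>
  The free product of the groups \<open>H i\<close>, \<open>i \<in> I\<close>, is realised as the monoid of words in the
  letters \<open>(i, x)\<close>, \<open>x \<in> carrier (H i)\<close>, modulo the congruence that multiplies adjacent letters
  from the same factor and deletes letters that are identity elements.
\<close>

definition fp_words :: "'i set \<Rightarrow> ('i \<Rightarrow> ('b, 'c) monoid_scheme) \<Rightarrow> ('i \<times> 'b) list set" where
  "fp_words I H = lists (SIGMA i:I. carrier (H i))"

inductive_set fp_rel ::
    "'i set \<Rightarrow> ('i \<Rightarrow> ('b, 'c) monoid_scheme) \<Rightarrow> (('i \<times> 'b) list \<times> ('i \<times> 'b) list) set"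
  for I H where
  merge: "\<lbrakk>u \<in> fp_words I H; w \<in> fp_words I H; i \<in> I; x \<in> carrier (H i); y \<in> carrier (H i)\<rbrakk>
    \<Longrightarrow> (u @ [(i, x), (i, y)] @ w, u @ [(i, x \<otimes>\<^bsub>H i\<^esub> y)] @ w) \<in> fp_rel I H"
| unit: "\<lbrakk>u \<in> fp_words I H; w \<in> fp_words I H; i \<in> I\<rbrakk>
    \<Longrightarrow> (u @ [(i, \<one>\<^bsub>H i\<^esub>)] @ w, u @ w) \<in> fp_rel I H"
| refl: "u \<in> fp_words I H \<Longrightarrow> (u, u) \<in> fp_rel I H"
| sym: "(u, w) \<in> fp_rel I H \<Longrightarrow> (w, u) \<in> fp_rel I H"
| trans: "\<lbrakk>(u, v) \<in> fp_rel I H; (v, w) \<in> fp_rel I H\<rbrakk> \<Longrightarrow> (u, w) \<in> fp_rel I H"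

definition free_product ::
    "'i set \<Rightarrow> ('i \<Rightarrow> ('b, 'c) monoid_scheme) \<Rightarrow> ('i \<times> 'b) list set monoid" where
  "free_product I H =
    \<lparr>carrier = fp_words I H // fp_rel I H,
     monoid.mult = (\<lambda>A B. \<Union>a\<in>A. \<Union>b\<in>B. fp_rel I H `` {a @ b}),
     one = fp_rel I H `` {[]}\<rparr>"

definition fp_inj ::
    "'i set \<Rightarrow> ('i \<Rightarrow> ('b, 'c) monoid_scheme) \<Rightarrow> 'i \<Rightarrow> 'b \<Rightarrow> ('i \<times> 'b) list set" where
  "fp_inj I H i x = fp_rel I H `` {[(i, x)]}"

definition normal_closure :: "('a, 'b) monoid_scheme \<Rightarrow> 'a set \<Rightarrow> 'a set" where
  "normal_closure G S = \<Inter>{N. N \<lhd> G \<and> S \<subseteq> N}"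

definition cyclic_group_of_order :: "enat \<Rightarrow> int monoid" where
  "cyclic_group_of_order n =
    (case n of enat k \<Rightarrow> integer_mod_group k | \<infinity> \<Rightarrow> integer_group)"


subsection \<open>Labeled graphs and graph products of cyclic groups\<close>

text \<open>Induced subgraphs are represented by their vertex sets.\<close>

locale labeled_graph =
  fixes V :: "'a set" and E :: "'a set set" and lab :: "'a \<Rightarrow> enat"
  assumes finite_V: "finite V"
    and edges: "E \<subseteq> {e. e \<subseteq> V \<and> card e = 2}"
    and labels: "\<forall>v\<in>V. lab v = \<infinity> \<or> (\<exists>n. primepow n \<and> lab v = enat n)"
begin

definition link :: "'a \<Rightarrow> 'a set" where
  "link v = {w \<in> V. {v, w} \<in> E}"

definition star :: "'a \<Rightarrow> 'a set" where
  "star v = insert v (link v)"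

definition components :: "'a set \<Rightarrow> 'a set set" where
  "components S =
    S // {(x, y) \<in> S \<times> S. (x, y) \<in> {(a, b). a \<in> S \<and> b \<in> S \<and> {a, b} \<in> E}\<^sup>*}"

definition maximal_complete :: "'a set \<Rightarrow> bool" where
  "maximal_complete \<Delta> \<longleftrightarrow>
    \<Delta> \<subseteq> V \<and> clique \<Delta> E \<and> (\<forall>\<Delta>'. \<Delta> \<subseteq> \<Delta>' \<and> \<Delta>' \<subseteq> V \<and> clique \<Delta>' E \<longrightarrow> \<Delta>' = \<Delta>)"

definition vertex_free_product :: "('a \<times> int) list set monoid" where
  "vertex_free_product = free_product V (\<lambda>v. cyclic_group_of_order (lab v))"

text \<open>\<open>1\<close> is the standard generator of the cyclic groups above, so this is the letter \<open>v\<close> itself.\<close>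

definition free_vertex :: "'a \<Rightarrow> ('a \<times> int) list set" where
  "free_vertex v = fp_inj V (\<lambda>v. cyclic_group_of_order (lab v)) v 1"

definition edge_commutators :: "('a \<times> int) list set set" where
  "edge_commutators =
    (let F = vertex_free_product in
      {free_vertex x \<otimes>\<^bsub>F\<^esub> free_vertex y \<otimes>\<^bsub>F\<^esub> inv\<^bsub>F\<^esub> free_vertex x \<otimes>\<^bsub>F\<^esub> inv\<^bsub>F\<^esub> free_vertex y
        | x y. {x, y} \<in> E})"

definition graph_product :: "('a \<times> int) list set set monoid" where
  "graph_product = vertex_free_product Mod normal_closure vertex_free_product edge_commutators"

abbreviation G :: "('a \<times> int) list set set monoid" where
  "G \<equiv> graph_product"

definition vertex :: "'a \<Rightarrow> ('a \<times> int) list set set" where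
  "vertex v =
    normal_closure vertex_free_product edge_commutators #>\<^bsub>vertex_free_product\<^esub> free_vertex v"

definition W :: "'a set \<Rightarrow> ('a \<times> int) list set set set" where
  "W \<Delta> = generate G (vertex ` \<Delta>)"


subsection \<open>The subgroup of automorphisms and its generators\<close>

text \<open>
  Group endomorphisms are normalised to be \<^const>\<open>extensional\<close>, in accordance with \<^const>\<open>auto\<close>.
\<close>

definition extends_to ::
    "('a \<Rightarrow> ('a \<times> int) list set set) \<Rightarrow>
     (('a \<times> int) list set set \<Rightarrow> ('a \<times> int) list set set) \<Rightarrow> bool" where
  "extends_to \<phi> \<theta> \<longleftrightarrow>
    \<theta> \<in> hom G G \<inter> extensional (carrier G) \<and> (\<forall>v\<in>V. \<theta> (vertex v) = \<phi> v)"

definition well_defined :: "('a \<Rightarrow> ('a \<times> int) list set set) \<Rightarrow> bool" where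
  "well_defined \<phi> \<longleftrightarrow> (\<exists>\<theta>. extends_to \<phi> \<theta>)"

text \<open>
  The generators are introduced merely as extensions of maps on vertices to endomorphisms.
  That they are automorphisms is then part of any statement that identifies a subset of
  \<^term>\<open>auto G\<close> with the set generated by them (cf. rule \<open>generate.incl\<close>).
\<close>

definition labeled_graph_automorphisms ::
    "(('a \<times> int) list set set \<Rightarrow> ('a \<times> int) list set set) set" where
  "labeled_graph_automorphisms =
    {\<theta>. \<exists>\<pi>. bij_betw \<pi> V V \<and> (\<forall>x\<in>V. \<forall>y\<in>V. {x, y} \<in> E \<longleftrightarrow> {\<pi> x, \<pi> y} \<in> E) \<and>
      (\<forall>v\<in>V. lab (\<pi> v) = lab v) \<and> extends_to (\<lambda>v. vertex (\<pi> v)) \<theta>}"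

definition factor_automorphisms ::
    "(('a \<times> int) list set set \<Rightarrow> ('a \<times> int) list set set) set" where
  "factor_automorphisms =
    {\<theta>. \<exists>v\<in>V. \<exists>m :: int.
      (case lab v of \<infinity> \<Rightarrow> m = -1 | enat n \<Rightarrow> m \<noteq> 1 \<and> coprime m (int n)) \<and>
      extends_to (vertex(v := vertex v [^]\<^bsub>G\<^esub> m)) \<theta>}"

definition transvection_map :: "'a \<Rightarrow> 'a \<Rightarrow> nat \<Rightarrow> 'a \<Rightarrow> ('a \<times> int) list set set" where
  "transvection_map x y q = vertex(x := vertex x \<otimes>\<^bsub>G\<^esub> (vertex y [^]\<^bsub>G\<^esub> q))"

definition dominated_transvection ::
    "'a \<Rightarrow> 'a \<Rightarrow> (('a \<times> int) list set set \<Rightarrow> ('a \<times> int) list set set) \<Rightarrow> bool" where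
  "dominated_transvection x y \<theta> \<longleftrightarrow>
    x \<in> V \<and> y \<in> V \<and> x \<noteq> y \<and>
    (\<exists>q\<ge>1. extends_to (transvection_map x y q) \<theta> \<and>
      (\<forall>r. 1 \<le> r \<and> r < q \<longrightarrow> \<not> well_defined (transvection_map x y r)))"

definition star_transvections ::
    "(('a \<times> int) list set set \<Rightarrow> ('a \<times> int) list set set) set" where
  "star_transvections = {\<theta>. \<exists>x y. dominated_transvection x y \<theta> \<and> {x, y} \<in> E}"

definition partial_conjugations ::
    "(('a \<times> int) list set set \<Rightarrow> ('a \<times> int) list set set) set" where
  "partial_conjugations =
    {\<theta>. \<exists>v\<in>V. \<exists>K\<in>components (V - star v).
      extends_to
        (\<lambda>z. if z \<in> K then vertex v \<otimes>\<^bsub>G\<^esub> vertex z \<otimes>\<^bsub>G\<^esub> inv\<^bsub>G\<^esub> vertex v else vertex z) \<theta>}"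

definition star_generators ::
    "(('a \<times> int) list set set \<Rightarrow> ('a \<times> int) list set set) set" where
  "star_generators =
    labeled_graph_automorphisms \<union> factor_automorphisms \<union> star_transvections \<union>
    partial_conjugations"

definition Aut_star ::
    "(('a \<times> int) list set set \<Rightarrow> ('a \<times> int) list set set) set" where
  "Aut_star =
    {\<theta> \<in> carrier (AutoGroup G). \<forall>\<Delta>. maximal_complete \<Delta> \<longrightarrow>
      (\<exists>\<Theta>. maximal_complete \<Theta> \<and>
        (\<exists>g\<in>carrier G. \<theta> ` W \<Delta> = g <#\<^bsub>G\<^esub> W \<Theta> #>\<^bsub>G\<^esub> inv\<^bsub>G\<^esub> g))}"

end

end

(*
  Let \<theta> be in Aut*. Its action on the abelianisation of G permutes the subgroups spanned by the
  maximal complete subgraphs. Gaussian elimination, column by column, with star-transvections and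
  factor automorphisms, followed by a labeled graph automorphism, reduces to the case that \<theta> acts
  trivially on the abelianisation. As W(\<Delta>) embeds there for complete \<Delta>, such a \<theta> agrees on each
  W(\<Delta>) with the conjugation by some element. The image of a vertex v then determines a wall in the
  Cayley graph of G, namely a coset of the centralizer of v. If one of these walls separates another
  one from 1, then a partial conjugation brings the latter closer to 1. If there is no such pair,
  then ping-pong and the surjectivity of \<theta> show that all walls contain 1, so \<theta> is the identity.
*)
theory Submission
  imports Defs "HOL-Number_Theory.Cong"
begin

subsection \<open>The universal property of free products\<close>

text \<open>Graph products are handled without normal forms: homomorphisms to cyclic groups
  (\<open>coord\<close>) and one action on pairs (\<open>sector\<close>) carry all the information
  needed. Two obstacles shape the elimination. Adding a multiple of row \<open>t\<close> to row
  \<open>s\<close> needs a transvection, which exists only if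
  \<open>link t \<subseteq> star s\<close> and the orders permit the multiple. The inclusion is
  secured by the choice of the next column. The orders fit by themselves once the pivot has the same
  order as the column, because the divisibility that every matrix entry satisfies is the one that
  makes the clearing transvection well-defined. Pivots have two origins. Prime power labels make the
  finite cyclic rings local, so some entry is a unit; for infinite order Euclid's algorithm has to
  produce one first. In the second half only adjacent vertices are known to share a conjugator.
  Their walls then meet, so a wall that separates the wall of one vertex from 1 does so for a whole
  component, which is just what a single partial conjugation moves.\<close>

context
  fixes I :: "'i set" and H :: "'i \<Rightarrow> ('b, 'c) monoid_scheme"
  assumes factors: "\<And>i. i \<in> I \<Longrightarrow> group (H i)"
begin

lemma fp_words_append [simp]: "u @ w \<in> fp_words I H \<longleftrightarrow> u \<in> fp_words I H \<and> w \<in> fp_words I H"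
  by (auto simp: fp_words_def)

lemma fp_words_Nil [simp]: "[] \<in> fp_words I H"
  by (simp add: fp_words_def)

lemma fp_words_Cons [simp]:
  "(i, x) # w \<in> fp_words I H \<longleftrightarrow> i \<in> I \<and> x \<in> carrier (H i) \<and> w \<in> fp_words I H"
  by (auto simp: fp_words_def)

lemma fp_rel_words: "(u, w) \<in> fp_rel I H \<Longrightarrow> u \<in> fp_words I H \<and> w \<in> fp_words I H"
  by (induction rule: fp_rel.induct)
    (auto intro: group.is_monoid factors monoid.m_closed monoid.one_closed)

lemma equiv_fp_rel: "equiv (fp_words I H) (fp_rel I H)"
proof (rule equivI)
  show "fp_rel I H \<subseteq> fp_words I H \<times> fp_words I H" using fp_rel_words by auto
  show "refl_on (fp_words I H) (fp_rel I H)" by (simp add: refl_on_def fp_rel.refl)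
  show "sym (fp_rel I H)" by (rule symI) (rule fp_rel.sym)
  show "trans (fp_rel I H)" by (rule transI) (rule fp_rel.trans)
qed

lemma fp_rel_context:
  assumes "(u, w) \<in> fp_rel I H" "p \<in> fp_words I H" "q \<in> fp_words I H"
  shows "(p @ u @ q, p @ w @ q) \<in> fp_rel I H"
  using assms
proof (induction rule: fp_rel.induct)
  case (merge u w i x y)
  then show ?case using fp_rel.merge[of "p @ u" I H "w @ q" i x y] by simp
next
  case (unit u w i)
  then show ?case using fp_rel.unit[of "p @ u" I H "w @ q" i] by simp
next
  case (refl u)
  then show ?case by (intro fp_rel.refl) simp
next
  case (sym u w)
  from sym.IH[OF sym.prems] show ?case by (rule fp_rel.sym)
next
  case (trans u v w)
  from trans.IH[OF trans.prems] show ?case by (rule fp_rel.trans)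
qed

lemma fp_rel_append:
  assumes "(u, u') \<in> fp_rel I H" "(w, w') \<in> fp_rel I H"
  shows "(u @ w, u' @ w') \<in> fp_rel I H"
proof -
  have "(u @ w, u' @ w) \<in> fp_rel I H"
    using fp_rel_context[OF assms(1), of "[]" w] fp_rel_words[OF assms(2)] by simp
  moreover have "(u' @ w, u' @ w') \<in> fp_rel I H"
    using fp_rel_context[OF assms(2), of u' "[]"] fp_rel_words[OF assms(1)] by simp
  ultimately show ?thesis by (rule fp_rel.trans)
qed

lemma fp_mult_class:
  assumes "u \<in> fp_words I H" "w \<in> fp_words I H"
  shows "fp_rel I H `` {u} \<otimes>\<^bsub>free_product I H\<^esub> fp_rel I H `` {w} = fp_rel I H `` {u @ w}"
proof -
  have "congruent2 (fp_rel I H) (fp_rel I H) (\<lambda>a b. fp_rel I H `` {a @ b})"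
    using equiv_fp_rel fp_rel_append
    by (intro congruent2I') (auto intro!: equiv_class_eq)
  from UN_equiv_class2[OF equiv_fp_rel equiv_fp_rel this assms]
  show ?thesis by (simp add: free_product_def)
qed

lemma fp_class_cases:
  assumes "A \<in> carrier (free_product I H)"
  obtains u where "u \<in> fp_words I H" "A = fp_rel I H `` {u}"
  using assms by (auto simp: free_product_def quotient_def)

lemma fp_class_in_carrier:
  "u \<in> fp_words I H \<Longrightarrow> fp_rel I H `` {u} \<in> carrier (free_product I H)"
  by (simp add: free_product_def quotientI)

lemma fp_one: "\<one>\<^bsub>free_product I H\<^esub> = fp_rel I H `` {[]}"
  by (simp add: free_product_def)

text \<open>The word is inverted letter by letter: the inverse of a new first letter goes to the end
  of the inverse word, where \<open>merge\<close> and \<open>unit\<close> cancel the pair.\<close>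

lemma fp_left_inverse:
  "w \<in> fp_words I H \<Longrightarrow> \<exists>u\<in>fp_words I H. (u @ w, []) \<in> fp_rel I H"
proof (induction w)
  case Nil
  then show ?case using fp_rel.refl by fastforce
next
  case (Cons a w)
  obtain i x where a: "a = (i, x)" by force
  with Cons obtain u where u: "u \<in> fp_words I H" "(u @ w, []) \<in> fp_rel I H"
    and ix: "i \<in> I" "x \<in> carrier (H i)" "w \<in> fp_words I H" by auto
  interpret Hi: group "H i" by (rule factors[OF ix(1)])
  let ?u = "u @ [(i, inv\<^bsub>H i\<^esub> x)]"
  have "(u @ [(i, inv\<^bsub>H i\<^esub> x), (i, x)] @ w, u @ [(i, inv\<^bsub>H i\<^esub> x \<otimes>\<^bsub>H i\<^esub> x)] @ w) \<in> fp_rel I H"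
    using u ix by (intro fp_rel.merge) auto
  moreover have "(u @ [(i, inv\<^bsub>H i\<^esub> x \<otimes>\<^bsub>H i\<^esub> x)] @ w, u @ w) \<in> fp_rel I H"
    using u ix by (simp add: fp_rel.unit[of _ I H, simplified])
  ultimately have "(u @ [(i, inv\<^bsub>H i\<^esub> x), (i, x)] @ w, []) \<in> fp_rel I H"
    using u(2) fp_rel.trans by metis
  then have "(?u @ a # w, []) \<in> fp_rel I H" using a by simp
  moreover have "?u \<in> fp_words I H" using u ix by auto
  ultimately show ?case by blast
qed

lemma group_free_product: "group (free_product I H)"
proof (rule groupI, goal_cases)
  case (1 A B)
  then show ?case by (auto elim!: fp_class_cases simp: fp_mult_class intro!: fp_class_in_carrier)
next
  case 2
  then show ?case by (simp add: fp_one fp_class_in_carrier)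
next
  case (3 A B C)
  then show ?case by (auto elim!: fp_class_cases simp: fp_mult_class)
next
  case (4 A)
  then show ?case by (auto elim!: fp_class_cases simp: fp_mult_class fp_one)
next
  case (5 A)
  then obtain w where w: "w \<in> fp_words I H" "A = fp_rel I H `` {w}" by (rule fp_class_cases)
  then obtain u where "u \<in> fp_words I H" "(u @ w, []) \<in> fp_rel I H" using fp_left_inverse by blast
  then show ?case using w
    by (intro bexI[of _ "fp_rel I H `` {u}"])
      (simp_all add: fp_mult_class fp_one fp_class_in_carrier equiv_class_eq[OF equiv_fp_rel])
qed

lemma fp_inj_hom:
  assumes "i \<in> I" shows "fp_inj I H i \<in> hom (H i) (free_product I H)"
proof (rule homI)
  interpret Hi: group "H i" by (rule factors[OF assms])
  fix x y assume xy: "x \<in> carrier (H i)" "y \<in> carrier (H i)"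
  show "fp_inj I H i x \<in> carrier (free_product I H)"
    using xy assms by (simp add: fp_inj_def fp_class_in_carrier)
  have "([] @ [(i, x), (i, y)] @ [], [] @ [(i, x \<otimes>\<^bsub>H i\<^esub> y)] @ []) \<in> fp_rel I H"
    using assms xy by (intro fp_rel.merge) auto
  then show "fp_inj I H i (x \<otimes>\<^bsub>H i\<^esub> y) = fp_inj I H i x \<otimes>\<^bsub>free_product I H\<^esub> fp_inj I H i y"
    using xy assms by (simp add: fp_inj_def fp_mult_class equiv_class_eq[OF equiv_fp_rel])
qed

lemma fp_generate:
  "carrier (free_product I H) =
    generate (free_product I H) (\<Union>i\<in>I. fp_inj I H i ` carrier (H i))" (is "_ = generate ?F ?S")
proof
  interpret F: group ?F by (rule group_free_product)
  have S: "?S \<subseteq> carrier ?F" using fp_inj_hom by (auto simp: hom_def)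
  have "fp_rel I H `` {w} \<in> generate ?F ?S" if "w \<in> fp_words I H" for w
    using that
  proof (induction w)
    case Nil
    then show ?case using generate.one[of ?F] by (simp add: fp_one)
  next
    case (Cons a w)
    obtain i x where a: "a = (i, x)" by force
    with Cons have "fp_rel I H `` {a # w} = fp_inj I H i x \<otimes>\<^bsub>?F\<^esub> fp_rel I H `` {w}"
      by (simp add: fp_inj_def fp_mult_class)
    moreover have "fp_inj I H i x \<in> ?S" using Cons a by auto
    ultimately show ?case using Cons a by (auto intro: generate.eng generate.incl)
  qed
  then show "carrier ?F \<subseteq> generate ?F ?S" by (auto elim!: fp_class_cases)
  show "generate ?F ?S \<subseteq> carrier ?F" by (rule F.generate_incl[OF S])
qed

text \<open>Words are evaluated in \<open>K\<close>; every generating step of the congruence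
  preserves the value because the \<open>\<phi> i\<close> are homomorphisms.\<close>

lemma free_product_universal:
  assumes "group K" and hom: "\<And>i. i \<in> I \<Longrightarrow> \<phi> i \<in> hom (H i) K"
  obtains \<Phi> where "\<Phi> \<in> hom (free_product I H) K"
    "\<And>i x. i \<in> I \<Longrightarrow> x \<in> carrier (H i) \<Longrightarrow> \<Phi> (fp_inj I H i x) = \<phi> i x"
proof -
  interpret K: group K by fact
  define ev where "ev w = foldr (\<lambda>(i, x) a. \<phi> i x \<otimes>\<^bsub>K\<^esub> a) w \<one>\<^bsub>K\<^esub>" for w
  have \<phi>_closed: "\<phi> i x \<in> carrier K" if "i \<in> I" "x \<in> carrier (H i)" for i x
    using hom that by (auto simp: hom_def)
  have ev_closed: "w \<in> fp_words I H \<Longrightarrow> ev w \<in> carrier K" for w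
    by (induction w) (auto simp: ev_def \<phi>_closed)
  have ev_append: "ev (u @ w) = ev u \<otimes>\<^bsub>K\<^esub> ev w" if "u \<in> fp_words I H" "w \<in> fp_words I H" for u w
    using that(1)
  proof (induction u)
    case Nil
    then show ?case using ev_closed[OF that(2)] by (simp add: ev_def)
  next
    case (Cons a u)
    then show ?case using ev_closed[OF that(2)] ev_closed[of u] \<phi>_closed
      by (cases a) (auto simp: ev_def K.m_assoc)
  qed
  have ev_Cons: "ev ((i, x) # w) = \<phi> i x \<otimes>\<^bsub>K\<^esub> ev w" for i x w
    by (simp add: ev_def)
  have ev_rel: "ev u = ev w" if "(u, w) \<in> fp_rel I H" for u w
    using that
  proof (induction rule: fp_rel.induct)
    case (merge u w i x y)
    interpret Hi: group "H i" by (rule factors) fact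
    show ?case using merge hom[of i] ev_closed \<phi>_closed
      by (simp add: ev_append ev_Cons K.m_assoc hom_mult)
  next
    case (unit u w i)
    interpret Hi: group "H i" by (rule factors) fact
    show ?case using unit hom_one[OF hom, of i] ev_closed
      by (simp add: ev_append ev_Cons Hi.is_group K.is_group)
  qed auto
  \<comment> \<open>The choice of a representative is harmless, since \<open>ev\<close> is constant
    on classes by \<open>ev_rel\<close>.\<close>
  define \<Phi> where "\<Phi> A = ev (SOME w. w \<in> A)" for A
  have \<Phi>: "\<Phi> (fp_rel I H `` {w}) = ev w" if "w \<in> fp_words I H" for w
  proof -
    have "w \<in> fp_rel I H `` {w}" using that by (auto intro: fp_rel.refl)
    then have "(SOME u. u \<in> fp_rel I H `` {w}) \<in> fp_rel I H `` {w}" by (rule someI)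
    then show ?thesis by (auto simp: \<Phi>_def dest: ev_rel)
  qed
  have "\<Phi> \<in> hom (free_product I H) K"
    by (rule homI) (auto elim!: fp_class_cases simp: \<Phi> fp_mult_class ev_append ev_closed)
  moreover have "\<Phi> (fp_inj I H i x) = \<phi> i x" if "i \<in> I" "x \<in> carrier (H i)" for i x
    using that by (simp add: fp_inj_def \<Phi> ev_Cons) (simp add: ev_def \<phi>_closed)
  ultimately show ?thesis by (rule that)
qed

end

lemma (in group) hom_eq_on_generate:
  assumes "\<phi> \<in> hom G K" "\<psi> \<in> hom G K" "group K" "S \<subseteq> carrier G" "\<And>s. s \<in> S \<Longrightarrow> \<phi> s = \<psi> s"
    and "g \<in> generate G S"
  shows "\<phi> g = \<psi> g"
proof -
  interpret \<phi>: group_hom G K \<phi> using assms by (simp add: group_hom_def group_hom_axioms_def)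
  interpret \<psi>: group_hom G K \<psi> using assms by (simp add: group_hom_def group_hom_axioms_def)
  show ?thesis using \<open>g \<in> generate G S\<close>
  proof (induction rule: generate.induct)
    case (eng h1 h2)
    then show ?case using generate_in_carrier[OF \<open>S \<subseteq> carrier G\<close>] by simp
  qed (use assms in auto)
qed

lemma (in group) normal_closure_normal: "S \<subseteq> carrier G \<Longrightarrow> normal_closure G S \<lhd> G"
proof (rule normal_invI)
  assume S: "S \<subseteq> carrier G"
  \<comment> \<open>\<open>subgroups_Inter\<close> needs a nonempty family; the whole group belongs
    to it.\<close>
  have "carrier G \<in> {N. N \<lhd> G \<and> S \<subseteq> N}"
    using S subgroup_self by (auto intro!: normal_invI)
  then show "subgroup (normal_closure G S) G"
    unfolding normal_closure_def by (intro subgroups_Inter) (auto intro: normal_imp_subgroup)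
next
  fix x h assume "x \<in> carrier G" "h \<in> normal_closure G S"
  then show "x \<otimes> h \<otimes> inv x \<in> normal_closure G S"
    by (auto simp: normal_closure_def normal_inv_iff)
qed

lemma normal_closure_incl: "S \<subseteq> normal_closure G S"
  by (auto simp: normal_closure_def)

lemma normal_closure_minimal: "N \<lhd> G \<Longrightarrow> S \<subseteq> N \<Longrightarrow> normal_closure G S \<subseteq> N"
  by (auto simp: normal_closure_def)

text \<open>The case \<open>n = 0\<close> is included, as \<open>k mod 0 = k\<close>; finite and
  infinite orders are thereby treated alike.\<close>

lemma (in group) int_pow_mod_exponent:
  assumes "a \<in> carrier G" "a [^] n = \<one>"
  shows "a [^] (k mod n) = a [^] (k::int)"
proof -
  have "a [^] (n * (k div n) + k mod n) = a [^] (n * (k div n)) \<otimes> a [^] (k mod n)"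
    by (rule int_pow_mult[OF assms(1)])
  moreover have "a [^] (n * (k div n)) = \<one>"
    using int_pow_pow[OF assms(1), of n "k div n"] assms(2) by simp
  ultimately show ?thesis using assms by simp
qed

lemma (in group) int_pow_hom_integer_mod_group:
  assumes "a \<in> carrier G" "a [^] int n = \<one>"
  shows "(\<lambda>k. a [^] k) \<in> hom (integer_mod_group n) G"
  using assms by (intro homI) (simp_all add: int_pow_mod_exponent int_pow_mult)

section \<open>Graph products: generators, relations and the universal property\<close>

context labeled_graph
begin

text \<open>The label \<open>\<infinity>\<close> becomes the modulus \<open>0\<close>, since congruence modulo \<open>0\<close> is equality.\<close>

definition modulus :: "'a \<Rightarrow> int" where
  "modulus v = (case lab v of enat k \<Rightarrow> int k | \<infinity> \<Rightarrow> 0)"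

lemma cyclic_eq: "cyclic_group_of_order (lab v) = integer_mod_group (nat (modulus v))"
  by (auto simp: cyclic_group_of_order_def modulus_def integer_mod_group_def split: enat.split)

lemma modulus_nonneg: "modulus v \<ge> 0"
  by (auto simp: modulus_def split: enat.split)

lemma modulus_cases:
  assumes "v \<in> V"
  obtains "modulus v = 0" "lab v = \<infinity>"
  | p a where "Factorial_Ring.prime p" "a > 0" "modulus v = int p ^ a" "lab v = enat (p ^ a)"
proof -
  from labels assms have "lab v = \<infinity> \<or> (\<exists>n. primepow n \<and> lab v = enat n)" by (rule bspec)
  then consider "lab v = \<infinity>" | n where "primepow n" "lab v = enat n" by metis
  then show ?thesis using that by cases (auto simp: modulus_def primepow_def)
qed

text \<open>In a factor of order 1 the letter \<open>1\<close> would fall outside the carrier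
  \<open>{0..<1}\<close>, and a vertex could be trivial.\<close>

lemma modulus_neq_1: "v \<in> V \<Longrightarrow> modulus v \<noteq> 1"
proof (erule modulus_cases)
  fix p a assume "Factorial_Ring.prime (p::nat)" "a > 0" "modulus v = int p ^ a"
  then show "modulus v \<noteq> 1" using prime_gt_1_nat[of p] by auto
qed simp

lemma modulus_eq_imp_lab: "v \<in> V \<Longrightarrow> w \<in> V \<Longrightarrow> modulus v = modulus w \<Longrightarrow> lab v = lab w"
  by (auto elim!: modulus_cases simp flip: of_nat_power)

lemma edge_in_V: "{v, w} \<in> E \<Longrightarrow> v \<in> V \<and> w \<in> V \<and> v \<noteq> w"
  using edges by (auto simp: card_insert_if split: if_splits)

abbreviation (input) FP where "FP \<equiv> vertex_free_product"

lemma cyclic_factors: "group (cyclic_group_of_order (lab v))"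
  by (simp add: cyclic_eq)

lemma group_FP: "group FP"
  unfolding vertex_free_product_def by (intro group_free_product cyclic_factors)

lemma one_in_cyclic: "v \<in> V \<Longrightarrow> 1 \<in> carrier (cyclic_group_of_order (lab v))"
  using modulus_neq_1[of v] modulus_nonneg[of v] by (simp add: cyclic_eq nat_eq_iff)

lemma fp_inj_hom_FP: "v \<in> V \<Longrightarrow>
    fp_inj V (\<lambda>v. cyclic_group_of_order (lab v)) v \<in> hom (cyclic_group_of_order (lab v)) FP"
  unfolding vertex_free_product_def by (intro fp_inj_hom cyclic_factors)

lemma free_vertex_closed: "v \<in> V \<Longrightarrow> free_vertex v \<in> carrier FP"
  using fp_inj_hom_FP[of v] one_in_cyclic[of v] by (auto simp: free_vertex_def hom_def)

text \<open>Every letter of the free product is a power of a vertex letter, so the vertices alone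
  generate.\<close>

lemma free_vertex_pow:
  assumes "v \<in> V" "k \<in> carrier (cyclic_group_of_order (lab v))"
  shows "free_vertex v [^]\<^bsub>FP\<^esub> k = fp_inj V (\<lambda>v. cyclic_group_of_order (lab v)) v k"
proof -
  have "fp_inj V (\<lambda>v. cyclic_group_of_order (lab v)) v
      (1 [^]\<^bsub>cyclic_group_of_order (lab v)\<^esub> k) = free_vertex v [^]\<^bsub>FP\<^esub> k"
    unfolding free_vertex_def using fp_inj_hom_FP one_in_cyclic assms cyclic_factors group_FP
    by (intro hom_int_pow) auto
  \<comment> \<open>A power of \<open>1\<close> is the residue of its exponent, and \<open>k\<close>
    is already reduced as a member of the carrier.\<close>
  moreover have "1 [^]\<^bsub>cyclic_group_of_order (lab v)\<^esub> k = k"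
    using assms(2) by (auto simp: cyclic_eq int_pow_integer_mod_group carrier_integer_mod_group
        simp del: integer_mod_group_1 split: if_splits)
  ultimately show ?thesis by simp
qed

lemma free_vertex_exponent:
  assumes "v \<in> V" shows "free_vertex v [^]\<^bsub>FP\<^esub> modulus v = \<one>\<^bsub>FP\<^esub>"
proof -
  have "fp_inj V (\<lambda>v. cyclic_group_of_order (lab v)) v
      (1 [^]\<^bsub>cyclic_group_of_order (lab v)\<^esub> modulus v) = free_vertex v [^]\<^bsub>FP\<^esub> modulus v"
    unfolding free_vertex_def using fp_inj_hom_FP one_in_cyclic assms cyclic_factors group_FP
    by (intro hom_int_pow) auto
  moreover have "1 [^]\<^bsub>cyclic_group_of_order (lab v)\<^esub> modulus v = \<one>\<^bsub>cyclic_group_of_order (lab v)\<^esub>"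
    using modulus_nonneg[of v] by (simp add: cyclic_eq int_pow_integer_mod_group)
  ultimately show ?thesis
    using hom_one[OF fp_inj_hom_FP cyclic_factors group_FP] assms by simp
qed

lemma edge_commutators_subset: "edge_commutators \<subseteq> carrier FP"
proof -
  interpret group FP by (rule group_FP)
  show ?thesis by (auto simp: edge_commutators_def Let_def free_vertex_closed dest: edge_in_V)
qed

abbreviation (input) N where "N \<equiv> normal_closure FP edge_commutators"

lemma normal_N: "N \<lhd> FP"
  using group.normal_closure_normal[OF group_FP edge_commutators_subset] .

lemma group_G: "group G"
  unfolding graph_product_def by (rule normal.factorgroup_is_group[OF normal_N])

lemma proj_hom: "(\<lambda>g. N #>\<^bsub>FP\<^esub> g) \<in> hom FP G"
  unfolding graph_product_def by (rule normal.r_coset_hom_Mod[OF normal_N])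

end

sublocale labeled_graph \<subseteq> group G by (rule group_G)

context labeled_graph
begin

lemma vertex_closed [simp]: "v \<in> V \<Longrightarrow> vertex v \<in> carrier G"
  using proj_hom free_vertex_closed by (auto simp: vertex_def hom_def)

lemma vertex_pow: "v \<in> V \<Longrightarrow> vertex v [^]\<^bsub>G\<^esub> (k::int) = N #>\<^bsub>FP\<^esub> (free_vertex v [^]\<^bsub>FP\<^esub> k)"
  unfolding vertex_def
  using hom_int_pow[OF proj_hom free_vertex_closed group_FP group_G] by simp

lemma vertex_exponent: "v \<in> V \<Longrightarrow> vertex v [^]\<^bsub>G\<^esub> modulus v = \<one>\<^bsub>G\<^esub>"
  using hom_one[OF proj_hom group_FP group_G] by (simp add: vertex_pow free_vertex_exponent)

lemma vertex_commute:
  assumes "{v, w} \<in> E"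
  shows "vertex v \<otimes>\<^bsub>G\<^esub> vertex w = vertex w \<otimes>\<^bsub>G\<^esub> vertex v"
proof -
  interpret FP: group FP by (rule group_FP)
  interpret pr: group_hom FP G "\<lambda>g. N #>\<^bsub>FP\<^esub> g"
    using proj_hom by unfold_locales
  have vw: "v \<in> V" "w \<in> V" using edge_in_V[OF assms] by auto
  note cl = free_vertex_closed[OF vw(1)] free_vertex_closed[OF vw(2)]
  let ?c = "free_vertex v \<otimes>\<^bsub>FP\<^esub> free_vertex w \<otimes>\<^bsub>FP\<^esub> inv\<^bsub>FP\<^esub> free_vertex v \<otimes>\<^bsub>FP\<^esub> inv\<^bsub>FP\<^esub> free_vertex w"
  have "?c \<in> N"
    using assms normal_closure_incl[of edge_commutators FP]
    by (auto simp: edge_commutators_def Let_def)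
  then have "N #>\<^bsub>FP\<^esub> ?c = \<one>\<^bsub>G\<^esub>"
    using FP.coset_join2[of ?c N] cl normal_imp_subgroup[OF normal_N]
    by (simp add: graph_product_def FactGroup_def)
  moreover have "N #>\<^bsub>FP\<^esub> ?c = vertex v \<otimes>\<^bsub>G\<^esub> vertex w \<otimes>\<^bsub>G\<^esub> inv\<^bsub>G\<^esub> vertex v \<otimes>\<^bsub>G\<^esub> inv\<^bsub>G\<^esub> vertex w"
    using cl by (simp add: vertex_def)
  ultimately have "vertex v \<otimes>\<^bsub>G\<^esub> vertex w \<otimes>\<^bsub>G\<^esub> inv\<^bsub>G\<^esub> vertex v \<otimes>\<^bsub>G\<^esub> inv\<^bsub>G\<^esub> vertex w = \<one>\<^bsub>G\<^esub>"
    by simp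
  then have "vertex v \<otimes>\<^bsub>G\<^esub> vertex w \<otimes>\<^bsub>G\<^esub> inv\<^bsub>G\<^esub> (vertex w \<otimes>\<^bsub>G\<^esub> vertex v) = \<one>\<^bsub>G\<^esub>"
    using vw by (simp add: inv_mult_group m_assoc)
  then show ?thesis using vw by (metis inv_equality inv_inv m_closed inv_closed vertex_closed)
qed

lemma generate_vertices: "carrier G = generate G (vertex ` V)"
proof
  interpret FP: group FP by (rule group_FP)
  interpret pr: group_hom FP G "\<lambda>g. N #>\<^bsub>FP\<^esub> g"
    using proj_hom by unfold_locales
  have sub: "vertex ` V \<subseteq> carrier G" by auto
  let ?C = "\<lambda>v. cyclic_group_of_order (lab v)"
  let ?S = "\<Union>v\<in>V. fp_inj V ?C v ` carrier (?C v)"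
  have carr: "carrier FP = generate FP ?S"
    unfolding vertex_free_product_def by (intro fp_generate cyclic_factors)
  have "N #>\<^bsub>FP\<^esub> g \<in> generate G (vertex ` V)" if "g \<in> generate FP ?S" for g
    using that
  proof (induction rule: generate.induct)
    case one
    then show ?case using generate.one[of G] by simp
  next
    case (incl h)
    then obtain v k where "v \<in> V" "h = free_vertex v [^]\<^bsub>FP\<^esub> (k::int)"
      by (auto simp flip: free_vertex_pow)
    then show ?case using subgroup_int_pow_closed[OF generate_is_subgroup[OF sub]]
      by (simp add: vertex_pow[symmetric] generate.incl)
  next
    case (inv h)
    then obtain v k where "v \<in> V" "h = free_vertex v [^]\<^bsub>FP\<^esub> (k::int)"
      by (auto simp flip: free_vertex_pow)
    then have "inv\<^bsub>FP\<^esub> h = free_vertex v [^]\<^bsub>FP\<^esub> (- k)" "v \<in> V"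
      by (simp_all add: FP.int_pow_neg free_vertex_closed)
    then show ?case using subgroup_int_pow_closed[OF generate_is_subgroup[OF sub]]
      by (simp only: vertex_pow[symmetric]) (simp add: generate.incl)
  next
    case (eng h1 h2)
    then show ?case using carr by (simp add: generate.eng)
  qed
  then show "carrier G \<subseteq> generate G (vertex ` V)"
    unfolding graph_product_def FactGroup_def by (auto simp: RCOSETS_def carr)
  show "generate G (vertex ` V) \<subseteq> carrier G" by (rule generate_incl[OF sub])
qed

text \<open>The source of the maps \<open>coord\<close>, of the action behind \<open>sector\<close>
  and of the endomorphisms \<open>endo\<close>. For a vertex of infinite order the exponent
  condition concerns a zeroth power and holds trivially.\<close>

lemma graph_product_universal:
  assumes "group K" and closed: "\<And>v. v \<in> V \<Longrightarrow> \<phi> v \<in> carrier K"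
    and exponent: "\<And>v. v \<in> V \<Longrightarrow> \<phi> v [^]\<^bsub>K\<^esub> modulus v = \<one>\<^bsub>K\<^esub>"
    and commute: "\<And>v w. {v, w} \<in> E \<Longrightarrow> \<phi> v \<otimes>\<^bsub>K\<^esub> \<phi> w = \<phi> w \<otimes>\<^bsub>K\<^esub> \<phi> v"
  obtains \<theta> where "\<theta> \<in> hom G K" "\<And>v. v \<in> V \<Longrightarrow> \<theta> (vertex v) = \<phi> v"
proof -
  interpret K: group K by fact
  let ?C = "\<lambda>v. cyclic_group_of_order (lab v)"
  have "(\<lambda>k. \<phi> v [^]\<^bsub>K\<^esub> k) \<in> hom (?C v) K" if "v \<in> V" for v
    using that exponent closed modulus_nonneg[of v] unfolding cyclic_eq
    by (intro K.int_pow_hom_integer_mod_group) auto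
  from free_product_universal[where I = V and H = ?C, OF cyclic_factors \<open>group K\<close> this]
  obtain \<Phi> where \<Phi>: "\<Phi> \<in> hom (free_product V ?C) K"
    "\<And>v k. v \<in> V \<Longrightarrow> k \<in> carrier (?C v) \<Longrightarrow> \<Phi> (fp_inj V ?C v k) = \<phi> v [^]\<^bsub>K\<^esub> k"
    by blast
  note \<Phi> = \<Phi>[folded vertex_free_product_def]
  interpret \<Phi>: group_hom FP K \<Phi>
    using group_FP \<Phi>(1) by (simp add: group_hom_def group_hom_axioms_def K.is_group)
  have \<Phi>_vertex: "\<Phi> (free_vertex v) = \<phi> v" if "v \<in> V" for v
    using \<Phi>(2)[OF that one_in_cyclic[OF that]] closed[OF that] by (simp add: free_vertex_def)
  have "edge_commutators \<subseteq> kernel FP K \<Phi>"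
  proof
    fix c assume "c \<in> edge_commutators"
    then obtain x y where c: "{x, y} \<in> E" "c = free_vertex x \<otimes>\<^bsub>FP\<^esub> free_vertex y \<otimes>\<^bsub>FP\<^esub>
        inv\<^bsub>FP\<^esub> free_vertex x \<otimes>\<^bsub>FP\<^esub> inv\<^bsub>FP\<^esub> free_vertex y"
      by (auto simp: edge_commutators_def Let_def)
    have xy: "x \<in> V" "y \<in> V" using edge_in_V[OF c(1)] by auto
    have "\<Phi> c = \<phi> x \<otimes>\<^bsub>K\<^esub> \<phi> y \<otimes>\<^bsub>K\<^esub> inv\<^bsub>K\<^esub> \<phi> x \<otimes>\<^bsub>K\<^esub> inv\<^bsub>K\<^esub> \<phi> y"
      using xy by (simp add: c(2) free_vertex_closed \<Phi>_vertex)
    also have "\<dots> = \<phi> x \<otimes>\<^bsub>K\<^esub> \<phi> y \<otimes>\<^bsub>K\<^esub> inv\<^bsub>K\<^esub> (\<phi> y \<otimes>\<^bsub>K\<^esub> \<phi> x)"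
      using xy closed by (simp add: K.inv_mult_group K.m_assoc)
    also have "\<dots> = \<one>\<^bsub>K\<^esub>"
      using xy closed by (simp add: commute[OF c(1)])
    finally show "c \<in> kernel FP K \<Phi>"
      using xy closed by (simp add: kernel_def c(2) free_vertex_closed)
  qed
  then have "N \<subseteq> kernel FP K \<Phi>" by (intro normal_closure_minimal \<Phi>.normal_kernel)
  from \<Phi>.FactGroup_universal_kernel[OF normal_N this] obtain \<theta> where
    \<theta>: "\<theta> \<in> hom (FP Mod N) K" "\<And>x. x \<in> carrier FP \<Longrightarrow> \<theta> (N #>\<^bsub>FP\<^esub> x) = \<Phi> x" by blast
  show ?thesis
  proof (rule that)
    show "\<theta> \<in> hom G K" unfolding graph_product_def by (rule \<theta>(1))
    show "\<theta> (vertex v) = \<phi> v" if "v \<in> V" for v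
      unfolding vertex_def using \<theta>(2)[OF free_vertex_closed[OF that]] \<Phi>_vertex[OF that] by simp
  qed
qed

lemma hom_eqI:
  assumes "group K" "\<phi> \<in> hom G K" "\<psi> \<in> hom G K" "\<And>v. v \<in> V \<Longrightarrow> \<phi> (vertex v) = \<psi> (vertex v)"
    and "g \<in> carrier G"
  shows "\<phi> g = \<psi> g"
proof (rule hom_eq_on_generate[OF assms(2,3,1)])
  show "vertex ` V \<subseteq> carrier G" by auto
  show "g \<in> generate G (vertex ` V)" using assms(5) generate_vertices by simp
qed (use assms(4) in auto)

end

lemma (in group) inv_mult_cancel [simp]:
  assumes "g \<in> carrier G" "h \<in> carrier G"
  shows "g \<otimes> (inv g \<otimes> h) = h" "inv g \<otimes> (g \<otimes> h) = h"
  using assms by (simp_all add: m_assoc[symmetric])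

lemma (in group) conj_hom: "g \<in> carrier G \<Longrightarrow> (\<lambda>h. inv g \<otimes> h \<otimes> g) \<in> hom G G"
  by (intro homI) (simp_all add: m_assoc)

lemma (in group) conj_int_pow:
  "g \<in> carrier G \<Longrightarrow> h \<in> carrier G \<Longrightarrow> (inv g \<otimes> h \<otimes> g) [^] (k :: int) = inv g \<otimes> h [^] k \<otimes> g"
  using hom_int_pow[OF conj_hom _ is_group is_group, of g h k] by simp

lemma (in group) commute_pow:
  assumes "x \<in> carrier G" "y \<in> carrier G" "x \<otimes> y = y \<otimes> x"
  shows "x [^] (k :: int) \<otimes> y = y \<otimes> x [^] k"
proof -
  have "inv y \<otimes> x [^] k \<otimes> y = x [^] k"
    using assms conj_int_pow[of y x k] by (simp add: m_assoc)
  then have "y \<otimes> (inv y \<otimes> x [^] k \<otimes> y) = y \<otimes> x [^] k" by simp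
  then show ?thesis using assms by (simp add: m_assoc)
qed

context labeled_graph
begin

subsection \<open>Exponent sums\<close>

text \<open>The \<open>y\<close>-component of the abelianisation. The choice is unique on
  \<open>G\<close>, as the vertices generate it. Values are reduced residues, or arbitrary integers
  for modulus 0, so congruent coordinates are equal.\<close>

definition coord :: "'a \<Rightarrow> ('a \<times> int) list set set \<Rightarrow> int" where
  "coord y = (SOME \<epsilon>. \<epsilon> \<in> hom G (integer_mod_group (nat (modulus y))) \<and>
    (\<forall>v\<in>V. \<epsilon> (vertex v) = (if v = y then 1 else 0)))"

lemma coord:
  assumes "y \<in> V"
  shows coord_hom: "coord y \<in> hom G (integer_mod_group (nat (modulus y)))"
    and coord_vertex: "v \<in> V \<Longrightarrow> coord y (vertex v) = (if v = y then 1 else 0)"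
proof -
  let ?C = "integer_mod_group (nat (modulus y))"
  obtain \<epsilon> where "\<epsilon> \<in> hom G ?C" "\<And>v. v \<in> V \<Longrightarrow> \<epsilon> (vertex v) = (if v = y then 1 else 0)"
  proof (rule graph_product_universal)
    show "group ?C" by simp
    show "(if v = y then 1 else 0) \<in> carrier ?C" for v
      using modulus_neq_1[OF assms] modulus_nonneg[of y] by (simp add: nat_eq_iff)
    show "(if v = y then 1 else 0) [^]\<^bsub>?C\<^esub> modulus v = \<one>\<^bsub>?C\<^esub>" if "v \<in> V" for v
      using modulus_nonneg[of y] by (simp add: int_pow_integer_mod_group)
  qed (auto simp: add.commute)
  then have "\<exists>\<epsilon>. \<epsilon> \<in> hom G ?C \<and> (\<forall>v\<in>V. \<epsilon> (vertex v) = (if v = y then 1 else 0))"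
    by blast
  from someI_ex[OF this]
  show "coord y \<in> hom G ?C" "v \<in> V \<Longrightarrow> coord y (vertex v) = (if v = y then 1 else 0)"
    by (auto simp: coord_def)
qed

context
  fixes y assumes y: "y \<in> V"
begin

interpretation cyc: group "integer_mod_group (nat (modulus y))" by simp

interpretation co: group_hom G "integer_mod_group (nat (modulus y))" "coord y"
  using coord_hom[OF y] by unfold_locales

lemma coord_mult: "g \<in> carrier G \<Longrightarrow> h \<in> carrier G \<Longrightarrow>
    coord y (g \<otimes>\<^bsub>G\<^esub> h) = (coord y g + coord y h) mod modulus y"
  using modulus_nonneg[of y] by simp

lemma coord_one [simp]: "coord y \<one>\<^bsub>G\<^esub> = 0"
  using co.hom_one by simp

lemma coord_pow: "g \<in> carrier G \<Longrightarrow> coord y (g [^]\<^bsub>G\<^esub> k) = (k * coord y g) mod modulus y" for k :: int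
  using modulus_nonneg[of y] by (simp add: co.hom_int_pow int_pow_integer_mod_group)

lemma coord_inv: "g \<in> carrier G \<Longrightarrow> coord y (inv\<^bsub>G\<^esub> g) = (- coord y g) mod modulus y"
  using coord_pow[of g "-1"] by (simp add: int_pow_neg)

lemma coord_mod: "g \<in> carrier G \<Longrightarrow> coord y g mod modulus y = coord y g"
  using coord_pow[of g 1] by simp

lemma coord_vertex_pow:
  "v \<in> V \<Longrightarrow> coord y (vertex v [^]\<^bsub>G\<^esub> k) = (if v = y then k mod modulus y else 0)" for k :: int
  by (simp add: coord_pow coord_vertex[OF y])

lemma coord_conj: "g \<in> carrier G \<Longrightarrow> h \<in> carrier G \<Longrightarrow>
    coord y (inv\<^bsub>G\<^esub> g \<otimes>\<^bsub>G\<^esub> h \<otimes>\<^bsub>G\<^esub> g) = coord y h"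
  by (simp add: coord_mult coord_inv mod_simps coord_mod)

text \<open>\<open>coord y\<close> detects the order of the vertex, so its cyclic group survives in
  \<open>G\<close> without collapsing.\<close>

lemma vertex_pow_eq_one_iff: "vertex y [^]\<^bsub>G\<^esub> k = \<one>\<^bsub>G\<^esub> \<longleftrightarrow> modulus y dvd k" for k :: int
proof
  assume "vertex y [^]\<^bsub>G\<^esub> k = \<one>\<^bsub>G\<^esub>"
  then have "k mod modulus y = 0" using coord_vertex_pow[OF y, of k] by simp
  then show "modulus y dvd k" by auto
next
  assume "modulus y dvd k"
  then obtain j where "k = modulus y * j" by blast
  then show "vertex y [^]\<^bsub>G\<^esub> k = \<one>\<^bsub>G\<^esub>"
    using int_pow_pow[of "vertex y" "modulus y" j] y by (simp add: vertex_exponent)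
qed

lemma vertex_neq_one: "vertex y \<noteq> \<one>\<^bsub>G\<^esub>"
  using coord_vertex[OF y y] by auto

lemma vertex_pow_mod: "vertex y [^]\<^bsub>G\<^esub> (k mod modulus y) = vertex y [^]\<^bsub>G\<^esub> k" for k :: int
  using y by (simp add: int_pow_mod_exponent vertex_exponent)

end

subsection \<open>Words in syllables\<close>

text \<open>A syllable counts once in the length, whatever its exponent. The minimal length is thus
  a distance in the Cayley graph in which all powers of one vertex are single steps, and crossing a
  wall costs one syllable.\<close>

definition ev :: "('a \<times> int) list \<Rightarrow> ('a \<times> int) list set set" where
  "ev ws = foldr (\<lambda>(v, k) g. vertex v [^]\<^bsub>G\<^esub> k \<otimes>\<^bsub>G\<^esub> g) ws \<one>\<^bsub>G\<^esub>"

lemma ev_Nil [simp]: "ev [] = \<one>\<^bsub>G\<^esub>"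
  and ev_Cons [simp]: "ev ((v, k) # ws) = vertex v [^]\<^bsub>G\<^esub> k \<otimes>\<^bsub>G\<^esub> ev ws"
  by (simp_all add: ev_def)

lemma ev_closed [simp]: "ws \<in> lists (V \<times> UNIV) \<Longrightarrow> ev ws \<in> carrier G"
  by (induction ws) auto

lemma ev_append [simp]:
  "us \<in> lists (V \<times> UNIV) \<Longrightarrow> ws \<in> lists (V \<times> UNIV) \<Longrightarrow> ev (us @ ws) = ev us \<otimes>\<^bsub>G\<^esub> ev ws"
proof (induction us)
  case (Cons a us)
  then show ?case by (cases a) (simp add: m_assoc)
qed simp

lemma W_subgroup: "B \<subseteq> V \<Longrightarrow> subgroup (W B) G"
  unfolding W_def by (rule generate_is_subgroup) auto

lemma W_eq_ev:
  assumes "B \<subseteq> V" shows "W B = ev ` lists (B \<times> UNIV)"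
proof -
  have mono: "ws \<in> lists (B \<times> UNIV) \<Longrightarrow> ws \<in> lists (V \<times> UNIV)" for ws :: "('a \<times> int) list"
    using assms by (auto simp: in_lists_conv_set)
  have gen: "vertex v [^]\<^bsub>G\<^esub> k \<in> W B" if "v \<in> B" for v and k :: int
    using that by (intro subgroup_int_pow_closed[OF W_subgroup[OF assms]]) (auto simp: W_def generate.incl)
  have "ev ws \<in> W B" if "ws \<in> lists (B \<times> UNIV)" for ws
    using that
  proof (induction ws)
    case (Cons a ws)
    then show ?case using gen subgroup.m_closed[OF W_subgroup[OF assms]] by (cases a) auto
  qed (simp add: W_def generate.one)
  moreover have "g \<in> ev ` lists (B \<times> UNIV)" if "g \<in> W B" for g
    using that unfolding W_def
  proof (induction rule: generate.induct)
    case one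
    show ?case by (rule image_eqI[of _ _ "[]"]) simp_all
  next
    case (incl h)
    then obtain v where v: "v \<in> B" "h = vertex v" by blast
    then show ?case using assms by (intro image_eqI[of _ _ "[(v, 1)]"]) (simp_all add: subset_iff)
  next
    case (inv h)
    then obtain v where v: "v \<in> B" "h = vertex v" by blast
    then show ?case using assms
      by (intro image_eqI[of _ _ "[(v, -1)]"]) (simp_all add: subset_iff int_pow_neg)
  next
    case (eng h1 h2)
    then obtain us ws where *: "us \<in> lists (B \<times> UNIV)" "h1 = ev us" "ws \<in> lists (B \<times> UNIV)" "h2 = ev ws"
      by blast
    then have "h1 \<otimes>\<^bsub>G\<^esub> h2 = ev (us @ ws)" using mono by simp
    then show ?case using * by (intro image_eqI[of _ _ "us @ ws"]) simp_all
  qed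
  ultimately show ?thesis by blast
qed

lemma W_V: "W V = carrier G"
  using generate_vertices by (simp add: W_def)

lemma W_closed: "B \<subseteq> V \<Longrightarrow> g \<in> W B \<Longrightarrow> g \<in> carrier G"
  using subgroup.mem_carrier[OF W_subgroup] .

lemma vertex_in_W: "v \<in> B \<Longrightarrow> vertex v \<in> W B"
  by (simp add: W_def generate.incl)

lemma vertex_pow_in_W: "B \<subseteq> V \<Longrightarrow> v \<in> B \<Longrightarrow> vertex v [^]\<^bsub>G\<^esub> (k :: int) \<in> W B"
  by (rule subgroup_int_pow_closed[OF W_subgroup vertex_in_W])

lemma W_mono: "B \<subseteq> C \<Longrightarrow> W B \<subseteq> W C"
  unfolding W_def by (intro mono_generate) auto

text \<open>Prepending whole syllables avoids a separate case for inverses and matches the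
  recursions of \<open>sector\<close> and \<open>side\<close>.\<close>

lemma W_induct [consumes 2, case_names one step]:
  assumes "g \<in> W B" "B \<subseteq> V" "P \<one>\<^bsub>G\<^esub>"
    and "\<And>v k g. v \<in> B \<Longrightarrow> g \<in> W B \<Longrightarrow> P g \<Longrightarrow> P (vertex v [^]\<^bsub>G\<^esub> (k :: int) \<otimes>\<^bsub>G\<^esub> g)"
  shows "P g"
proof -
  obtain ws where "ws \<in> lists (B \<times> UNIV)" "g = ev ws" using assms(1,2) W_eq_ev by blast
  moreover have "P (ev ws)" if "ws \<in> lists (B \<times> UNIV)" for ws
    using that
  proof (induction ws)
    case (Cons a ws)
    then have "ev ws \<in> W B" using W_eq_ev[OF assms(2)] by auto
    then show ?case using Cons assms(4) by (cases a) auto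
  qed (simp add: assms)
  ultimately show ?thesis by simp
qed

lemma carrier_induct [consumes 1, case_names one step]:
  assumes "g \<in> carrier G" "P \<one>\<^bsub>G\<^esub>"
    and "\<And>v k g. v \<in> V \<Longrightarrow> g \<in> carrier G \<Longrightarrow> P g \<Longrightarrow> P (vertex v [^]\<^bsub>G\<^esub> (k :: int) \<otimes>\<^bsub>G\<^esub> g)"
  shows "P g"
  using assms W_induct[of g V P] by (simp add: W_V)

lemma link_subset: "link v \<subseteq> V" and star_subset: "v \<in> V \<Longrightarrow> star v \<subseteq> V"
  by (auto simp: link_def star_def)

lemma self_in_star [simp]: "v \<in> star v"
  by (simp add: star_def)

lemma in_star_iff: "w \<in> star v \<longleftrightarrow> w = v \<or> {v, w} \<in> E"
  using edge_in_V[of v w] by (auto simp: star_def link_def)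

lemma star_sym: "w \<in> star v \<longleftrightarrow> v \<in> star w"
  by (auto simp: in_star_iff insert_commute)

text \<open>The easy half of the description of the centralizer of \<open>y\<close>; the other half
  is \<open>centralizer_vertex\<close>.\<close>

lemma W_star_commute:
  assumes "y \<in> V" "h \<in> W (star y)"
  shows "h \<otimes>\<^bsub>G\<^esub> vertex y = vertex y \<otimes>\<^bsub>G\<^esub> h"
  using assms(2) star_subset[OF assms(1)]
proof (induction rule: W_induct)
  case one
  then show ?case using assms by simp
next
  case (step v k g)
  have v: "v \<in> V" and g: "g \<in> carrier G"
    using step star_subset[OF assms(1)] W_closed by auto
  have "vertex v \<otimes>\<^bsub>G\<^esub> vertex y = vertex y \<otimes>\<^bsub>G\<^esub> vertex v"
    using step(1) vertex_commute[of y v] by (auto simp: in_star_iff)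
  then have "vertex v [^]\<^bsub>G\<^esub> k \<otimes>\<^bsub>G\<^esub> vertex y = vertex y \<otimes>\<^bsub>G\<^esub> vertex v [^]\<^bsub>G\<^esub> k"
    using v assms by (intro commute_pow) auto
  then show ?case using step v g assms
    by (simp add: m_assoc) (simp add: m_assoc[symmetric])
qed

subsection \<open>Sectors of a wall\<close>

text \<open>
  \<open>sector y\<close> is the projection of the Cayley graph of \<open>G\<close> onto the group generated by \<open>y\<close>.
  It changes only along the edges labelled \<open>y\<close> that start in \<open>W (star y)\<close>; these form the wall of
  \<open>y\<close>. Instead of using normal forms it is obtained from an action of \<open>G\<close> on pairs \<open>(a, g)\<close>, where
  \<open>g\<close> is the current vertex of the Cayley graph and \<open>a\<close> collects the crossings of the wall.
\<close>

definition cross :: "'a \<Rightarrow> 'a \<Rightarrow> int \<Rightarrow>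
    ('a \<times> int) list set set \<times> ('a \<times> int) list set set \<Rightarrow>
    ('a \<times> int) list set set \<times> ('a \<times> int) list set set" where
  "cross y v k = (\<lambda>(a, g)\<in>carrier G \<times> carrier G.
    (if v = y \<and> g \<in> W (star y) then vertex v [^]\<^bsub>G\<^esub> k \<otimes>\<^bsub>G\<^esub> a else a, vertex v [^]\<^bsub>G\<^esub> k \<otimes>\<^bsub>G\<^esub> g))"

lemma W_mult_left_iff:
  assumes "B \<subseteq> V" "u \<in> W B" "g \<in> carrier G"
  shows "u \<otimes>\<^bsub>G\<^esub> g \<in> W B \<longleftrightarrow> g \<in> W B"
proof
  interpret subgroup "W B" G by (rule W_subgroup[OF assms(1)])
  show "g \<in> W B \<Longrightarrow> u \<otimes>\<^bsub>G\<^esub> g \<in> W B" using assms by simp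
  assume "u \<otimes>\<^bsub>G\<^esub> g \<in> W B"
  then have "inv\<^bsub>G\<^esub> u \<otimes>\<^bsub>G\<^esub> (u \<otimes>\<^bsub>G\<^esub> g) \<in> W B" using assms by (intro m_closed[of _ "u \<otimes>\<^bsub>G\<^esub> g"]) auto
  moreover have "inv\<^bsub>G\<^esub> u \<otimes>\<^bsub>G\<^esub> (u \<otimes>\<^bsub>G\<^esub> g) = g" using assms by simp
  ultimately show "g \<in> W B" by (simp only:)
qed

lemma W_mult_right_iff:
  assumes "B \<subseteq> V" "u \<in> W B" "g \<in> carrier G"
  shows "g \<otimes>\<^bsub>G\<^esub> u \<in> W B \<longleftrightarrow> g \<in> W B"
proof
  interpret subgroup "W B" G by (rule W_subgroup[OF assms(1)])
  show "g \<in> W B \<Longrightarrow> g \<otimes>\<^bsub>G\<^esub> u \<in> W B" using assms by simp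
  assume "g \<otimes>\<^bsub>G\<^esub> u \<in> W B"
  then have "g \<otimes>\<^bsub>G\<^esub> u \<otimes>\<^bsub>G\<^esub> inv\<^bsub>G\<^esub> u \<in> W B" using assms by (intro m_closed[of "g \<otimes>\<^bsub>G\<^esub> u"]) auto
  moreover have "g \<otimes>\<^bsub>G\<^esub> u \<otimes>\<^bsub>G\<^esub> inv\<^bsub>G\<^esub> u = g" using assms by (simp add: m_assoc)
  ultimately show "g \<in> W B" by (simp only:)
qed

context
  fixes y assumes y: "y \<in> V"
begin

interpretation BG: group "BijGroup (carrier G \<times> carrier G)" by (rule group_BijGroup)

lemma cross_funcset: "v \<in> V \<Longrightarrow> p \<in> carrier G \<times> carrier G \<Longrightarrow> cross y v k p \<in> carrier G \<times> carrier G"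
  by (auto simp: cross_def split: prod.splits)

lemma cross_add:
  assumes "v \<in> V" "p \<in> carrier G \<times> carrier G"
  shows "cross y v j (cross y v k p) = cross y v (j + k) p"
proof -
  \<comment> \<open>A step along \<open>y\<close> neither enters nor leaves
    \<open>W (star y)\<close>, so both crossings are subject to the same test.\<close>
  have "v = y \<Longrightarrow> g \<in> carrier G \<Longrightarrow> vertex v [^]\<^bsub>G\<^esub> k \<otimes>\<^bsub>G\<^esub> g \<in> W (star y) \<longleftrightarrow> g \<in> W (star y)" for g
    using y by (intro W_mult_left_iff star_subset vertex_pow_in_W) auto
  then show ?thesis using assms
    by (auto simp: cross_def int_pow_mult m_assoc split: prod.splits)
qed

lemma cross_zero: "v \<in> V \<Longrightarrow> p \<in> carrier G \<times> carrier G \<Longrightarrow> cross y v 0 p = p"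
  by (auto simp: cross_def split: prod.splits)

lemma cross_Bij:
  assumes v: "v \<in> V" shows "cross y v k \<in> Bij (carrier G \<times> carrier G)"
proof -
  have "bij_betw (cross y v k) (carrier G \<times> carrier G) (carrier G \<times> carrier G)"
    by (intro bij_betw_byWitness[where f' = "cross y v (- k)"] ballI image_subsetI)
      (simp_all add: cross_funcset[OF v] cross_add[OF v] cross_zero[OF v] del: mem_Sigma_iff)
  then show ?thesis by (simp add: Bij_def cross_def)
qed

lemma cross_mult:
  assumes v: "v \<in> V"
  shows "cross y v j \<otimes>\<^bsub>BijGroup (carrier G \<times> carrier G)\<^esub> cross y v k = cross y v (j + k)"
proof -
  have "compose (carrier G \<times> carrier G) (cross y v j) (cross y v k) = cross y v (j + k)"
    using cross_add[OF v, of _ j k] by (intro ext) (simp add: compose_def, simp add: cross_def)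
  then show ?thesis using cross_Bij[OF v] by (simp add: BijGroup_def)
qed

lemma cross_nat_pow:
  assumes v: "v \<in> V"
  shows "cross y v 1 [^]\<^bsub>BijGroup (carrier G \<times> carrier G)\<^esub> n = cross y v (int n)"
proof (induction n)
  case 0
  have "(\<lambda>x\<in>carrier G \<times> carrier G. x) = cross y v 0"
    using cross_zero[OF v] by (intro ext) (auto simp: cross_def)
  then show ?case by (simp add: BijGroup_def)
next
  case (Suc n)
  then show ?case by (simp add: cross_mult[OF v] add.commute)
qed

text \<open>If one of the two vertices is \<open>y\<close>, then the other lies in
  \<open>star y\<close> and does not affect the test for crossing. If neither is, nothing is
  collected.\<close>

lemma cross_commute:
  assumes "{v, w} \<in> E" "p \<in> carrier G \<times> carrier G"
  shows "cross y v 1 (cross y w 1 p) = cross y w 1 (cross y v 1 p)"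
proof -
  have vw: "v \<in> V" "w \<in> V" "v \<noteq> w" using edge_in_V[OF assms(1)] by auto
  have inW: "vertex u \<otimes>\<^bsub>G\<^esub> g \<in> W (star y) \<longleftrightarrow> g \<in> W (star y)"
    if "u \<in> star y" "g \<in> carrier G" for u g
    using that y by (intro W_mult_left_iff star_subset vertex_in_W) auto
  have "w \<in> star v" "v \<in> star w" using assms(1) by (auto simp: in_star_iff insert_commute)
  moreover obtain a g where "p = (a, g)" "a \<in> carrier G" "g \<in> carrier G" using assms(2) by auto
  moreover have "vertex v \<otimes>\<^bsub>G\<^esub> (vertex w \<otimes>\<^bsub>G\<^esub> g) = vertex w \<otimes>\<^bsub>G\<^esub> (vertex v \<otimes>\<^bsub>G\<^esub> g)"
    if "g \<in> carrier G" for g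
    using that vw vertex_commute[OF assms(1)] by (simp add: m_assoc[symmetric])
  ultimately show ?thesis using vw inW by (auto simp: cross_def)
qed

lemma sector_exists:
  "\<exists>s. s \<one>\<^bsub>G\<^esub> = \<one>\<^bsub>G\<^esub> \<and> (\<forall>v\<in>V. \<forall>k. \<forall>h\<in>carrier G. s (vertex v [^]\<^bsub>G\<^esub> (k :: int) \<otimes>\<^bsub>G\<^esub> h) =
    (if v = y \<and> h \<in> W (star y) then vertex y [^]\<^bsub>G\<^esub> k \<otimes>\<^bsub>G\<^esub> s h else s h))"
proof -
  let ?S = "carrier G \<times> carrier G"
  obtain \<rho> where \<rho>: "\<rho> \<in> hom G (BijGroup ?S)" "\<And>v. v \<in> V \<Longrightarrow> \<rho> (vertex v) = cross y v 1"
  proof (rule graph_product_universal)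
    show "group (BijGroup ?S)" by (rule group_BijGroup)
    show "cross y v 1 \<in> carrier (BijGroup ?S)" if "v \<in> V" for v
      using cross_Bij[OF that] by (simp add: BijGroup_def)
    show "cross y v 1 [^]\<^bsub>BijGroup ?S\<^esub> modulus v = \<one>\<^bsub>BijGroup ?S\<^esub>" if v: "v \<in> V" for v
    proof -
      obtain n where n: "modulus v = int n" using modulus_nonneg[of v] nonneg_int_cases by blast
      \<comment> \<open>\<open>cross\<close> depends on \<open>k\<close> only through the power of
        \<open>vertex v\<close>, so it inherits the order of that vertex.\<close>
      have "vertex v [^]\<^bsub>G\<^esub> modulus v = vertex v [^]\<^bsub>G\<^esub> (0 :: int)" using vertex_exponent[OF v] by simp
      then have "cross y v (modulus v) = cross y v 0" by (simp only: cross_def)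
      then show ?thesis using cross_nat_pow[OF v, of n] cross_nat_pow[OF v, of 0]
        by (simp add: n int_pow_int)
    qed
    show "cross y v 1 \<otimes>\<^bsub>BijGroup ?S\<^esub> cross y w 1 = cross y w 1 \<otimes>\<^bsub>BijGroup ?S\<^esub> cross y v 1"
      if e: "{v, w} \<in> E" for v w
      using edge_in_V[OF e] cross_Bij cross_commute[OF e]
      by (auto simp: BijGroup_def compose_def simp del: mem_Sigma_iff)
  qed blast
  interpret \<rho>: group_hom G "BijGroup ?S" \<rho>
    using \<rho>(1) by unfold_locales
  have \<rho>_pow: "\<rho> (vertex v [^]\<^bsub>G\<^esub> k) = cross y v k" if v: "v \<in> V" for v and k :: int
  proof (cases k rule: int_cases2)
    case (nonneg n)
    then show ?thesis using v \<rho>(2) \<rho>.hom_int_pow[of "vertex v" k] cross_nat_pow[OF v, of n]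
      by (simp add: int_pow_int)
  next
    case (nonpos n)
    have "cross y v k \<otimes>\<^bsub>BijGroup ?S\<^esub> cross y v (int n) = cross y v 0"
      using nonpos by (simp add: cross_mult[OF v])
    also have "cross y v 0 = \<one>\<^bsub>BijGroup ?S\<^esub>" using cross_nat_pow[OF v, of 0] by simp
    finally have "inv\<^bsub>BijGroup ?S\<^esub> (cross y v (int n)) = cross y v k"
      using cross_Bij[OF v] by (intro BG.inv_equality) (simp_all add: BijGroup_def)
    moreover have "\<rho> (vertex v [^]\<^bsub>G\<^esub> k) = inv\<^bsub>BijGroup ?S\<^esub> (\<rho> (vertex v) [^]\<^bsub>BijGroup ?S\<^esub> n)"
      using v nonpos by (simp add: \<rho>.hom_int_pow BG.int_pow_neg_int)
    ultimately show ?thesis using \<rho>(2)[OF v] cross_nat_pow[OF v, of n] by simp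
  qed
  have \<rho>_Bij: "g \<in> carrier G \<Longrightarrow> \<rho> g \<in> Bij ?S" for g
    using \<rho>.hom_closed[of g] by (simp add: BijGroup_def)
  \<comment> \<open>The orbit of the base point. The second entry of \<open>p h\<close> will be
    \<open>h\<close> itself, so the test in \<open>cross\<close> concerns \<open>h\<close>, and the
    first entry is a function of \<open>h\<close> with the desired recursion.\<close>
  define p where "p h = \<rho> h (\<one>\<^bsub>G\<^esub>, \<one>\<^bsub>G\<^esub>)" for h
  have p_closed: "p h \<in> ?S" if "h \<in> carrier G" for h
    using Bij_imp_funcset[OF \<rho>_Bij[OF that]] by (auto simp: p_def)
  have p_step: "p (vertex v [^]\<^bsub>G\<^esub> k \<otimes>\<^bsub>G\<^esub> h) = cross y v k (p h)" if "v \<in> V" "h \<in> carrier G" for v h and k :: int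
    using that \<rho>_pow[OF that(1)] cross_Bij[OF that(1)] \<rho>_Bij[OF that(2)]
    by (simp add: p_def BijGroup_def compose_def)
  have p_one: "p \<one>\<^bsub>G\<^esub> = (\<one>\<^bsub>G\<^esub>, \<one>\<^bsub>G\<^esub>)"
    using \<rho>.hom_one by (simp add: p_def BijGroup_def)
  have snd_p: "snd (p h) = h" if "h \<in> carrier G" for h
    using that
  proof (induction rule: carrier_induct)
    case (step v k g)
    then show ?case using p_step[of v g k] p_closed[of g]
      by (cases "p g") (auto simp: cross_def)
  qed (simp add: p_one)
  show ?thesis
  proof (intro exI[of _ "\<lambda>h. fst (p h)"] conjI ballI allI)
    fix v h and k :: int assume "v \<in> V" "h \<in> carrier G"
    then show "fst (p (vertex v [^]\<^bsub>G\<^esub> k \<otimes>\<^bsub>G\<^esub> h)) =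
      (if v = y \<and> h \<in> W (star y) then vertex y [^]\<^bsub>G\<^esub> k \<otimes>\<^bsub>G\<^esub> fst (p h) else fst (p h))"
      using p_step[of v h k] p_closed[of h] snd_p[of h] by (cases "p h") (auto simp: cross_def)
  qed (simp add: p_one)
qed

end

definition sector :: "'a \<Rightarrow> ('a \<times> int) list set set \<Rightarrow> ('a \<times> int) list set set" where
  "sector y = (SOME s. s \<one>\<^bsub>G\<^esub> = \<one>\<^bsub>G\<^esub> \<and>
    (\<forall>v\<in>V. \<forall>k. \<forall>h\<in>carrier G. s (vertex v [^]\<^bsub>G\<^esub> (k :: int) \<otimes>\<^bsub>G\<^esub> h) =
      (if v = y \<and> h \<in> W (star y) then vertex y [^]\<^bsub>G\<^esub> k \<otimes>\<^bsub>G\<^esub> s h else s h)))"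

context
  fixes y assumes y: "y \<in> V"
begin

lemma sector_one [simp]: "sector y \<one>\<^bsub>G\<^esub> = \<one>\<^bsub>G\<^esub>"
  using someI_ex[OF sector_exists[OF y]] by (simp add: sector_def)

lemma sector_step: "v \<in> V \<Longrightarrow> h \<in> carrier G \<Longrightarrow> sector y (vertex v [^]\<^bsub>G\<^esub> (k :: int) \<otimes>\<^bsub>G\<^esub> h) =
    (if v = y \<and> h \<in> W (star y) then vertex y [^]\<^bsub>G\<^esub> k \<otimes>\<^bsub>G\<^esub> sector y h else sector y h)"
  using someI_ex[OF sector_exists[OF y]] by (simp add: sector_def)

lemma sector_pow: "h \<in> carrier G \<Longrightarrow> \<exists>k :: int. sector y h = vertex y [^]\<^bsub>G\<^esub> k"
proof (induction rule: carrier_induct)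
  case one
  have "sector y \<one>\<^bsub>G\<^esub> = vertex y [^]\<^bsub>G\<^esub> (0 :: int)" by simp
  then show ?case by blast
next
  case (step v k g)
  then show ?case using y by (auto simp: sector_step int_pow_mult[symmetric])
qed

lemma sector_closed [simp]: "h \<in> carrier G \<Longrightarrow> sector y h \<in> carrier G"
  using sector_pow[of h] y by auto

text \<open>Multiplication by \<open>w\<close> on the right does not affect membership in
  \<open>W (star y)\<close>, so the recursion for the product collects the same crossings as that
  for \<open>h\<close>, only starting from \<open>sector y w\<close>.\<close>

lemma sector_mult:
  assumes w: "w \<in> W (star y)" and "h \<in> carrier G"
  shows "sector y (h \<otimes>\<^bsub>G\<^esub> w) = sector y h \<otimes>\<^bsub>G\<^esub> sector y w"
  using assms(2)
proof (induction rule: carrier_induct)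
  case one
  then show ?case using W_closed[OF star_subset[OF y] w] by simp
next
  case (step v k g)
  then show ?case
    using W_closed[OF star_subset[OF y] w] y W_mult_right_iff[OF star_subset[OF y] w, of g]
    by (auto simp: sector_step m_assoc)
qed

lemma sector_outside:
  assumes "w \<in> W B" "B \<subseteq> V" "y \<notin> B" "h \<in> carrier G"
  shows "sector y (w \<otimes>\<^bsub>G\<^esub> h) = sector y h"
  using assms(1,2)
proof (induction rule: W_induct)
  case one
  then show ?case using assms(4) by simp
next
  case (step v k g)
  then have "v \<in> V" "g \<in> carrier G" "v \<noteq> y" using W_closed assms by auto
  then show ?case using step assms(4) by (simp add: m_assoc sector_step)
qed

lemma sector_self_pow: "sector y (vertex y [^]\<^bsub>G\<^esub> (k :: int)) = vertex y [^]\<^bsub>G\<^esub> k"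
  using sector_step[OF y, of "\<one>\<^bsub>G\<^esub>" k] y subgroup.one_closed[OF W_subgroup[OF star_subset[OF y]]]
  by simp

lemma sector_mult_pow: "h \<in> carrier G \<Longrightarrow>
    sector y (h \<otimes>\<^bsub>G\<^esub> vertex y [^]\<^bsub>G\<^esub> (k :: int)) = sector y h \<otimes>\<^bsub>G\<^esub> vertex y [^]\<^bsub>G\<^esub> k"
  using sector_mult[of "vertex y [^]\<^bsub>G\<^esub> k" h] vertex_pow_in_W[OF star_subset[OF y], of y k]
  by (simp add: sector_self_pow)

text \<open>Multiplying by \<open>y\<close> on the right always rotates the sector, whereas
  multiplying on the left does so only inside \<open>W (star y)\<close>.\<close>

lemma centralizer_vertex:
  assumes "h \<in> carrier G" "h \<otimes>\<^bsub>G\<^esub> vertex y = vertex y \<otimes>\<^bsub>G\<^esub> h"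
  shows "h \<in> W (star y)"
proof (rule ccontr)
  assume "h \<notin> W (star y)"
  then have "sector y (vertex y \<otimes>\<^bsub>G\<^esub> h) = sector y h"
    using sector_step[OF y assms(1), of 1] y by simp
  moreover have "sector y (h \<otimes>\<^bsub>G\<^esub> vertex y) = sector y h \<otimes>\<^bsub>G\<^esub> vertex y"
    using sector_mult_pow[OF assms(1), of 1] y by simp
  ultimately have "sector y h \<otimes>\<^bsub>G\<^esub> vertex y = sector y h" using assms by simp
  then show False using vertex_neq_one[OF y] y assms(1) by (simp add: r_cancel_one)
qed

end

end

subsection \<open>Walls of a conjugating endomorphism\<close>

text \<open>Adjacent vertices share a conjugator, so their walls meet; nothing is demanded of other
  pairs. The identity map is an instance too, which turns results on walls into results on
  sectors.\<close>

locale conjugating = labeled_graph V E lab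
  for V :: "'a set" and E lab +
  fixes \<psi> :: "('a \<times> int) list set set \<Rightarrow> ('a \<times> int) list set set"
  assumes endo: "\<psi> \<in> hom G G"
    and conj_vertex: "v \<in> V \<Longrightarrow> \<exists>g\<in>carrier G. \<psi> (vertex v) = inv\<^bsub>G\<^esub> g \<otimes>\<^bsub>G\<^esub> vertex v \<otimes>\<^bsub>G\<^esub> g"
    and conj_edge: "{x, y} \<in> E \<Longrightarrow> \<exists>g\<in>carrier G.
      \<psi> (vertex x) = inv\<^bsub>G\<^esub> g \<otimes>\<^bsub>G\<^esub> vertex x \<otimes>\<^bsub>G\<^esub> g \<and>
      \<psi> (vertex y) = inv\<^bsub>G\<^esub> g \<otimes>\<^bsub>G\<^esub> vertex y \<otimes>\<^bsub>G\<^esub> g"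
begin

interpretation \<psi>: group_hom G G \<psi>
  using endo by unfold_locales

text \<open>A coset \<open>W (star v) g\<close>, because \<open>W (star v)\<close> is the
  centralizer of \<open>v\<close>. With the inverse on the left, it is left multiplication by
  syllables, that is, walking in the Cayley graph, that crosses the wall.\<close>

definition wall :: "'a \<Rightarrow> ('a \<times> int) list set set set" where
  "wall v = {g \<in> carrier G. \<psi> (vertex v) = inv\<^bsub>G\<^esub> g \<otimes>\<^bsub>G\<^esub> vertex v \<otimes>\<^bsub>G\<^esub> g}"

lemma wall_closed: "g \<in> wall v \<Longrightarrow> g \<in> carrier G"
  by (simp add: wall_def)

lemma wall_pow:
  "v \<in> V \<Longrightarrow> g \<in> wall v \<Longrightarrow> \<psi> (vertex v) [^]\<^bsub>G\<^esub> (k :: int) = inv\<^bsub>G\<^esub> g \<otimes>\<^bsub>G\<^esub> vertex v [^]\<^bsub>G\<^esub> k \<otimes>\<^bsub>G\<^esub> g"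
  by (simp add: wall_def conj_int_pow)

lemma wall_coset:
  assumes v: "v \<in> V" and g: "g \<in> wall v" and h: "h \<in> carrier G"
  shows "h \<in> wall v \<longleftrightarrow> h \<otimes>\<^bsub>G\<^esub> inv\<^bsub>G\<^esub> g \<in> W (star v)"
proof
  note cl = v h wall_closed[OF g] 
  let ?w = "h \<otimes>\<^bsub>G\<^esub> inv\<^bsub>G\<^esub> g"
  assume "h \<in> wall v"
  then have eq: "inv\<^bsub>G\<^esub> h \<otimes>\<^bsub>G\<^esub> vertex v \<otimes>\<^bsub>G\<^esub> h = inv\<^bsub>G\<^esub> g \<otimes>\<^bsub>G\<^esub> vertex v \<otimes>\<^bsub>G\<^esub> g" using g by (simp add: wall_def)
  have "vertex v \<otimes>\<^bsub>G\<^esub> ?w = h \<otimes>\<^bsub>G\<^esub> (inv\<^bsub>G\<^esub> h \<otimes>\<^bsub>G\<^esub> vertex v \<otimes>\<^bsub>G\<^esub> h) \<otimes>\<^bsub>G\<^esub> inv\<^bsub>G\<^esub> g"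
    using cl by (simp add: m_assoc)
  also have "\<dots> = ?w \<otimes>\<^bsub>G\<^esub> vertex v" unfolding eq using cl by (simp add: m_assoc)
  finally show "?w \<in> W (star v)" using cl by (intro centralizer_vertex) auto
next
  note cl = v h wall_closed[OF g] 
  let ?w = "h \<otimes>\<^bsub>G\<^esub> inv\<^bsub>G\<^esub> g"
  assume "?w \<in> W (star v)"
  from W_star_commute[OF v this] have comm: "?w \<otimes>\<^bsub>G\<^esub> vertex v = vertex v \<otimes>\<^bsub>G\<^esub> ?w" .
  have h_eq: "h = ?w \<otimes>\<^bsub>G\<^esub> g" using cl by (simp add: m_assoc)
  have "inv\<^bsub>G\<^esub> h \<otimes>\<^bsub>G\<^esub> vertex v \<otimes>\<^bsub>G\<^esub> h = inv\<^bsub>G\<^esub> h \<otimes>\<^bsub>G\<^esub> (vertex v \<otimes>\<^bsub>G\<^esub> ?w) \<otimes>\<^bsub>G\<^esub> g"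
    using cl by (simp add: m_assoc)
  also have "\<dots> = inv\<^bsub>G\<^esub> g \<otimes>\<^bsub>G\<^esub> vertex v \<otimes>\<^bsub>G\<^esub> g"
    unfolding comm[symmetric] using cl by (simp add: m_assoc)
  finally show "h \<in> wall v" using h g by (simp add: wall_def)
qed

lemma wall_mult:
  assumes v: "v \<in> V" and h: "h \<in> carrier G" and w: "w \<in> W (star v)"
  shows "w \<otimes>\<^bsub>G\<^esub> h \<in> wall v \<longleftrightarrow> h \<in> wall v"
proof -
  obtain g where g: "g \<in> wall v" using conj_vertex[OF v] by (auto simp: wall_def)
  have wc: "w \<in> carrier G" using W_closed[OF star_subset[OF v] w] .
  have "w \<otimes>\<^bsub>G\<^esub> h \<in> wall v \<longleftrightarrow> w \<otimes>\<^bsub>G\<^esub> (h \<otimes>\<^bsub>G\<^esub> inv\<^bsub>G\<^esub> g) \<in> W (star v)"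
    using wall_coset[OF v g, of "w \<otimes>\<^bsub>G\<^esub> h"] wc h wall_closed[OF g] by (simp add: m_assoc)
  also have "\<dots> \<longleftrightarrow> h \<in> wall v"
    using wall_coset[OF v g h] W_mult_left_iff[OF star_subset[OF v] w] h wall_closed[OF g] by simp
  finally show ?thesis .
qed

text \<open>A point of the wall, normalised so that the identity of \<open>G\<close> gets a trivial
  side; being separated from the identity then simply means having a nontrivial side.\<close>

definition base :: "'a \<Rightarrow> ('a \<times> int) list set set" where
  "base v = (SOME g. g \<in> wall v \<and> sector v (inv\<^bsub>G\<^esub> g) = \<one>\<^bsub>G\<^esub>)"

lemma base:
  assumes v: "v \<in> V"
  shows base_wall: "base v \<in> wall v" and sector_inv_base: "sector v (inv\<^bsub>G\<^esub> (base v)) = \<one>\<^bsub>G\<^esub>"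
proof -
  obtain g where g: "g \<in> wall v" using conj_vertex[OF v] by (auto simp: wall_def)
  note gc = wall_closed[OF g]
  obtain k :: int where k: "sector v (inv\<^bsub>G\<^esub> g) = vertex v [^]\<^bsub>G\<^esub> k" using sector_pow[OF v] gc by blast
  \<comment> \<open>Left multiplication by a power of \<open>v\<close> stays in the wall, and the
    inverse power on the right of \<open>inv g\<close> cancels the old sector.\<close>
  let ?g = "vertex v [^]\<^bsub>G\<^esub> k \<otimes>\<^bsub>G\<^esub> g"
  have "?g \<in> wall v"
    using v wall_mult[OF v gc vertex_pow_in_W[OF star_subset[OF v]], of v k] g by simp
  moreover have "inv\<^bsub>G\<^esub> ?g = inv\<^bsub>G\<^esub> g \<otimes>\<^bsub>G\<^esub> vertex v [^]\<^bsub>G\<^esub> (- k)"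
    using gc v by (simp add: inv_mult_group int_pow_neg)
  then have "sector v (inv\<^bsub>G\<^esub> ?g) = vertex v [^]\<^bsub>G\<^esub> k \<otimes>\<^bsub>G\<^esub> vertex v [^]\<^bsub>G\<^esub> (- k)"
    using k gc by (simp add: sector_mult_pow[OF v])
  then have "sector v (inv\<^bsub>G\<^esub> ?g) = \<one>\<^bsub>G\<^esub>" using v by (simp add: int_pow_neg)
  ultimately have "\<exists>g. g \<in> wall v \<and> sector v (inv\<^bsub>G\<^esub> g) = \<one>\<^bsub>G\<^esub>" by blast
  from someI_ex[OF this] show "base v \<in> wall v" "sector v (inv\<^bsub>G\<^esub> (base v)) = \<one>\<^bsub>G\<^esub>"
    by (auto simp: base_def)
qed

lemma base_closed [simp]: "v \<in> V \<Longrightarrow> base v \<in> carrier G"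
  using wall_closed[OF base_wall] .

text \<open>\<open>sector\<close> carried by right translation from the coset
  \<open>W (star y)\<close> to the wall of \<open>y\<close>.\<close>

definition side :: "'a \<Rightarrow> ('a \<times> int) list set set \<Rightarrow> ('a \<times> int) list set set" where
  "side y h = sector y (h \<otimes>\<^bsub>G\<^esub> inv\<^bsub>G\<^esub> (base y))"

lemma side_one: "y \<in> V \<Longrightarrow> side y \<one>\<^bsub>G\<^esub> = \<one>\<^bsub>G\<^esub>"
  by (simp add: side_def sector_inv_base)

lemma side_closed [simp]: "y \<in> V \<Longrightarrow> h \<in> carrier G \<Longrightarrow> side y h \<in> carrier G"
  by (simp add: side_def)

lemma side_pow: "y \<in> V \<Longrightarrow> h \<in> carrier G \<Longrightarrow> \<exists>k :: int. side y h = vertex y [^]\<^bsub>G\<^esub> k"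
  by (simp add: side_def sector_pow)

lemma side_step:
  assumes "y \<in> V" "v \<in> V" "h \<in> carrier G"
  shows "side y (vertex v [^]\<^bsub>G\<^esub> (k :: int) \<otimes>\<^bsub>G\<^esub> h) =
    (if v = y \<and> h \<in> wall y then vertex y [^]\<^bsub>G\<^esub> k \<otimes>\<^bsub>G\<^esub> side y h else side y h)"
  using assms sector_step[OF assms(1,2), of "h \<otimes>\<^bsub>G\<^esub> inv\<^bsub>G\<^esub> (base y)" k]
    wall_coset[OF assms(1) base_wall[OF assms(1)] assms(3)]
  by (simp add: side_def m_assoc)

text \<open>Since \<open>\<psi> (vertex y)\<close> is \<open>vertex y\<close> conjugated by
  \<open>base y\<close>, right multiplication by it is a rotation about the wall of
  \<open>y\<close>.\<close>

lemma side_conj_pow: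
  assumes y: "y \<in> V" and h: "h \<in> carrier G"
  shows "side y (h \<otimes>\<^bsub>G\<^esub> \<psi> (vertex y) [^]\<^bsub>G\<^esub> (k :: int)) = side y h \<otimes>\<^bsub>G\<^esub> vertex y [^]\<^bsub>G\<^esub> k"
proof -
  have "h \<otimes>\<^bsub>G\<^esub> \<psi> (vertex y) [^]\<^bsub>G\<^esub> k \<otimes>\<^bsub>G\<^esub> inv\<^bsub>G\<^esub> (base y) = h \<otimes>\<^bsub>G\<^esub> inv\<^bsub>G\<^esub> (base y) \<otimes>\<^bsub>G\<^esub> vertex y [^]\<^bsub>G\<^esub> k"
    unfolding wall_pow[OF y base_wall[OF y]] using y h by (simp add: m_assoc)
  then show ?thesis using y h by (simp add: side_def sector_mult_pow)
qed

text \<open>At a common point \<open>g\<close> of both walls the image of \<open>x\<close> becomes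
  the letter \<open>x\<close> inside \<open>W (star y)\<close>, which contributes nothing to the
  sector of \<open>y\<close>.\<close>

lemma side_conj_adjacent:
  assumes e: "{x, y} \<in> E" and h: "h \<in> carrier G"
  shows "side y (h \<otimes>\<^bsub>G\<^esub> \<psi> (vertex x) [^]\<^bsub>G\<^esub> (k :: int)) = side y h"
proof -
  have xy: "x \<in> V" "y \<in> V" "x \<noteq> y" "x \<in> star y"
    using edge_in_V[OF e] e by (auto simp: in_star_iff insert_commute)
  obtain g where g: "g \<in> wall x" "g \<in> wall y" using conj_edge[OF e] by (auto simp: wall_def)
  note gc = wall_closed[OF g(1)]
  interpret St: subgroup "W (star y)" G by (rule W_subgroup[OF star_subset[OF xy(2)]])
  let ?w = "g \<otimes>\<^bsub>G\<^esub> inv\<^bsub>G\<^esub> (base y)" and ?x = "vertex x [^]\<^bsub>G\<^esub> k"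
  have w: "?w \<in> W (star y)" using wall_coset[OF xy(2) base_wall[OF xy(2)] gc] g by simp
  have x: "?x \<in> W (star y)" using vertex_pow_in_W[OF star_subset[OF xy(2)] xy(4)] .
  have sx: "sector y (?x \<otimes>\<^bsub>G\<^esub> ?w) = sector y ?w"
    using sector_step[OF xy(2,1), of ?w k] xy(3) gc xy by simp
  have "h \<otimes>\<^bsub>G\<^esub> \<psi> (vertex x) [^]\<^bsub>G\<^esub> k \<otimes>\<^bsub>G\<^esub> inv\<^bsub>G\<^esub> (base y) = (h \<otimes>\<^bsub>G\<^esub> inv\<^bsub>G\<^esub> g) \<otimes>\<^bsub>G\<^esub> (?x \<otimes>\<^bsub>G\<^esub> ?w)"
    unfolding wall_pow[OF xy(1) g(1)] using xy gc h by (simp add: m_assoc)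
  then have "side y (h \<otimes>\<^bsub>G\<^esub> \<psi> (vertex x) [^]\<^bsub>G\<^esub> k) = sector y (h \<otimes>\<^bsub>G\<^esub> inv\<^bsub>G\<^esub> g) \<otimes>\<^bsub>G\<^esub> sector y ?w"
    using sector_mult[OF xy(2) St.m_closed[OF x w], of "h \<otimes>\<^bsub>G\<^esub> inv\<^bsub>G\<^esub> g"] h gc sx by (simp add: side_def)
  also have "\<dots> = sector y (h \<otimes>\<^bsub>G\<^esub> inv\<^bsub>G\<^esub> g \<otimes>\<^bsub>G\<^esub> ?w)"
    using sector_mult[OF xy(2) w, of "h \<otimes>\<^bsub>G\<^esub> inv\<^bsub>G\<^esub> g"] h gc by simp
  also have "h \<otimes>\<^bsub>G\<^esub> inv\<^bsub>G\<^esub> g \<otimes>\<^bsub>G\<^esub> ?w = h \<otimes>\<^bsub>G\<^esub> inv\<^bsub>G\<^esub> (base y)"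
    using xy gc h by (simp add: m_assoc)
  finally show ?thesis by (simp add: side_def)
qed

text \<open>Two points of the wall of \<open>x\<close> differ by letters from \<open>star x\<close>,
  none of which is \<open>y\<close>. So the wall of a vertex that does not commute with
  \<open>y\<close> lies on one side of the wall of \<open>y\<close>.\<close>

lemma side_wall_const:
  assumes y: "y \<in> V" and x: "x \<in> V" "y \<notin> star x" and g: "g \<in> wall x" "g' \<in> wall x"
  shows "side y g = side y g'"
proof -
  note gc = wall_closed[OF g(1)] wall_closed[OF g(2)]
  have "g \<otimes>\<^bsub>G\<^esub> inv\<^bsub>G\<^esub> g' \<in> W (star x)" using wall_coset[OF x(1) g(2) gc(1)] g by simp
  then have "sector y (g \<otimes>\<^bsub>G\<^esub> inv\<^bsub>G\<^esub> g' \<otimes>\<^bsub>G\<^esub> (g' \<otimes>\<^bsub>G\<^esub> inv\<^bsub>G\<^esub> (base y))) = sector y (g' \<otimes>\<^bsub>G\<^esub> inv\<^bsub>G\<^esub> (base y))"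
    using y x gc star_subset[OF x(1)] by (intro sector_outside) auto
  then show ?thesis using gc y by (simp add: side_def m_assoc)
qed

text \<open>A word is read from right to left as a path starting at \<open>h\<close>; the side
  changes only at a syllable of \<open>y\<close> that is met on the wall. The crossing found is one
  that leaves the side of \<open>h\<close>.\<close>

lemma crossing:
  assumes y: "y \<in> V" and h: "h \<in> carrier G" and ws: "ws \<in> lists (V \<times> UNIV)"
    and ne: "side y (ev ws \<otimes>\<^bsub>G\<^esub> h) \<noteq> side y h"
  obtains us k zs where "ws = us @ (y, k) # zs" "ev zs \<otimes>\<^bsub>G\<^esub> h \<in> wall y"
    "side y (ev zs \<otimes>\<^bsub>G\<^esub> h) = side y h"
proof -
  have "\<exists>us k zs. ws = us @ (y, k) # zs \<and> ev zs \<otimes>\<^bsub>G\<^esub> h \<in> wall y \<and> side y (ev zs \<otimes>\<^bsub>G\<^esub> h) = side y h"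
    using ws ne
  proof (induction ws rule: list.induct)
    case Nil
    then show ?case using h by simp
  next
    case (Cons a ws)
    obtain v k where a: "a = (v, k)" by force
    have ws: "ws \<in> lists (V \<times> UNIV)" and v: "v \<in> V" using Cons.prems(1) a by auto
    show ?case
    proof (cases "side y (ev ws \<otimes>\<^bsub>G\<^esub> h) = side y h")
      case True
      then have "v = y \<and> ev ws \<otimes>\<^bsub>G\<^esub> h \<in> wall y"
        using Cons.prems(2) side_step[OF y v, of "ev ws \<otimes>\<^bsub>G\<^esub> h" k] h v ws a
        by (auto simp: m_assoc split: if_splits)
      then show ?thesis using True a by (intro exI[of _ "[]"]) simp
    next
      case False
      from Cons.IH[OF ws this] obtain us k' zs where "ws = us @ (y, k') # zs"
        "ev zs \<otimes>\<^bsub>G\<^esub> h \<in> wall y" "side y (ev zs \<otimes>\<^bsub>G\<^esub> h) = side y h" by blast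
      then show ?thesis by (intro exI[of _ "a # us"]) auto
    qed
  qed
  then show ?thesis using that by blast
qed

text \<open>Let the path from the identity cross the wall of \<open>y\<close> at
  \<open>p = ev zs\<close> with the syllable \<open>(y, j)\<close>. Right multiplication by the
  power \<open>- j\<close> of the image of \<open>y\<close>, which equals
  \<open>inv p y^-j p\<close>, erases this syllable. Repetition brings the end point to the trivial
  side, one syllable shorter each time.\<close>

lemma shorten:
  fixes k :: int
  assumes y: "y \<in> V"
  shows "ws \<in> lists (V \<times> UNIV) \<Longrightarrow> side y (ev ws) = vertex y [^]\<^bsub>G\<^esub> k \<Longrightarrow>
    \<exists>ws'\<in>lists (V \<times> UNIV). ev ws' = ev ws \<otimes>\<^bsub>G\<^esub> \<psi> (vertex y) [^]\<^bsub>G\<^esub> (- k) \<and> length ws' \<le> length ws \<and>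
      (side y (ev ws) \<noteq> \<one>\<^bsub>G\<^esub> \<longrightarrow> length ws' < length ws)"
proof (induction "length ws" arbitrary: ws k rule: less_induct)
  case less
  note ws = less.prems(1)
  show ?case
  proof (cases "side y (ev ws) = \<one>\<^bsub>G\<^esub>")
    case True
    then have "vertex y [^]\<^bsub>G\<^esub> (- k) = \<one>\<^bsub>G\<^esub>" using less.prems(2) y by (simp add: int_pow_neg)
    then have "\<psi> (vertex y) [^]\<^bsub>G\<^esub> (- k) = \<one>\<^bsub>G\<^esub>"
      using wall_pow[OF y base_wall[OF y], of "- k"] y by simp
    then show ?thesis using True ws by (intro bexI[of _ ws]) auto
  next
    case False
    then have ne: "side y (ev ws \<otimes>\<^bsub>G\<^esub> \<one>\<^bsub>G\<^esub>) \<noteq> side y \<one>\<^bsub>G\<^esub>" using ws y by (simp add: side_one)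
    obtain us j zs where split: "ws = us @ (y, j) # zs" and p: "ev zs \<otimes>\<^bsub>G\<^esub> \<one>\<^bsub>G\<^esub> \<in> wall y"
      by (rule crossing[OF y one_closed ws ne])
    have uz: "us \<in> lists (V \<times> UNIV)" "zs \<in> lists (V \<times> UNIV)" using ws split by auto
    let ?Y = "\<psi> (vertex y)" and ?ws = "us @ zs"
    have Y: "?Y \<in> carrier G" using y by simp
    have zsw: "ev zs \<in> wall y" using p uz by simp
    have "ev ws \<otimes>\<^bsub>G\<^esub> ?Y [^]\<^bsub>G\<^esub> (- j) = ev ?ws"
      unfolding wall_pow[OF y zsw] using uz y by (simp add: split m_assoc int_pow_neg)
    moreover have "side y (ev ws \<otimes>\<^bsub>G\<^esub> ?Y [^]\<^bsub>G\<^esub> (- j)) = vertex y [^]\<^bsub>G\<^esub> (k + - j)"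
      unfolding side_conj_pow[OF y ev_closed[OF ws]] less.prems(2) using y by (simp only: int_pow_mult vertex_closed)
    ultimately have "side y (ev ?ws) = vertex y [^]\<^bsub>G\<^esub> (k + - j)" by simp
    from less.hyps[OF _ _ this] obtain ws' where ws': "ws' \<in> lists (V \<times> UNIV)"
      "ev ws' = ev ?ws \<otimes>\<^bsub>G\<^esub> ?Y [^]\<^bsub>G\<^esub> (- (k + - j))" "length ws' \<le> length ?ws"
      using uz split by auto
    have "ev ws' = ev ws \<otimes>\<^bsub>G\<^esub> (?Y [^]\<^bsub>G\<^esub> (- j) \<otimes>\<^bsub>G\<^esub> ?Y [^]\<^bsub>G\<^esub> (- (k + - j)))"
      unfolding ws'(2) \<open>ev ws \<otimes>\<^bsub>G\<^esub> ?Y [^]\<^bsub>G\<^esub> (- j) = ev ?ws\<close>[symmetric] using Y ws by (simp add: m_assoc)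
    also have "?Y [^]\<^bsub>G\<^esub> (- j) \<otimes>\<^bsub>G\<^esub> ?Y [^]\<^bsub>G\<^esub> (- (k + - j)) = ?Y [^]\<^bsub>G\<^esub> (- k)"
      using int_pow_mult[OF Y, of "- j" "- (k + - j)"] by simp
    finally have "ev ws' = ev ws \<otimes>\<^bsub>G\<^esub> ?Y [^]\<^bsub>G\<^esub> (- k)" .
    moreover have "length ws' < length ws" using ws'(3) split by simp
    ultimately show ?thesis using ws'(1) less_imp_le by blast
  qed
qed

lemma ev_surj:
  assumes "g \<in> carrier G" obtains ws where "ws \<in> lists (V \<times> UNIV)" "ev ws = g"
  using assms W_eq_ev[of V] W_V by auto

text \<open>
  A shortest path from the wall of \<open>v\<close> to \<open>h\<close> does not meet the wall of \<open>v\<close> again. Hence it does not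
  cross the wall of \<open>y\<close>, which lies on the other side.
\<close>

lemma side_disjoint:
  assumes v: "v \<in> V" and y: "y \<in> V" "y \<notin> star v"
    and a: "a \<in> wall y" and b: "b \<in> wall v" and h: "h \<in> carrier G"
    and ne: "side v h \<noteq> side v a"
  shows "side y h = side y b"
proof (rule ccontr)
  assume ne': "side y h \<noteq> side y b"
  have vy: "v \<notin> star y" using y star_sym by blast
  \<comment> \<open>Distances to \<open>h\<close> are measured from the whole wall of
    \<open>v\<close>, not only from \<open>b\<close>.\<close>
  define P where "P n \<longleftrightarrow> (\<exists>ws\<in>lists (V \<times> UNIV). \<exists>c\<in>wall v. ev ws \<otimes>\<^bsub>G\<^esub> c = h \<and> length ws = n)" for n
  obtain ws0 where "ws0 \<in> lists (V \<times> UNIV)" "ev ws0 = h \<otimes>\<^bsub>G\<^esub> inv\<^bsub>G\<^esub> b"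
    by (rule ev_surj[of "h \<otimes>\<^bsub>G\<^esub> inv\<^bsub>G\<^esub> b"]) (use h wall_closed[OF b] in auto)
  then have "P (length ws0)" using b h wall_closed[OF b] unfolding P_def
    by (intro bexI[of _ ws0] bexI[of _ b]) (auto simp: m_assoc)
  then have "P (LEAST n. P n)" by (rule LeastI)
  then obtain ws c where ws: "ws \<in> lists (V \<times> UNIV)" and c: "c \<in> wall v" and eq: "ev ws \<otimes>\<^bsub>G\<^esub> c = h"
    and len: "length ws = (LEAST n. P n)" unfolding P_def by blast
  have min: "length ws \<le> n" if "P n" for n using len Least_le[of P, OF that] by simp
  note cc = wall_closed[OF c]
  have "side y (ev ws \<otimes>\<^bsub>G\<^esub> c) \<noteq> side y c"
    using ne' eq side_wall_const[OF y(1) v y(2) b c] by simp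
  then obtain us k zs where s1: "ws = us @ (y, k) # zs" and p: "ev zs \<otimes>\<^bsub>G\<^esub> c \<in> wall y"
    by (rule crossing[OF y(1) cc ws])
  let ?p = "ev zs \<otimes>\<^bsub>G\<^esub> c" and ?us = "us @ [(y, k)]"
  have l: "us \<in> lists (V \<times> UNIV)" "zs \<in> lists (V \<times> UNIV)" "?us \<in> lists (V \<times> UNIV)" using ws s1 by auto
  have h_eq: "ev ?us \<otimes>\<^bsub>G\<^esub> ?p = h" using eq s1 l cc y by (simp add: m_assoc)
  have "side v (ev ?us \<otimes>\<^bsub>G\<^esub> ?p) \<noteq> side v ?p"
    unfolding h_eq using ne side_wall_const[OF v y(1) vy a p] by simp
  then obtain us' j zs' where s2: "?us = us' @ (v, j) # zs'" and q: "ev zs' \<otimes>\<^bsub>G\<^esub> ?p \<in> wall v"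
    by (rule crossing[OF v wall_closed[OF p] l(3)])
  have l': "us' @ [(v, j)] \<in> lists (V \<times> UNIV)" "us' \<in> lists (V \<times> UNIV)" "zs' \<in> lists (V \<times> UNIV)"
    using l(3) unfolding s2 by auto
  have "ev (us' @ [(v, j)]) \<otimes>\<^bsub>G\<^esub> (ev zs' \<otimes>\<^bsub>G\<^esub> ?p) = h"
    using h_eq l' l(2) v cc unfolding s2 by (simp add: m_assoc)
  then have "P (length (us' @ [(v, j)]))" unfolding P_def using l'(1) q by blast
  \<comment> \<open>The path could start at the second crossing instead. Minimality leaves no room
    between the two crossings, so they are the same syllable and \<open>v = y\<close>.\<close>
  from min[OF this] have "length us + length zs \<le> length us'" using s1 by simp
  moreover have "length us = length us' + length zs'" using arg_cong[OF s2, of length] by simp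
  ultimately have "zs' = []" by simp
  then have "v = y" using s2 by simp
  then show False using y(2) by simp
qed

end

section \<open>Sectors of G as the sides of the walls of the identity map\<close>

context labeled_graph
begin

lemma conjugating_id: "conjugating V E lab (\<lambda>g. g)"
proof unfold_locales
  show "(\<lambda>g. g) \<in> hom G G" by (simp add: hom_def)
  show "\<exists>g\<in>carrier G. vertex v = inv\<^bsub>G\<^esub> g \<otimes>\<^bsub>G\<^esub> vertex v \<otimes>\<^bsub>G\<^esub> g" if "v \<in> V" for v
    using that by (intro bexI[of _ "\<one>\<^bsub>G\<^esub>"]) simp_all
  show "\<exists>g\<in>carrier G. vertex x = inv\<^bsub>G\<^esub> g \<otimes>\<^bsub>G\<^esub> vertex x \<otimes>\<^bsub>G\<^esub> g \<and>
      vertex y = inv\<^bsub>G\<^esub> g \<otimes>\<^bsub>G\<^esub> vertex y \<otimes>\<^bsub>G\<^esub> g" if "{x, y} \<in> E" for x y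
    using edge_in_V[OF that] by (intro bexI[of _ "\<one>\<^bsub>G\<^esub>"]) simp_all
qed

interpretation id: conjugating V E lab "\<lambda>g. g"
  by (rule conjugating_id)

lemma one_in_id_wall: "v \<in> V \<Longrightarrow> \<one>\<^bsub>G\<^esub> \<in> id.wall v"
  by (simp add: id.wall_def)

text \<open>\<open>base y\<close> is chosen in \<open>W (star y)\<close> with an inverse of trivial
  sector, so translating by it does not change sectors.\<close>

lemma id_side:
  assumes y: "y \<in> V" and h: "h \<in> carrier G" shows "id.side y h = sector y h"
proof -
  have "\<one>\<^bsub>G\<^esub> \<otimes>\<^bsub>G\<^esub> inv\<^bsub>G\<^esub> (id.base y) \<in> W (star y)"
    using id.wall_coset[OF y id.base_wall[OF y] one_closed] one_in_id_wall[OF y] by simp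
  then have "inv\<^bsub>G\<^esub> (id.base y) \<in> W (star y)" using y by simp
  from sector_mult[OF y this h] show ?thesis
    using y h by (simp add: id.side_def id.sector_inv_base)
qed

lemma sector_shorten:
  assumes "y \<in> V" "ws \<in> lists (V \<times> UNIV)" "sector y (ev ws) = vertex y [^]\<^bsub>G\<^esub> (k :: int)" "sector y (ev ws) \<noteq> \<one>\<^bsub>G\<^esub>"
  obtains ws' where "ws' \<in> lists (V \<times> UNIV)" "ev ws' = ev ws \<otimes>\<^bsub>G\<^esub> vertex y [^]\<^bsub>G\<^esub> (- k)" "length ws' < length ws"
  using id.shorten[OF assms(1,2), of k] assms that by (auto simp: id_side)

lemma sector_disjoint:
  assumes "v \<in> V" "y \<in> V" "y \<notin> star v" "h \<in> carrier G" "sector v h \<noteq> \<one>\<^bsub>G\<^esub>"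
  shows "sector y h = \<one>\<^bsub>G\<^esub>"
  using id.side_disjoint[OF assms(1-3) one_in_id_wall one_in_id_wall assms(4)] assms
  by (simp add: id_side)

lemma all_sectors_one:
  assumes h: "h \<in> carrier G" and all: "\<And>v. v \<in> V \<Longrightarrow> sector v h = \<one>\<^bsub>G\<^esub>"
  shows "h = \<one>\<^bsub>G\<^esub>"
proof -
  define P where "P n \<longleftrightarrow> (\<exists>ws\<in>lists (V \<times> UNIV). ev ws = h \<and> length ws = n)" for n
  have "\<exists>n. P n" using h unfolding P_def by (metis id.ev_surj)
  then have "P (LEAST n. P n)" by (rule LeastI_ex)
  then obtain ws where ws: "ws \<in> lists (V \<times> UNIV)" "ev ws = h" "length ws = (LEAST n. P n)"
    unfolding P_def by blast
  have min: "length ws \<le> length zs" if "zs \<in> lists (V \<times> UNIV)" "ev zs = h" for zs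
    unfolding ws(3) by (rule Least_le) (use that in \<open>auto simp: P_def\<close>)
  show ?thesis
  proof (cases ws rule: rev_cases)
    case Nil
    then show ?thesis using ws by simp
  next
    case (snoc us a)
    obtain v j where a: "a = (v, j)" by force
    have us: "us \<in> lists (V \<times> UNIV)" and v: "v \<in> V" using ws snoc a by auto
    have h_eq: "h = ev us \<otimes>\<^bsub>G\<^esub> vertex v [^]\<^bsub>G\<^esub> j" using ws(2) snoc a us v by auto
    then have "sector v (ev us) \<otimes>\<^bsub>G\<^esub> vertex v [^]\<^bsub>G\<^esub> j = \<one>\<^bsub>G\<^esub>"
      using all[OF v] us by (simp add: sector_mult_pow[OF v])
    then have s: "sector v (ev us) = vertex v [^]\<^bsub>G\<^esub> (- j)"
      using us v by (metis ev_closed int_pow_closed int_pow_neg inv_equality inv_inv inv_closed sector_closed vertex_closed)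
    show ?thesis
    proof (cases "sector v (ev us) = \<one>\<^bsub>G\<^esub>")
      case True
      then have "vertex v [^]\<^bsub>G\<^esub> j = \<one>\<^bsub>G\<^esub>" using s v by (simp add: int_pow_neg)
      then have "ev us = h" using h_eq us by simp
      from min[OF us this] show ?thesis using snoc by simp
    next
      case False
      from sector_shorten[OF v us s False] obtain zs where
        "zs \<in> lists (V \<times> UNIV)" "ev zs = h" "length zs < length us" using h_eq by auto
      then show ?thesis using min[of zs] snoc by simp
    qed
  qed
qed

end

section \<open>Ping-pong\<close>

context conjugating
begin

interpretation \<psi>: group_hom G G \<psi>
  using endo by unfold_locales

text \<open>
  If no wall separates another one from \<open>\<one>\<close>, then the domain of all points that no wall separates
  from \<open>\<one>\<close> is moved by \<open>\<psi> u\<close> into the same sectors into which \<open>u\<close> moves \<open>\<one>\<close> (ping-pong).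
\<close>

lemma ping_pong:
  assumes together: "\<And>x y g. x \<in> V \<Longrightarrow> y \<in> V \<Longrightarrow> x \<notin> star y \<Longrightarrow> g \<in> wall x \<Longrightarrow> side y g = \<one>\<^bsub>G\<^esub>"
    and d: "d \<in> carrier G" "\<And>y. y \<in> V \<Longrightarrow> side y d = \<one>\<^bsub>G\<^esub>"
  shows "ws \<in> lists (V \<times> UNIV) \<Longrightarrow> y \<in> V \<Longrightarrow> side y (d \<otimes>\<^bsub>G\<^esub> \<psi> (ev ws)) = sector y (ev ws)"
proof (induction "length ws" arbitrary: ws y rule: less_induct)
  case less
  note ws = less.prems(1) and y = less.prems(2)
  let ?u = "ev ws"
  show ?case
  proof (cases "\<forall>v\<in>V. sector v ?u = \<one>\<^bsub>G\<^esub>")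
    case True
    then have "?u = \<one>\<^bsub>G\<^esub>" using all_sectors_one ws by simp
    then show ?thesis using d y by simp
  next
    case False
    then obtain v where v: "v \<in> V" "sector v ?u \<noteq> \<one>\<^bsub>G\<^esub>" by blast
    \<comment> \<open>The power of \<open>v\<close> recorded by the sector is stripped from
      \<open>u\<close>; the induction hypothesis applies to the shorter rest.\<close>
    obtain k :: int where k: "sector v ?u = vertex v [^]\<^bsub>G\<^esub> k" using sector_pow[OF v(1) ev_closed[OF ws]] by blast
    obtain zs where zs: "zs \<in> lists (V \<times> UNIV)" "ev zs = ?u \<otimes>\<^bsub>G\<^esub> vertex v [^]\<^bsub>G\<^esub> (- k)" "length zs < length ws"
      by (rule sector_shorten[OF v(1) ws k v(2)])
    have u: "?u = ev zs \<otimes>\<^bsub>G\<^esub> vertex v [^]\<^bsub>G\<^esub> k"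
      unfolding zs(2) using ws v by (simp add: m_assoc int_pow_neg)
    have du: "d \<otimes>\<^bsub>G\<^esub> \<psi> ?u = (d \<otimes>\<^bsub>G\<^esub> \<psi> (ev zs)) \<otimes>\<^bsub>G\<^esub> \<psi> (vertex v) [^]\<^bsub>G\<^esub> k"
      unfolding u using d zs(1) v by (simp add: \<psi>.hom_int_pow m_assoc)
    note IH = less.hyps[OF zs(3,1)]
    have side_v: "side v (d \<otimes>\<^bsub>G\<^esub> \<psi> ?u) = sector v ?u"
      unfolding du unfolding u using d zs(1) v(1) IH[OF v(1)] by (simp add: side_conj_pow sector_mult_pow)
    consider "y = v" | "{v, y} \<in> E" | "y \<notin> star v" by (auto simp: in_star_iff)
    then show ?thesis
    proof cases
      case 1
      then show ?thesis using side_v by simp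
    next
      case 2
      then have "vertex v [^]\<^bsub>G\<^esub> k \<in> W (star y)" "v \<noteq> y"
        using edge_in_V[OF 2] y by (auto intro!: vertex_pow_in_W star_subset simp: in_star_iff insert_commute)
      moreover from this have "sector y (vertex v [^]\<^bsub>G\<^esub> k) = \<one>\<^bsub>G\<^esub>"
        using sector_step[OF y v(1), of "\<one>\<^bsub>G\<^esub>" k] v(1) y by simp
      ultimately have "sector y ?u = sector y (ev zs)"
        unfolding u using zs(1) y by (simp add: sector_mult)
      moreover have "side y (d \<otimes>\<^bsub>G\<^esub> \<psi> ?u) = side y (d \<otimes>\<^bsub>G\<^esub> \<psi> (ev zs))"
        unfolding du using d zs(1) by (intro side_conj_adjacent[OF 2]) simp
      ultimately show ?thesis using IH[OF y] by simp
    next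
      case 3
      then have vy: "v \<notin> star y" using star_sym by blast
      \<comment> \<open>The wall of \<open>y\<close> lies on the trivial side of the wall of
        \<open>v\<close>, but the point in question does not. Hence this point is on the side of
        \<open>y\<close> that contains the wall of \<open>v\<close>, which is trivial as
        well.\<close>
      have "side v (base y) = \<one>\<^bsub>G\<^esub>" using together[OF y v(1) 3 base_wall[OF y]] .
      then have "side y (d \<otimes>\<^bsub>G\<^esub> \<psi> ?u) = side y (base v)"
        using side_v v d ws by (intro side_disjoint[OF v(1) y 3 base_wall[OF y] base_wall[OF v(1)]]) auto
      also have "\<dots> = \<one>\<^bsub>G\<^esub>" using together[OF v(1) y vy base_wall[OF v(1)]] .
      also have "\<dots> = sector y ?u" using sector_disjoint[OF v(1) y 3 _ v(2)] ws by simp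
      finally show ?thesis .
    qed
  qed
qed

text \<open>If the wall of \<open>v\<close> missed the identity, the step from the identity to
  \<open>vertex v\<close> would cross no wall. By ping-pong a preimage of \<open>vertex v\<close>
  would then have only trivial sectors, so it would be trivial, and so would
  \<open>vertex v\<close>.\<close>

lemma fixes_vertices_if_no_separation:
  assumes surj: "\<psi> ` carrier G = carrier G"
    and together: "\<And>x y g. x \<in> V \<Longrightarrow> y \<in> V \<Longrightarrow> x \<notin> star y \<Longrightarrow> g \<in> wall x \<Longrightarrow> side y g = \<one>\<^bsub>G\<^esub>"
    and v: "v \<in> V"
  shows "\<psi> (vertex v) = vertex v"
proof -
  have "\<one>\<^bsub>G\<^esub> \<in> wall v"
  proof (rule ccontr)
    assume "\<one>\<^bsub>G\<^esub> \<notin> wall v"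
    then have sv: "side y (vertex v) = \<one>\<^bsub>G\<^esub>" if "y \<in> V" for y
      using side_step[OF that v one_closed, of 1] v side_one[OF that] that by auto
    obtain u where u: "u \<in> carrier G" "\<psi> u = vertex v" using surj v by (metis imageE vertex_closed)
    obtain ws where ws: "ws \<in> lists (V \<times> UNIV)" "ev ws = u" by (rule ev_surj[OF u(1)])
    have "sector y u = \<one>\<^bsub>G\<^esub>" if "y \<in> V" for y
    proof -
      have "side y (\<one>\<^bsub>G\<^esub> \<otimes>\<^bsub>G\<^esub> \<psi> (ev ws)) = sector y (ev ws)"
        by (rule ping_pong[OF _ one_closed side_one ws(1) that]) (rule together)
      then show ?thesis using u(2) sv[OF that] v unfolding ws(2) by simp
    qed
    then have "u = \<one>\<^bsub>G\<^esub>" by (rule all_sectors_one[OF u(1)])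
    then show False using u(2) vertex_neq_one[OF v] by simp
  qed
  then show ?thesis using v by (simp add: wall_def)
qed

end

context labeled_graph
begin

subsection \<open>Automorphisms of the graph product\<close>

text \<open>The defining relations of the graph product for the images of the vertices; the
  checkable counterpart of \<open>well_defined\<close>.\<close>

definition admissible :: "('a \<Rightarrow> ('a \<times> int) list set set) \<Rightarrow> bool" where
  "admissible \<phi> \<longleftrightarrow> (\<forall>v\<in>V. \<phi> v \<in> carrier G \<and> \<phi> v [^]\<^bsub>G\<^esub> modulus v = \<one>\<^bsub>G\<^esub>) \<and>
    (\<forall>v w. {v, w} \<in> E \<longrightarrow> \<phi> v \<otimes>\<^bsub>G\<^esub> \<phi> w = \<phi> w \<otimes>\<^bsub>G\<^esub> \<phi> v)"

lemma well_defined_iff: "well_defined \<phi> \<longleftrightarrow> admissible \<phi>"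
proof
  assume "well_defined \<phi>"
  then obtain \<theta> where \<theta>: "\<theta> \<in> hom G G" "\<And>v. v \<in> V \<Longrightarrow> \<theta> (vertex v) = \<phi> v"
    by (auto simp: well_defined_def extends_to_def)
  interpret \<theta>: group_hom G G \<theta> using \<theta>(1) by unfold_locales
  have "\<phi> v \<in> carrier G" "\<phi> v [^]\<^bsub>G\<^esub> modulus v = \<one>\<^bsub>G\<^esub>" if "v \<in> V" for v
    using that by (simp_all add: \<theta>(2)[symmetric] \<theta>.hom_int_pow[symmetric] vertex_exponent)
  moreover have "\<phi> v \<otimes>\<^bsub>G\<^esub> \<phi> w = \<phi> w \<otimes>\<^bsub>G\<^esub> \<phi> v" if "{v, w} \<in> E" for v w
    using edge_in_V[OF that] arg_cong[OF vertex_commute[OF that], of \<theta>] by (simp add: \<theta>(2))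
  ultimately show "admissible \<phi>" unfolding admissible_def by blast
next
  assume *: "admissible \<phi>"
  obtain \<theta> where "\<theta> \<in> hom G G" "\<And>v. v \<in> V \<Longrightarrow> \<theta> (vertex v) = \<phi> v"
    by (rule graph_product_universal[of G \<phi>]) (use * group_G in \<open>unfold admissible_def, blast+\<close>)
  then have "extends_to \<phi> (restrict \<theta> (carrier G))"
    by (simp add: extends_to_def hom_def Pi_def)
  then show "well_defined \<phi>" by (auto simp: well_defined_def)
qed

lemma extends_to_unique: "extends_to \<phi> \<theta> \<Longrightarrow> extends_to \<phi> \<theta>' \<Longrightarrow> \<theta> = \<theta>'"
  by (rule extensionalityI[of _ "carrier G"], unfold extends_to_def)
    (blast, blast, rule hom_eqI[OF group_G], simp_all)

definition endo :: "('a \<Rightarrow> ('a \<times> int) list set set) \<Rightarrow>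
    ('a \<times> int) list set set \<Rightarrow> ('a \<times> int) list set set" where
  "endo \<phi> = (SOME \<theta>. extends_to \<phi> \<theta>)"

lemma endo_extends: "admissible \<phi> \<Longrightarrow> extends_to \<phi> (endo \<phi>)"
  using someI_ex[of "extends_to \<phi>"] by (simp add: well_defined_iff[symmetric] well_defined_def endo_def)

lemma endo_eq: "extends_to \<phi> \<theta> \<Longrightarrow> endo \<phi> = \<theta>"
  using extends_to_unique someI[of "extends_to \<phi>" \<theta>] by (simp add: endo_def)

lemma endo_hom: "admissible \<phi> \<Longrightarrow> endo \<phi> \<in> hom G G"
  and endo_vertex: "admissible \<phi> \<Longrightarrow> v \<in> V \<Longrightarrow> endo \<phi> (vertex v) = \<phi> v"
  and endo_extensional: "admissible \<phi> \<Longrightarrow> endo \<phi> \<in> extensional (carrier G)"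
  using endo_extends[of \<phi>] by (simp_all add: extends_to_def)

text \<open>Both compositions agree with the identity on the generating vertices, hence
  everywhere.\<close>

lemma endo_auto:
  assumes ad: "admissible \<phi>" "admissible \<phi>'"
    and inv: "\<And>v. v \<in> V \<Longrightarrow> endo \<phi> (\<phi>' v) = vertex v" "\<And>v. v \<in> V \<Longrightarrow> endo \<phi>' (\<phi> v) = vertex v"
  shows "endo \<phi> \<in> auto G"
proof -
  have id: "(\<lambda>g. g) \<in> hom G G" by (simp add: hom_def)
  have cl: "endo \<phi> g \<in> carrier G" "endo \<phi>' g \<in> carrier G" if "g \<in> carrier G" for g
    using endo_hom[OF ad(1)] endo_hom[OF ad(2)] that by (auto simp: hom_def)
  have comp: "(\<lambda>g. endo \<phi> (endo \<phi>' g)) \<in> hom G G" "(\<lambda>g. endo \<phi>' (endo \<phi> g)) \<in> hom G G"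
    using endo_hom[OF ad(1)] endo_hom[OF ad(2)] by (simp_all add: hom_def Pi_def)
  have "endo \<phi> (endo \<phi>' g) = g" if "g \<in> carrier G" for g
    by (rule hom_eqI[OF group_G comp(1) id _ that]) (simp add: endo_vertex ad inv)
  moreover have "endo \<phi>' (endo \<phi> g) = g" if "g \<in> carrier G" for g
    by (rule hom_eqI[OF group_G comp(2) id _ that]) (simp add: endo_vertex ad inv)
  ultimately have "bij_betw (endo \<phi>) (carrier G) (carrier G)"
    using cl by (intro bij_betw_byWitness[where f' = "endo \<phi>'"]) auto
  then show ?thesis using ad by (simp add: auto_def Bij_def endo_hom endo_extensional)
qed

lemma auto_hom: "\<theta> \<in> auto G \<Longrightarrow> \<theta> \<in> hom G G"
  by (simp add: auto_def)

lemma auto_group_hom: "\<theta> \<in> auto G \<Longrightarrow> group_hom G G \<theta>"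
  using group_G by (simp add: auto_def group_hom_def group_hom_axioms_def)

lemma auto_bij: "\<theta> \<in> auto G \<Longrightarrow> bij_betw \<theta> (carrier G) (carrier G)"
  by (simp add: auto_def Bij_def)

lemma auto_closed: "\<theta> \<in> auto G \<Longrightarrow> g \<in> carrier G \<Longrightarrow> \<theta> g \<in> carrier G"
  using auto_hom[of \<theta>] by (auto simp: hom_def)

lemma auto_eqI:
  assumes "\<theta> \<in> auto G" "\<eta> \<in> auto G" "\<And>v. v \<in> V \<Longrightarrow> \<theta> (vertex v) = \<eta> (vertex v)"
  shows "\<theta> = \<eta>"
proof (rule extends_to_unique[of "\<lambda>v. \<eta> (vertex v)"])
  show "extends_to (\<lambda>v. \<eta> (vertex v)) \<theta>" "extends_to (\<lambda>v. \<eta> (vertex v)) \<eta>"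
    using assms by (simp_all add: extends_to_def auto_def Bij_def)
qed

abbreviation (input) AG where "AG \<equiv> AutoGroup G"

lemma carrier_AG [simp]: "carrier AG = auto G"
  by (simp add: AutoGroup_def)

lemma AG_apply:
  "\<theta> \<in> auto G \<Longrightarrow> \<eta> \<in> auto G \<Longrightarrow> g \<in> carrier G \<Longrightarrow> (\<theta> \<otimes>\<^bsub>AG\<^esub> \<eta>) g = \<theta> (\<eta> g)"
  by (simp add: AutoGroup_def BijGroup_def auto_def compose_def)

lemma AG_one_apply: "g \<in> carrier G \<Longrightarrow> \<one>\<^bsub>AG\<^esub> g = g"
  by (simp add: AutoGroup_def BijGroup_def)

lemma AG_inv:
  assumes "\<theta> \<in> auto G"
  shows "inv\<^bsub>AG\<^esub> \<theta> \<in> auto G"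
    and "g \<in> carrier G \<Longrightarrow> (inv\<^bsub>AG\<^esub> \<theta>) (\<theta> g) = g"
    and "g \<in> carrier G \<Longrightarrow> \<theta> ((inv\<^bsub>AG\<^esub> \<theta>) g) = g"
proof -
  interpret AG: group AG by (rule AutoGroup)
  show cl: "inv\<^bsub>AG\<^esub> \<theta> \<in> auto G" using AG.inv_closed[of \<theta>] assms by simp
  show "(inv\<^bsub>AG\<^esub> \<theta>) (\<theta> g) = g" if "g \<in> carrier G"
    using AG_apply[OF cl assms that] AG.l_inv[of \<theta>] assms AG_one_apply[OF that] by simp
  show "\<theta> ((inv\<^bsub>AG\<^esub> \<theta>) g) = g" if "g \<in> carrier G"
    using AG_apply[OF assms cl that] AG.r_inv[of \<theta>] assms AG_one_apply[OF that] by simp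
qed

lemma AG_mult_closed: "\<theta> \<in> auto G \<Longrightarrow> \<eta> \<in> auto G \<Longrightarrow> \<theta> \<otimes>\<^bsub>AG\<^esub> \<eta> \<in> auto G"
  using monoid.m_closed[OF group.is_monoid[OF AutoGroup]] by simp

subsection \<open>Abelianisation\<close>

text \<open>\<open>coord y (\<theta> (vertex x))\<close> is the matrix entry in row \<open>y\<close>
  and column \<open>x\<close>. This is where orders constrain the matrix: for instance, a column of
  finite order vanishes in all rows of infinite order.\<close>

lemma hom_coord_exponent:
  assumes "\<theta> \<in> hom G G" "x \<in> V" "y \<in> V"
  shows "modulus y dvd modulus x * coord y (\<theta> (vertex x))"
proof -
  interpret \<theta>: group_hom G G \<theta> using assms(1) by unfold_locales
  have "\<theta> (vertex x) [^]\<^bsub>G\<^esub> modulus x = \<one>\<^bsub>G\<^esub>"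
    using assms by (simp add: \<theta>.hom_int_pow[symmetric] vertex_exponent)
  then have "(modulus x * coord y (\<theta> (vertex x))) mod modulus y = 0"
    using coord_pow[OF assms(3), of "\<theta> (vertex x)" "modulus x"] assms by simp
  then show ?thesis by auto
qed

text \<open>Multiplication of a coordinate vector by the matrix of \<open>\<theta>\<close>.\<close>

lemma coord_hom_sum:
  assumes \<theta>: "\<theta> \<in> hom G G" and y: "y \<in> V" and g: "g \<in> carrier G"
  shows "[coord y (\<theta> g) = (\<Sum>v\<in>V. coord v g * coord y (\<theta> (vertex v)))] (mod modulus y)"
  using g
proof (induction rule: carrier_induct)
  interpret \<theta>: group_hom G G \<theta> using \<theta> by unfold_locales
  case one
  then show ?case using y by simp
next
  interpret \<theta>: group_hom G G \<theta> using \<theta> by unfold_locales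
  case (step v k g)
  let ?M = "\<lambda>x. coord y (\<theta> (vertex x))"
  \<comment> \<open>A coordinate at \<open>x\<close> is only defined modulo the order of
    \<open>x\<close>; by \<open>hom_coord_exponent\<close> its product with an entry of column
    \<open>x\<close> is nevertheless defined modulo the order of \<open>y\<close>.\<close>
  have M: "[(a mod modulus x) * ?M x = a * ?M x] (mod modulus y)" if "x \<in> V" for a x
  proof -
    define q r where "q = a div modulus x" and "r = a mod modulus x"
    have "a = modulus x * q + r" by (simp add: q_def r_def)
    then have "a * ?M x - r * ?M x = q * (modulus x * ?M x)" by (simp add: algebra_simps)
    then have "modulus y dvd a * ?M x - r * ?M x" using hom_coord_exponent[OF \<theta> that y] by simp
    then show ?thesis unfolding r_def using cong_iff_dvd_diff cong_sym by blast
  qed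
  have "[coord y (\<theta> (vertex v [^]\<^bsub>G\<^esub> k \<otimes>\<^bsub>G\<^esub> g)) = k * ?M v + coord y (\<theta> g)] (mod modulus y)"
    using y step by (simp add: coord_mult coord_pow \<theta>.hom_int_pow cong_def mod_simps)
  also have "[k * ?M v + coord y (\<theta> g) = k * ?M v + (\<Sum>x\<in>V. coord x g * ?M x)] (mod modulus y)"
    using step.IH by (rule cong_add[OF cong_refl])
  also have "k * ?M v + (\<Sum>x\<in>V. coord x g * ?M x) =
      (\<Sum>x\<in>V. ((if x = v then k else 0) + coord x g) * ?M x)"
    using step(1) finite_V by (simp add: distrib_right sum.distrib if_distrib[of "\<lambda>a. a * _"] sum.delta cong: if_cong)
  also have "[(\<Sum>x\<in>V. ((if x = v then k else 0) + coord x g) * ?M x) =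
      (\<Sum>x\<in>V. coord x (vertex v [^]\<^bsub>G\<^esub> k \<otimes>\<^bsub>G\<^esub> g) * ?M x)] (mod modulus y)"
  proof (rule cong_sum)
    fix x assume x: "x \<in> V"
    have "coord x (vertex v [^]\<^bsub>G\<^esub> k \<otimes>\<^bsub>G\<^esub> g) = ((if x = v then k else 0) + coord x g) mod modulus x"
      using x step by (auto simp: coord_mult coord_vertex_pow mod_simps)
    then show "[((if x = v then k else 0) + coord x g) * ?M x =
        coord x (vertex v [^]\<^bsub>G\<^esub> k \<otimes>\<^bsub>G\<^esub> g) * ?M x] (mod modulus y)"
      using M[OF x] by (simp add: cong_sym)
  qed
  finally show ?case .
qed

text \<open>Equality modulo the commutator subgroup, expressed by coordinates.\<close>

definition similar :: "('a \<times> int) list set set \<Rightarrow> ('a \<times> int) list set set \<Rightarrow> bool" (infix "\<asymp>" 50) where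
  "g \<asymp> h \<longleftrightarrow> (\<forall>v\<in>V. coord v g = coord v h)"

lemma similar_refl [simp]: "g \<asymp> g"
  and similar_sym: "g \<asymp> h \<Longrightarrow> h \<asymp> g"
  and similar_trans: "g \<asymp> h \<Longrightarrow> h \<asymp> k \<Longrightarrow> g \<asymp> k"
  by (simp_all add: similar_def)

lemma similar_hom:
  assumes "\<theta> \<in> hom G G" "g \<in> carrier G" "h \<in> carrier G" "g \<asymp> h"
  shows "\<theta> g \<asymp> \<theta> h"
  unfolding similar_def
proof
  interpret \<theta>: group_hom G G \<theta> using assms(1) by unfold_locales
  fix y assume y: "y \<in> V"
  have "(\<Sum>v\<in>V. coord v g * coord y (\<theta> (vertex v))) = (\<Sum>v\<in>V. coord v h * coord y (\<theta> (vertex v)))"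
    using assms(4) by (intro sum.cong) (auto simp: similar_def)
  then have "[coord y (\<theta> g) = coord y (\<theta> h)] (mod modulus y)"
    using coord_hom_sum[OF assms(1) y assms(2)] coord_hom_sum[OF assms(1) y assms(3)]
    by (metis cong_sym cong_trans)
  then show "coord y (\<theta> g) = coord y (\<theta> h)"
    using coord_mod[OF y] assms by (simp add: cong_def)
qed

lemma similar_conj: "g \<in> carrier G \<Longrightarrow> h \<in> carrier G \<Longrightarrow> g \<otimes>\<^bsub>G\<^esub> h \<otimes>\<^bsub>G\<^esub> inv\<^bsub>G\<^esub> g \<asymp> h"
  using coord_conj[of _ "inv\<^bsub>G\<^esub> g" h] by (simp add: similar_def)

text \<open>The preimage in \<open>G\<close> of the subgroup of the abelianisation spanned by
  \<open>B\<close>. It is blind to conjugation, and intersections of such sets are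
  immediate.\<close>

definition supp_in :: "'a set \<Rightarrow> ('a \<times> int) list set set set" where
  "supp_in B = {g \<in> carrier G. \<forall>v\<in>V - B. coord v g = 0}"

lemma supp_in_similar: "g \<asymp> h \<Longrightarrow> h \<in> carrier G \<Longrightarrow> g \<in> supp_in B \<Longrightarrow> h \<in> supp_in B"
  by (simp add: supp_in_def similar_def)

lemma vertex_in_supp: "v \<in> V \<Longrightarrow> vertex v \<in> supp_in B \<longleftrightarrow> v \<in> B"
  by (auto simp: supp_in_def coord_vertex)

lemma W_in_supp:
  assumes "w \<in> W B" "B \<subseteq> V" shows "w \<in> supp_in B"
  using assms
proof (induction rule: W_induct)
  case (step v k g)
  then have "v \<in> V" using assms(2) by blast
  with step show ?case by (auto simp: supp_in_def coord_mult coord_vertex_pow)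
qed (simp add: supp_in_def)

lemma supp_in_Inter: "\<D> \<noteq> {} \<Longrightarrow> supp_in (\<Inter>\<D>) = (\<Inter>D\<in>\<D>. supp_in D)"
  by (auto simp: supp_in_def)

lemma supp_in_Int: "supp_in (B \<inter> C) = supp_in B \<inter> supp_in C"
  by (auto simp: supp_in_def)

text \<open>The witness is the product of the vertex powers prescribed by the coordinates of
  \<open>g\<close>.\<close>

lemma supp_similar_W:
  assumes g: "g \<in> supp_in B" and B: "B \<subseteq> V"
  obtains w where "w \<in> W B" "w \<asymp> g"
proof -
  have fin: "finite B" using B finite_V finite_subset by blast
  have "\<exists>w\<in>W C. \<forall>v\<in>V. coord v w = (if v \<in> C then coord v g else 0)" if "C \<subseteq> B" for C
    using finite_subset[OF that fin] that
  proof (induction C)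
    case empty
    have "\<one>\<^bsub>G\<^esub> \<in> W {}" by (simp add: W_def generate.one)
    then show ?case by (intro bexI[of _ "\<one>\<^bsub>G\<^esub>"]) simp_all
  next
    case (insert x C)
    then obtain w where w: "w \<in> W C" "\<forall>v\<in>V. coord v w = (if v \<in> C then coord v g else 0)" by blast
    have sub: "insert x C \<subseteq> V" "x \<in> V" "C \<subseteq> V" using insert B by auto
    let ?x = "vertex x [^]\<^bsub>G\<^esub> coord x g"
    have "?x \<otimes>\<^bsub>G\<^esub> w \<in> W (insert x C)"
      using w sub W_mono[of C "insert x C"] by (intro subgroup.m_closed[OF W_subgroup] vertex_pow_in_W) auto
    moreover have "coord v (?x \<otimes>\<^bsub>G\<^esub> w) = (if v \<in> insert x C then coord v g else 0)" if "v \<in> V" for v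
      using that w sub W_closed[OF sub(3) w(1)] insert.hyps(2) g coord_mod[OF that, of g]
      by (auto simp: coord_mult coord_vertex_pow supp_in_def)
    ultimately show ?case by blast
  qed
  from this[of B] obtain w where "w \<in> W B" "\<forall>v\<in>V. coord v w = (if v \<in> B then coord v g else 0)" by blast
  then show ?thesis using that[of w] g by (simp add: similar_def supp_in_def)
qed

lemma clique_subset_star: "clique B E \<Longrightarrow> v \<in> B \<Longrightarrow> B \<subseteq> star v"
  unfolding clique_def in_star_iff subset_iff by metis

text \<open>Inside a complete subgraph containing \<open>v\<close> every element passes the test for
  crossing, so \<open>sector\<close> collects the full exponent of \<open>v\<close>.\<close>

lemma clique_sector:
  assumes cl: "clique B E" "B \<subseteq> V" and w: "w \<in> W B" and v: "v \<in> V"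
  shows "sector v w = vertex v [^]\<^bsub>G\<^esub> coord v w"
  using w cl(2)
proof (induction rule: W_induct)
  case one
  then show ?case using v by simp
next
  case (step u k g)
  have u: "u \<in> V" and g: "g \<in> carrier G" using step cl W_closed by auto
  have "g \<in> W (star v)" if "u = v"
    using clique_subset_star[OF cl(1), of v] W_mono[of B "star v"] step that by auto
  then show ?case using u g v step
    by (simp add: sector_step coord_mult coord_vertex_pow vertex_pow_mod int_pow_mult mod_simps)
qed

text \<open>The quotient of the two elements has zero coordinates, hence trivial sectors by
  \<open>clique_sector\<close>, and is therefore trivial.\<close>

lemma clique_similar_eq:
  assumes cl: "clique B E" "B \<subseteq> V" and w: "w \<in> W B" "w' \<in> W B" "w \<asymp> w'"
  shows "w = w'"
proof -
  interpret B: subgroup "W B" G by (rule W_subgroup[OF cl(2)])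
  let ?u = "w \<otimes>\<^bsub>G\<^esub> inv\<^bsub>G\<^esub> w'"
  have u: "?u \<in> W B" using w by simp
  have coord: "coord v ?u = 0" if "v \<in> V" for v
    using w that by (simp add: coord_mult coord_inv similar_def mod_simps)
  have "?u = \<one>\<^bsub>G\<^esub>"
  proof (rule all_sectors_one)
    show "sector v ?u = \<one>\<^bsub>G\<^esub>" if "v \<in> V" for v
      using clique_sector[OF cl u that] coord[OF that] by simp
  qed (use w in simp)
  then have "?u \<otimes>\<^bsub>G\<^esub> w' = w'" using w by simp
  then show ?thesis using w by (simp add: m_assoc)
qed

subsection \<open>Automorphisms permuting the maximal complete subgraphs\<close>

lemma maximal_complete_subset: "maximal_complete \<Delta> \<Longrightarrow> \<Delta> \<subseteq> V"
  and maximal_complete_clique: "maximal_complete \<Delta> \<Longrightarrow> clique \<Delta> E"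
  by (simp_all add: maximal_complete_def)

lemma finite_maximal_complete: "finite {\<Delta>. maximal_complete \<Delta>}"
  by (rule finite_subset[of _ "Pow V"]) (use finite_V maximal_complete_subset in auto)

lemma clique_extends:
  assumes "clique B E" "B \<subseteq> V"
  obtains \<Delta> where "maximal_complete \<Delta>" "B \<subseteq> \<Delta>"
proof -
  let ?S = "{C. clique C E \<and> B \<subseteq> C \<and> C \<subseteq> V}"
  have "finite ?S" by (rule finite_subset[of _ "Pow V"]) (use finite_V in auto)
  moreover have "B \<in> ?S" using assms by simp
  ultimately obtain \<Delta> where \<Delta>: "\<Delta> \<in> ?S" "\<And>C. C \<in> ?S \<Longrightarrow> \<Delta> \<subseteq> C \<Longrightarrow> \<Delta> = C"
    using finite_has_maximal2[of ?S B] by auto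
  have "\<Delta>' = \<Delta>" if "\<Delta> \<subseteq> \<Delta>'" "\<Delta>' \<subseteq> V" "clique \<Delta>' E" for \<Delta>'
    using \<Delta>(2)[of \<Delta>'] \<Delta>(1) that by auto
  then have "maximal_complete \<Delta>" using \<Delta>(1) by (auto simp: maximal_complete_def)
  then show ?thesis using that \<Delta>(1) by blast
qed

lemma vertex_in_maximal:
  assumes "v \<in> V" obtains \<Delta> where "maximal_complete \<Delta>" "v \<in> \<Delta>"
  by (rule clique_extends[of "{v}"]) (use assms in \<open>auto simp: clique_def\<close>)

lemma edge_in_maximal:
  assumes "{v, w} \<in> E" obtains \<Delta> where "maximal_complete \<Delta>" "v \<in> \<Delta>" "w \<in> \<Delta>"
  by (rule clique_extends[of "{v, w}"])
    (use assms edge_in_V[OF assms] in \<open>auto simp: clique_def insert_commute\<close>)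

lemma maximal_edge: "maximal_complete \<Delta> \<Longrightarrow> v \<in> \<Delta> \<Longrightarrow> w \<in> \<Delta> \<Longrightarrow> v \<noteq> w \<Longrightarrow> {v, w} \<in> E"
  by (auto simp: maximal_complete_def clique_def)

lemma maximal_insert:
  assumes "maximal_complete \<Delta>" "y \<in> V" "\<Delta> \<subseteq> star y" shows "y \<in> \<Delta>"
proof -
  have "clique (insert y \<Delta>) E"
    using assms maximal_complete_clique[OF assms(1)]
    by (auto simp: clique_def in_star_iff insert_commute)
  then have "insert y \<Delta> = \<Delta>" using assms by (auto simp: maximal_complete_def)
  then show ?thesis by auto
qed

definition maps_to :: "(('a \<times> int) list set set \<Rightarrow> ('a \<times> int) list set set) \<Rightarrow> 'a set \<Rightarrow> 'a set \<Rightarrow> bool" where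
  "maps_to \<theta> \<Delta> \<Theta> \<longleftrightarrow> (\<exists>g\<in>carrier G. \<theta> ` W \<Delta> = (\<lambda>w. g \<otimes>\<^bsub>G\<^esub> w \<otimes>\<^bsub>G\<^esub> inv\<^bsub>G\<^esub> g) ` W \<Theta>)"

lemma coset_conj: "g <#\<^bsub>G\<^esub> H #>\<^bsub>G\<^esub> inv\<^bsub>G\<^esub> g = (\<lambda>w. g \<otimes>\<^bsub>G\<^esub> w \<otimes>\<^bsub>G\<^esub> inv\<^bsub>G\<^esub> g) ` H"
  by (auto simp: l_coset_def r_coset_def)

lemma Aut_star_iff: "\<theta> \<in> Aut_star \<longleftrightarrow> \<theta> \<in> auto G \<and>
    (\<forall>\<Delta>. maximal_complete \<Delta> \<longrightarrow> (\<exists>\<Theta>. maximal_complete \<Theta> \<and> maps_to \<theta> \<Delta> \<Theta>))"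
  by (simp add: Aut_star_def coset_conj maps_to_def)

lemma Aut_star_auto: "\<theta> \<in> Aut_star \<Longrightarrow> \<theta> \<in> auto G"
  by (simp add: Aut_star_iff)

text \<open>The conjugating element disappears in the abelianisation, where \<open>\<theta>\<close>
  therefore carries the span of \<open>\<Delta>\<close> onto that of
  \<open>\<Theta>\<close>.\<close>

lemma maps_to_supp:
  assumes \<theta>: "\<theta> \<in> auto G" and m: "maps_to \<theta> \<Delta> \<Theta>" and sub: "\<Delta> \<subseteq> V" "\<Theta> \<subseteq> V" and h: "h \<in> carrier G"
  shows "\<theta> h \<in> supp_in \<Theta> \<longleftrightarrow> h \<in> supp_in \<Delta>"
proof
  obtain g where g: "g \<in> carrier G" and im: "\<theta> ` W \<Delta> = (\<lambda>w. g \<otimes>\<^bsub>G\<^esub> w \<otimes>\<^bsub>G\<^esub> inv\<^bsub>G\<^esub> g) ` W \<Theta>"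
    using m by (auto simp: maps_to_def)
  note cl = auto_closed[OF \<theta>]
  {
    assume "h \<in> supp_in \<Delta>"
    then obtain w where w: "w \<in> W \<Delta>" "w \<asymp> h" using supp_similar_W sub(1) by blast
    have wc: "w \<in> carrier G" using W_closed sub w by blast
    obtain w' where w': "w' \<in> W \<Theta>" "\<theta> w = g \<otimes>\<^bsub>G\<^esub> w' \<otimes>\<^bsub>G\<^esub> inv\<^bsub>G\<^esub> g" using im w(1) by blast
    have wc': "w' \<in> carrier G" using W_closed sub w' by blast
    have "\<theta> w \<asymp> w'" unfolding w'(2) by (rule similar_conj[OF g wc'])
    moreover have "\<theta> w \<asymp> \<theta> h" by (rule similar_hom[OF auto_hom[OF \<theta>] wc h w(2)])
    ultimately have "w' \<asymp> \<theta> h" using similar_sym similar_trans by blast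
    then show "\<theta> h \<in> supp_in \<Theta>"
      using supp_in_similar W_in_supp[OF w'(1) sub(2)] cl[OF h] by blast
  }
  assume "\<theta> h \<in> supp_in \<Theta>"
  then obtain w where w: "w \<in> W \<Theta>" "w \<asymp> \<theta> h" using supp_similar_W sub(2) by blast
  have wc: "w \<in> carrier G" using W_closed sub w by blast
  obtain w' where w': "w' \<in> W \<Delta>" "\<theta> w' = g \<otimes>\<^bsub>G\<^esub> w \<otimes>\<^bsub>G\<^esub> inv\<^bsub>G\<^esub> g"
    using im w(1) by (metis (no_types, lifting) imageE image_eqI)
  have wc': "w' \<in> carrier G" using W_closed sub w' by blast
  have "\<theta> w' \<asymp> w" unfolding w'(2) by (rule similar_conj[OF g wc])
  then have "\<theta> w' \<asymp> \<theta> h" using w(2) similar_trans by blast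
  then have "(inv\<^bsub>AG\<^esub> \<theta>) (\<theta> w') \<asymp> (inv\<^bsub>AG\<^esub> \<theta>) (\<theta> h)"
    using cl wc' h by (intro similar_hom[OF auto_hom[OF AG_inv(1)[OF \<theta>]]]) auto
  then have "w' \<asymp> h" using AG_inv(2)[OF \<theta>] wc' h by simp
  then show "h \<in> supp_in \<Delta>" using supp_in_similar W_in_supp[OF w'(1) sub(1)] h by blast
qed

text \<open>A vertex belongs to the source exactly if its image has support in
  \<open>\<Theta>\<close>, so \<open>\<Theta>\<close> determines the source.\<close>

lemma maps_to_unique:
  assumes \<theta>: "\<theta> \<in> auto G" and "maps_to \<theta> \<Delta> \<Theta>" "maps_to \<theta> \<Delta>' \<Theta>" "\<Delta> \<subseteq> V" "\<Delta>' \<subseteq> V" "\<Theta> \<subseteq> V"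
  shows "\<Delta> = \<Delta>'"
proof -
  have "v \<in> \<Delta> \<longleftrightarrow> v \<in> \<Delta>'" if "v \<in> V" for v
    using maps_to_supp[OF \<theta> assms(2,4,6) vertex_closed[OF that]]
      maps_to_supp[OF \<theta> assms(3,5,6) vertex_closed[OF that]] vertex_in_supp[OF that] by simp
  then show ?thesis using assms(4,5) by blast
qed

text \<open>\<open>Aut_star\<close> only speaks about images of maximal complete subgraphs. By
  finiteness the induced injective map on them is onto, which makes \<open>Aut_star\<close> closed
  under inverses.\<close>

lemma maps_to_surj:
  assumes \<theta>: "\<theta> \<in> Aut_star" and max: "maximal_complete \<Theta>"
  obtains \<Delta> where "maximal_complete \<Delta>" "maps_to \<theta> \<Delta> \<Theta>"
proof -
  let ?M = "{\<Delta>. maximal_complete \<Delta>}"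
  obtain m where m: "\<And>\<Delta>. maximal_complete \<Delta> \<Longrightarrow> maximal_complete (m \<Delta>) \<and> maps_to \<theta> \<Delta> (m \<Delta>)"
    using \<theta> unfolding Aut_star_iff by metis
  have "inj_on m ?M"
  proof (rule inj_onI)
    fix \<Delta> \<Delta>' assume *: "\<Delta> \<in> ?M" "\<Delta>' \<in> ?M" "m \<Delta> = m \<Delta>'"
    then show "\<Delta> = \<Delta>'"
      using maps_to_unique[OF Aut_star_auto[OF \<theta>], of \<Delta> "m \<Delta>" \<Delta>'] m[of \<Delta>] m[of \<Delta>'] maximal_complete_subset
      by auto
  qed
  moreover have "m ` ?M \<subseteq> ?M" using m by auto
  ultimately have "m ` ?M = ?M" using finite_maximal_complete endo_inj_surj by blast
  then show ?thesis using that m max by (metis (mono_tags, lifting) imageE mem_Collect_eq)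
qed

lemma maps_to_comp:
  assumes \<theta>: "\<theta> \<in> auto G" and \<eta>: "\<eta> \<in> auto G" and "maps_to \<eta> \<Delta> \<Theta>" "maps_to \<theta> \<Theta> \<Xi>"
    and sub: "\<Delta> \<subseteq> V" "\<Theta> \<subseteq> V" "\<Xi> \<subseteq> V"
  shows "maps_to (\<theta> \<otimes>\<^bsub>AG\<^esub> \<eta>) \<Delta> \<Xi>"
proof -
  interpret \<theta>: group_hom G G \<theta> by (rule auto_group_hom[OF \<theta>])
  obtain g h where g: "g \<in> carrier G" "\<eta> ` W \<Delta> = (\<lambda>w. g \<otimes>\<^bsub>G\<^esub> w \<otimes>\<^bsub>G\<^esub> inv\<^bsub>G\<^esub> g) ` W \<Theta>"
    and h: "h \<in> carrier G" "\<theta> ` W \<Theta> = (\<lambda>w. h \<otimes>\<^bsub>G\<^esub> w \<otimes>\<^bsub>G\<^esub> inv\<^bsub>G\<^esub> h) ` W \<Xi>"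
    using assms(3,4) by (auto simp: maps_to_def)
  \<comment> \<open>Conjugation by \<open>g\<close> turns into conjugation by
    \<open>\<theta> g\<close> under \<open>\<theta>\<close> and is followed by the conjugation
    belonging to \<open>\<theta>\<close> itself.\<close>
  let ?k = "\<theta> g \<otimes>\<^bsub>G\<^esub> h"
  have "(\<theta> \<otimes>\<^bsub>AG\<^esub> \<eta>) ` W \<Delta> = \<theta> ` \<eta> ` W \<Delta>"
    unfolding image_image using AG_apply[OF \<theta> \<eta>] W_closed[OF sub(1)] by (intro image_cong) simp_all
  also have "\<dots> = (\<lambda>w. \<theta> g \<otimes>\<^bsub>G\<^esub> w \<otimes>\<^bsub>G\<^esub> inv\<^bsub>G\<^esub> (\<theta> g)) ` \<theta> ` W \<Theta>"
    unfolding g(2) image_image using W_closed[OF sub(2)] g(1) by (intro image_cong) simp_all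
  also have "\<dots> = (\<lambda>w. ?k \<otimes>\<^bsub>G\<^esub> w \<otimes>\<^bsub>G\<^esub> inv\<^bsub>G\<^esub> ?k) ` W \<Xi>"
    unfolding h(2) image_image using W_closed[OF sub(3)] g(1) h(1)
    by (intro image_cong) (simp_all add: inv_mult_group m_assoc)
  finally show ?thesis using g h unfolding maps_to_def by (intro bexI[of _ ?k]) simp_all
qed

lemma maps_to_inv:
  assumes \<theta>: "\<theta> \<in> auto G" and "maps_to \<theta> \<Delta> \<Theta>" and sub: "\<Delta> \<subseteq> V" "\<Theta> \<subseteq> V"
  shows "maps_to (inv\<^bsub>AG\<^esub> \<theta>) \<Theta> \<Delta>"
proof -
  let ?\<eta> = "inv\<^bsub>AG\<^esub> \<theta>"
  interpret \<eta>: group_hom G G ?\<eta> by (rule auto_group_hom[OF AG_inv(1)[OF \<theta>]])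
  obtain g where g: "g \<in> carrier G" "\<theta> ` W \<Delta> = (\<lambda>w. g \<otimes>\<^bsub>G\<^esub> w \<otimes>\<^bsub>G\<^esub> inv\<^bsub>G\<^esub> g) ` W \<Theta>"
    using assms(2) by (auto simp: maps_to_def)
  let ?k = "inv\<^bsub>G\<^esub> (?\<eta> g)"
  have "W \<Delta> = ?\<eta> ` \<theta> ` W \<Delta>"
    unfolding image_image using AG_inv(2)[OF \<theta>] W_closed[OF sub(1)] by simp
  also have "\<dots> = (\<lambda>w. ?\<eta> g \<otimes>\<^bsub>G\<^esub> ?\<eta> w \<otimes>\<^bsub>G\<^esub> inv\<^bsub>G\<^esub> (?\<eta> g)) ` W \<Theta>"
    unfolding g(2) image_image using W_closed[OF sub(2)] g(1) by (intro image_cong) simp_all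
  finally have "(\<lambda>w. ?k \<otimes>\<^bsub>G\<^esub> w \<otimes>\<^bsub>G\<^esub> inv\<^bsub>G\<^esub> ?k) ` W \<Delta> =
      (\<lambda>w. ?k \<otimes>\<^bsub>G\<^esub> w \<otimes>\<^bsub>G\<^esub> inv\<^bsub>G\<^esub> ?k) ` (\<lambda>w. ?\<eta> g \<otimes>\<^bsub>G\<^esub> ?\<eta> w \<otimes>\<^bsub>G\<^esub> inv\<^bsub>G\<^esub> (?\<eta> g)) ` W \<Theta>"
    by (simp only:)
  also have "\<dots> = ?\<eta> ` W \<Theta>"
    unfolding image_image using W_closed[OF sub(2)] g(1) by (intro image_cong) (simp_all add: m_assoc)
  finally show ?thesis using g(1) unfolding maps_to_def by (intro bexI[of _ ?k]) simp_all
qed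

lemma maps_to_refl_one: "B \<subseteq> V \<Longrightarrow> maps_to \<one>\<^bsub>AG\<^esub> B B"
  unfolding maps_to_def using W_closed
  by (intro bexI[of _ "\<one>\<^bsub>G\<^esub>"] image_cong) (simp_all add: AG_one_apply)

lemma subgroup_Aut_star: "subgroup Aut_star AG"
proof -
  interpret AG: group AG by (rule AutoGroup)
  show ?thesis
  proof (rule subgroup.intro)
    show "Aut_star \<subseteq> carrier AG" using Aut_star_auto by auto
    show "\<one>\<^bsub>AG\<^esub> \<in> Aut_star"
      using AG.one_closed maps_to_refl_one maximal_complete_subset by (auto simp: Aut_star_iff)
    show "\<theta> \<otimes>\<^bsub>AG\<^esub> \<eta> \<in> Aut_star" if \<theta>: "\<theta> \<in> Aut_star" and \<eta>: "\<eta> \<in> Aut_star" for \<theta> \<eta>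
      unfolding Aut_star_iff
    proof (intro conjI allI impI)
      show "\<theta> \<otimes>\<^bsub>AG\<^esub> \<eta> \<in> auto G" using \<theta> \<eta> Aut_star_auto AG_mult_closed by blast
      fix \<Delta> assume \<Delta>: "maximal_complete \<Delta>"
      obtain \<Theta> where \<Theta>: "maximal_complete \<Theta>" "maps_to \<eta> \<Delta> \<Theta>" using \<Delta> \<eta> Aut_star_iff by blast
      obtain \<Xi> where \<Xi>: "maximal_complete \<Xi>" "maps_to \<theta> \<Theta> \<Xi>" using \<Theta> \<theta> Aut_star_iff by blast
      show "\<exists>\<Xi>. maximal_complete \<Xi> \<and> maps_to (\<theta> \<otimes>\<^bsub>AG\<^esub> \<eta>) \<Delta> \<Xi>"
        using maps_to_comp[OF Aut_star_auto[OF \<theta>] Aut_star_auto[OF \<eta>] \<Theta>(2) \<Xi>(2)]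
          \<Delta> \<Theta> \<Xi> maximal_complete_subset by blast
    qed
    show "inv\<^bsub>AG\<^esub> \<theta> \<in> Aut_star" if \<theta>: "\<theta> \<in> Aut_star" for \<theta>
      unfolding Aut_star_iff
    proof (intro conjI allI impI)
      show "inv\<^bsub>AG\<^esub> \<theta> \<in> auto G" using \<theta> Aut_star_auto AG_inv(1) by blast
      fix \<Theta> assume \<Theta>: "maximal_complete \<Theta>"
      obtain \<Delta> where "maximal_complete \<Delta>" "maps_to \<theta> \<Delta> \<Theta>" by (rule maps_to_surj[OF \<theta> \<Theta>])
      then show "\<exists>\<Delta>. maximal_complete \<Delta> \<and> maps_to (inv\<^bsub>AG\<^esub> \<theta>) \<Theta> \<Delta>"
        using maps_to_inv[OF Aut_star_auto[OF \<theta>]] \<Theta> maximal_complete_subset by blast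
    qed
  qed
qed

subsection \<open>The generators\<close>

abbreviation (input) S where "S \<equiv> generate AG star_generators"

lemma hom_W_subset:
  assumes \<theta>: "\<theta> \<in> hom G G" and B: "B \<subseteq> V" and C: "C \<subseteq> V" and im: "\<And>v. v \<in> B \<Longrightarrow> \<theta> (vertex v) \<in> W C"
  shows "\<theta> ` W B \<subseteq> W C"
proof
  interpret \<theta>: group_hom G G \<theta> using \<theta> by unfold_locales
  interpret C: subgroup "W C" G by (rule W_subgroup[OF C])
  fix h assume "h \<in> \<theta> ` W B"
  then obtain w where w: "w \<in> W B" "h = \<theta> w" by blast
  from w(1) B have "\<theta> w \<in> W C"
  proof (induction rule: W_induct)
    case (step v k g)
    then have "v \<in> V" "g \<in> carrier G" using B W_closed by auto
    then show ?case using step im[of v] subgroup_int_pow_closed[OF W_subgroup[OF C]]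
      by (simp add: \<theta>.hom_int_pow)
  qed simp
  then show "h \<in> W C" using w by simp
qed

lemma maps_toI: "\<Theta> \<subseteq> V \<Longrightarrow> \<theta> ` W \<Delta> = W \<Theta> \<Longrightarrow> maps_to \<theta> \<Delta> \<Theta>"
  unfolding maps_to_def using W_closed by (intro bexI[of _ "\<one>\<^bsub>G\<^esub>"]) simp_all

lemma endo_maps_to:
  assumes ad: "admissible \<phi>" "admissible \<phi>'"
    and inv: "\<And>v. v \<in> V \<Longrightarrow> endo \<phi> (\<phi>' v) = vertex v"
    and sub: "B \<subseteq> V" "C \<subseteq> V"
    and im: "\<And>v. v \<in> B \<Longrightarrow> \<phi> v \<in> W C" "\<And>v. v \<in> C \<Longrightarrow> \<phi>' v \<in> W B"
  shows "maps_to (endo \<phi>) B C"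
proof (rule maps_toI[OF sub(2)])
  have le: "endo \<phi> ` W B \<subseteq> W C" "endo \<phi>' ` W C \<subseteq> W B"
    using hom_W_subset[OF endo_hom[OF ad(1)] sub] hom_W_subset[OF endo_hom[OF ad(2)] sub(2,1)] im sub
    by (simp_all add: endo_vertex[OF ad(1)] endo_vertex[OF ad(2)] subset_iff)
  have "endo \<phi> (endo \<phi>' g) = g" if "g \<in> carrier G" for g
  proof (rule hom_eqI[OF group_G _ _ _ that])
    show "(\<lambda>g. endo \<phi> (endo \<phi>' g)) \<in> hom G G" "(\<lambda>g. g) \<in> hom G G"
      using endo_hom[OF ad(1)] endo_hom[OF ad(2)] by (simp_all add: hom_def Pi_def)
  qed (simp add: endo_vertex ad inv)
  then have eq: "w = endo \<phi> (endo \<phi>' w)" if "w \<in> W C" for w using that W_closed sub by simp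
  have "W C \<subseteq> endo \<phi> ` W B"
  proof
    fix w assume w: "w \<in> W C"
    then have "endo \<phi>' w \<in> W B" using le(2) by blast
    with eq[OF w] show "w \<in> endo \<phi> ` W B" by (rule image_eqI[where f = "endo \<phi>"])
  qed
  with le(1) show "endo \<phi> ` W B = W C" by (rule subset_antisym)
qed

lemma identity_endo:
  assumes "extends_to \<phi> \<theta>" "\<And>v. v \<in> V \<Longrightarrow> \<phi> v = vertex v"
  shows "\<theta> = \<one>\<^bsub>AG\<^esub>"
proof (rule extends_to_unique[OF assms(1)])
  have "\<one>\<^bsub>AG\<^esub> \<in> auto G" using monoid.one_closed[OF group.is_monoid[OF AutoGroup]] by simp
  then show "extends_to \<phi> \<one>\<^bsub>AG\<^esub>"
    using assms(2) by (simp add: extends_to_def auto_def Bij_def AG_one_apply)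
qed

subsubsection \<open>Labeled graph automorphisms\<close>

definition graph_auto :: "('a \<Rightarrow> 'a) \<Rightarrow> bool" where
  "graph_auto \<pi> \<longleftrightarrow> bij_betw \<pi> V V \<and> (\<forall>x\<in>V. \<forall>y\<in>V. {x, y} \<in> E \<longleftrightarrow> {\<pi> x, \<pi> y} \<in> E) \<and>
    (\<forall>v\<in>V. lab (\<pi> v) = lab v)"

lemma graph_auto_in_V: "graph_auto \<pi> \<Longrightarrow> v \<in> V \<Longrightarrow> \<pi> v \<in> V"
  by (auto simp: graph_auto_def bij_betw_def)

lemma graph_auto_edge: "graph_auto \<pi> \<Longrightarrow> x \<in> V \<Longrightarrow> y \<in> V \<Longrightarrow> {\<pi> x, \<pi> y} \<in> E \<longleftrightarrow> {x, y} \<in> E"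
  by (simp add: graph_auto_def)

lemma graph_auto_inv:
  assumes "graph_auto \<pi>" shows "graph_auto (inv_into V \<pi>)"
proof -
  have bij: "bij_betw \<pi> V V" using assms by (simp add: graph_auto_def)
  have r: "inv_into V \<pi> v \<in> V" "\<pi> (inv_into V \<pi> v) = v" if "v \<in> V" for v
    using that bij by (simp_all add: bij_betw_def f_inv_into_f inv_into_into)
  show ?thesis unfolding graph_auto_def
  proof (intro conjI ballI)
    show "bij_betw (inv_into V \<pi>) V V" by (rule bij_betw_inv_into[OF bij])
    show "{x, y} \<in> E \<longleftrightarrow> {inv_into V \<pi> x, inv_into V \<pi> y} \<in> E" if "x \<in> V" "y \<in> V" for x y
      using graph_auto_edge[OF assms r(1)[OF that(1)] r(1)[OF that(2)]] r that by simp
    show "lab (inv_into V \<pi> v) = lab v" if "v \<in> V" for v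
      using assms r[OF that] by (metis graph_auto_def)
  qed
qed

lemma graph_auto_admissible:
  assumes "graph_auto \<pi>" shows "admissible (\<lambda>v. vertex (\<pi> v))"
  unfolding admissible_def
proof (intro conjI ballI allI impI)
  fix v assume v: "v \<in> V"
  then show "vertex (\<pi> v) \<in> carrier G" using graph_auto_in_V[OF assms] by simp
  have "modulus v = modulus (\<pi> v)" using assms v by (simp add: graph_auto_def modulus_def)
  then show "vertex (\<pi> v) [^]\<^bsub>G\<^esub> modulus v = \<one>\<^bsub>G\<^esub>"
    using vertex_exponent[OF graph_auto_in_V[OF assms v]] by simp
next
  fix v w assume "{v, w} \<in> E"
  then have "{\<pi> v, \<pi> w} \<in> E" using graph_auto_edge[OF assms] edge_in_V by blast
  then show "vertex (\<pi> v) \<otimes>\<^bsub>G\<^esub> vertex (\<pi> w) = vertex (\<pi> w) \<otimes>\<^bsub>G\<^esub> vertex (\<pi> v)" by (rule vertex_commute)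
qed

lemma graph_auto_maximal:
  assumes \<pi>: "graph_auto \<pi>" and max: "maximal_complete \<Delta>"
  shows "maximal_complete (\<pi> ` \<Delta>)"
proof -
  have clique: "clique (\<rho> ` B) E" "\<rho> ` B \<subseteq> V" if "graph_auto \<rho>" "clique B E" "B \<subseteq> V" for \<rho> B
    using that graph_auto_edge[OF that(1)] graph_auto_in_V[OF that(1)]
    by (auto simp: clique_def subset_iff)
  have bij: "bij_betw \<pi> V V" using \<pi> by (simp add: graph_auto_def)
  have sub: "\<Delta> \<subseteq> V" and cl: "clique \<Delta> E" using max by (simp_all add: maximal_complete_def)
  have inv: "inv_into V \<pi> ` \<pi> ` B = B" "\<pi> ` inv_into V \<pi> ` B = B" if "B \<subseteq> V" for B
    using bij that by (simp_all add: bij_betw_def inv_into_image_cancel image_inv_into_cancel)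
  have "C = \<pi> ` \<Delta>" if "\<pi> ` \<Delta> \<subseteq> C" "C \<subseteq> V" "clique C E" for C
  proof -
    have "\<Delta> \<subseteq> inv_into V \<pi> ` C" using image_mono[OF that(1), of "inv_into V \<pi>"] inv(1)[OF sub] by simp
    then have "inv_into V \<pi> ` C = \<Delta>"
      using clique[OF graph_auto_inv[OF \<pi>] that(3,2)] max by (simp add: maximal_complete_def)
    then show ?thesis using inv(2)[OF that(2)] by simp
  qed
  then show ?thesis using clique[OF \<pi> cl sub] by (simp add: maximal_complete_def)
qed

lemma graph_auto_endo:
  assumes \<pi>: "graph_auto \<pi>"
  shows "endo (\<lambda>v. vertex (\<pi> v)) \<in> auto G" and "endo (\<lambda>v. vertex (\<pi> v)) \<in> Aut_star"
    and "endo (\<lambda>v. vertex (\<pi> v)) \<in> S"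
proof -
  let ?\<rho> = "inv_into V \<pi>"
  note ad = graph_auto_admissible[OF \<pi>] graph_auto_admissible[OF graph_auto_inv[OF \<pi>]]
  have bij: "bij_betw \<pi> V V" using \<pi> by (simp add: graph_auto_def)
  have r: "?\<rho> v \<in> V" "\<pi> (?\<rho> v) = v" "?\<rho> (\<pi> v) = v" "\<pi> v \<in> V" if "v \<in> V" for v
    using that bij graph_auto_in_V[OF \<pi> that]
    by (simp_all add: bij_betw_def f_inv_into_f inv_into_into)
  have inv: "endo (\<lambda>v. vertex (\<pi> v)) (vertex (?\<rho> v)) = vertex v"
    "endo (\<lambda>v. vertex (?\<rho> v)) (vertex (\<pi> v)) = vertex v" if "v \<in> V" for v
    using that r endo_vertex[OF ad(1)] endo_vertex[OF ad(2)] by simp_all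
  show auto: "endo (\<lambda>v. vertex (\<pi> v)) \<in> auto G" by (rule endo_auto[OF ad inv])
  show "endo (\<lambda>v. vertex (\<pi> v)) \<in> Aut_star"
    unfolding Aut_star_iff
  proof (intro conjI allI impI auto)
    fix \<Delta> assume \<Delta>: "maximal_complete \<Delta>"
    have "maps_to (endo (\<lambda>v. vertex (\<pi> v))) \<Delta> (\<pi> ` \<Delta>)"
    proof (rule endo_maps_to[OF ad inv(1)])
      show sub: "\<Delta> \<subseteq> V" "\<pi> ` \<Delta> \<subseteq> V"
        using maximal_complete_subset[OF \<Delta>] maximal_complete_subset[OF graph_auto_maximal[OF \<pi> \<Delta>]] by auto
      show "vertex (?\<rho> v) \<in> W \<Delta>" if "v \<in> \<pi> ` \<Delta>" for v
        using that r(3) sub(1) by (auto intro!: vertex_in_W)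
    qed (auto intro: vertex_in_W)
    then show "\<exists>\<Theta>. maximal_complete \<Theta> \<and> maps_to (endo (\<lambda>v. vertex (\<pi> v))) \<Delta> \<Theta>"
      using graph_auto_maximal[OF \<pi> \<Delta>] by blast
  qed
  have "endo (\<lambda>v. vertex (\<pi> v)) \<in> labeled_graph_automorphisms"
    using \<pi> endo_extends[OF ad(1)] unfolding labeled_graph_automorphisms_def graph_auto_def by blast
  then show "endo (\<lambda>v. vertex (\<pi> v)) \<in> S" by (auto intro: generate.incl simp: star_generators_def)
qed

subsubsection \<open>Factor automorphisms\<close>

definition factor_map :: "'a \<Rightarrow> int \<Rightarrow> 'a \<Rightarrow> ('a \<times> int) list set set" where
  "factor_map v m = vertex(v := vertex v [^]\<^bsub>G\<^esub> m)"

lemma factor_admissible: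
  assumes v: "v \<in> V" shows "admissible (factor_map v m)"
  unfolding admissible_def
proof (intro conjI ballI allI impI)
  fix z assume z: "z \<in> V"
  then show "factor_map v m z \<in> carrier G" using v by (simp add: factor_map_def)
  show "factor_map v m z [^]\<^bsub>G\<^esub> modulus z = \<one>\<^bsub>G\<^esub>"
    using z v vertex_exponent[OF z] vertex_pow_eq_one_iff[OF v] by (simp add: factor_map_def int_pow_pow)
next
  fix z w assume e: "{z, w} \<in> E"
  have *: "vertex z [^]\<^bsub>G\<^esub> k \<otimes>\<^bsub>G\<^esub> vertex w = vertex w \<otimes>\<^bsub>G\<^esub> vertex z [^]\<^bsub>G\<^esub> k"
    if "{z, w} \<in> E" for z w and k :: int
    using edge_in_V[OF that] vertex_commute[OF that] by (intro commute_pow) auto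
  have "{w, z} \<in> E" using e by (simp add: insert_commute)
  then show "factor_map v m z \<otimes>\<^bsub>G\<^esub> factor_map v m w = factor_map v m w \<otimes>\<^bsub>G\<^esub> factor_map v m z"
    using *[OF e, of m] *[of w z m] vertex_commute[OF e] edge_in_V[OF e] unfolding factor_map_def by auto
qed

lemma factor_inverse:
  assumes v: "v \<in> V" and m: "[m * m' = 1] (mod modulus v)" and z: "z \<in> V"
  shows "endo (factor_map v m) (factor_map v m' z) = vertex z"
proof (cases "z = v")
  case True
  interpret \<theta>: group_hom G G "endo (factor_map v m)"
    using endo_hom[OF factor_admissible[OF v]] by unfold_locales
  have e: "endo (factor_map v m) (vertex v) = vertex v [^]\<^bsub>G\<^esub> m"
    using endo_vertex[OF factor_admissible[OF v] v, of m] by (simp add: factor_map_def)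
  have z_eq: "factor_map v m' z = vertex v [^]\<^bsub>G\<^esub> m'" using True by (simp add: factor_map_def)
  have "endo (factor_map v m) (factor_map v m' z) = vertex v [^]\<^bsub>G\<^esub> (m * m')"
    unfolding z_eq using v by (simp add: \<theta>.hom_int_pow e int_pow_pow)
  also have "\<dots> = vertex v [^]\<^bsub>G\<^esub> ((m * m') mod modulus v)"
    using vertex_pow_mod[OF v] by simp
  also have "\<dots> = vertex v" using m vertex_pow_mod[OF v, of 1] v by (simp add: cong_def)
  finally show ?thesis using True by simp
next
  case False
  then show ?thesis using z endo_vertex[OF factor_admissible[OF v] z] by (simp add: factor_map_def)
qed

lemma factor_endo:
  assumes v: "v \<in> V" and m: "coprime m (modulus v)"
  shows "endo (factor_map v m) \<in> auto G" and "endo (factor_map v m) \<in> Aut_star"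
    and "endo (factor_map v m) \<in> S"
proof -
  obtain m' where m': "[m * m' = 1] (mod modulus v)" using m cong_solve_coprime_int by blast
  then have m'': "[m' * m = 1] (mod modulus v)" by (simp add: mult.commute)
  note ad = factor_admissible[OF v, of m] factor_admissible[OF v, of m']
  note inv = factor_inverse[OF v m'] factor_inverse[OF v m'']
  show auto: "endo (factor_map v m) \<in> auto G" by (rule endo_auto[OF ad inv])
  have in_W: "factor_map v k z \<in> W B" if "z \<in> B" "B \<subseteq> V" for z k B
    using vertex_in_W[OF that(1)] vertex_pow_in_W[OF that(2,1)]
    by (cases "z = v") (simp_all add: factor_map_def)
  show "endo (factor_map v m) \<in> Aut_star"
    unfolding Aut_star_iff
  proof (intro conjI allI impI auto)
    fix \<Delta> assume \<Delta>: "maximal_complete \<Delta>"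
    have sub: "\<Delta> \<subseteq> V" by (rule maximal_complete_subset[OF \<Delta>])
    have "maps_to (endo (factor_map v m)) \<Delta> \<Delta>"
      by (rule endo_maps_to[OF ad inv(1) sub sub]) (simp_all add: in_W sub)
    then show "\<exists>\<Theta>. maximal_complete \<Theta> \<and> maps_to (endo (factor_map v m)) \<Delta> \<Theta>"
      using \<Delta> by blast
  qed
  show "endo (factor_map v m) \<in> S"
  proof (cases "m = 1")
    case True
    then have "endo (factor_map v m) = \<one>\<^bsub>AG\<^esub>"
      using v by (intro identity_endo[OF endo_extends[OF ad(1)]]) (simp add: factor_map_def)
    then show ?thesis using generate.one[of AG] by simp
  next
    case False
    \<comment> \<open>Being coprime to modulus 0 means being a unit, and \<open>m \<noteq> 1\<close>
      leaves \<open>-1\<close>. The value \<open>m = 1\<close>, excluded from the generators, was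
      the identity.\<close>
    from v have "case lab v of \<infinity> \<Rightarrow> m = -1 | enat n \<Rightarrow> m \<noteq> 1 \<and> coprime m (int n)"
    proof (cases rule: modulus_cases)
      case 1
      then have "is_unit m" using m by simp
      then show ?thesis using False 1 by (auto simp: zdvd1_eq)
    next
      case (2 p a)
      then show ?thesis using False m by simp
    qed
    then have "endo (factor_map v m) \<in> factor_automorphisms"
      using v endo_extends[OF ad(1)] unfolding factor_automorphisms_def factor_map_def by blast
    then show ?thesis by (auto intro: generate.incl simp: star_generators_def)
  qed
qed

lemma factor_automorphisms_subset: "factor_automorphisms \<subseteq> Aut_star"
proof
  fix \<theta> assume "\<theta> \<in> factor_automorphisms"
  then obtain v m where v: "v \<in> V" and m: "case lab v of \<infinity> \<Rightarrow> m = -1 | enat n \<Rightarrow> m \<noteq> 1 \<and> coprime m (int n)"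
    and \<theta>: "extends_to (factor_map v m) \<theta>"
    unfolding factor_automorphisms_def factor_map_def by blast
  have "coprime m (modulus v)" using m by (auto simp: modulus_def split: enat.splits)
  from factor_endo(2)[OF v this] show "\<theta> \<in> Aut_star" using endo_eq[OF \<theta>] by simp
qed

subsubsection \<open>One-parameter families\<close>

text \<open>A homomorphism from the integers to the automorphisms, described on vertices. Inverses
  come with the family, and membership in a subgroup has to be checked only for the parameter
  1.\<close>

definition one_parameter :: "(int \<Rightarrow> 'a \<Rightarrow> ('a \<times> int) list set set) \<Rightarrow> bool" where
  "one_parameter F \<longleftrightarrow> (\<forall>k. admissible (F k)) \<and> (\<forall>a b. \<forall>v\<in>V. endo (F a) (F b v) = F (a + b) v) \<and>
    (\<forall>v\<in>V. F 0 v = vertex v)"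

context
  fixes F assumes F: "one_parameter F"
begin

lemma one_parameter_admissible: "admissible (F k)"
  and one_parameter_add: "v \<in> V \<Longrightarrow> endo (F a) (F b v) = F (a + b) v"
  and one_parameter_zero: "v \<in> V \<Longrightarrow> F 0 v = vertex v"
  using F by (simp_all add: one_parameter_def)

lemma one_parameter_auto: "endo (F k) \<in> auto G"
  by (rule endo_auto[of "F k" "F (- k)"])
    (simp_all add: one_parameter_admissible one_parameter_add one_parameter_zero)

lemma one_parameter_hom: "(\<lambda>k. endo (F k)) \<in> hom integer_group AG"
proof (rule homI)
  fix a b
  show "endo (F (a \<otimes>\<^bsub>integer_group\<^esub> b)) = endo (F a) \<otimes>\<^bsub>AG\<^esub> endo (F b)"
  proof (rule auto_eqI)
    show "endo (F a) \<otimes>\<^bsub>AG\<^esub> endo (F b) \<in> auto G" by (intro AG_mult_closed one_parameter_auto)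
    show "endo (F (a \<otimes>\<^bsub>integer_group\<^esub> b)) (vertex v) = (endo (F a) \<otimes>\<^bsub>AG\<^esub> endo (F b)) (vertex v)" if "v \<in> V" for v
      using that AG_apply[OF one_parameter_auto one_parameter_auto]
      by (simp add: endo_vertex one_parameter_admissible one_parameter_add)
  qed (rule one_parameter_auto)
qed (simp add: one_parameter_auto)

lemma one_parameter_generate:
  assumes "subgroup H AG" "endo (F 1) \<in> H" shows "endo (F k) \<in> H"
proof -
  have "endo (F (1 [^]\<^bsub>integer_group\<^esub> k)) = endo (F 1) [^]\<^bsub>AG\<^esub> k"
    using hom_int_pow[where x = 1 and n = k, OF one_parameter_hom _ group_integer_group AutoGroup] by simp
  then show ?thesis using group.subgroup_int_pow_closed[OF AutoGroup assms] by simp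
qed

lemma one_parameter_maps_to:
  assumes "B \<subseteq> V" "\<And>k v. v \<in> B \<Longrightarrow> F k v \<in> W B"
  shows "maps_to (endo (F k)) B B"
  by (rule endo_maps_to[of "F k" "F (- k)"])
    (simp_all add: assms one_parameter_admissible one_parameter_add one_parameter_zero)

end

subsubsection \<open>Transvections\<close>

definition transv :: "'a \<Rightarrow> 'a \<Rightarrow> int \<Rightarrow> 'a \<Rightarrow> ('a \<times> int) list set set" where
  "transv x y k = vertex(x := vertex x \<otimes>\<^bsub>G\<^esub> vertex y [^]\<^bsub>G\<^esub> k)"

lemma transvection_map_transv: "transvection_map x y q = transv x y (int q)"
  by (simp add: transvection_map_def transv_def int_pow_int)

lemma mult_commute_assoc:
  assumes "a \<in> carrier G" "b \<in> carrier G" "c \<in> carrier G"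
    and "a \<otimes>\<^bsub>G\<^esub> c = c \<otimes>\<^bsub>G\<^esub> a" "b \<otimes>\<^bsub>G\<^esub> c = c \<otimes>\<^bsub>G\<^esub> b"
  shows "(a \<otimes>\<^bsub>G\<^esub> b) \<otimes>\<^bsub>G\<^esub> c = c \<otimes>\<^bsub>G\<^esub> (a \<otimes>\<^bsub>G\<^esub> b)"
proof -
  have "(a \<otimes>\<^bsub>G\<^esub> b) \<otimes>\<^bsub>G\<^esub> c = a \<otimes>\<^bsub>G\<^esub> (c \<otimes>\<^bsub>G\<^esub> b)" using assms by (simp add: m_assoc)
  also have "\<dots> = (c \<otimes>\<^bsub>G\<^esub> a) \<otimes>\<^bsub>G\<^esub> b" using assms(1-3) by (simp add: m_assoc[symmetric] assms(4))
  finally show ?thesis using assms(1-3) by (simp add: m_assoc)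
qed

lemma edge_pow_commute:
  assumes "{v, w} \<in> E"
  shows "vertex v [^]\<^bsub>G\<^esub> (k :: int) \<otimes>\<^bsub>G\<^esub> vertex w = vertex w \<otimes>\<^bsub>G\<^esub> vertex v [^]\<^bsub>G\<^esub> k"
  using edge_in_V[OF assms] vertex_commute[OF assms] by (intro commute_pow) auto

lemma transv_exponent:
  assumes e: "{x, y} \<in> E"
  shows "transv x y k x [^]\<^bsub>G\<^esub> modulus x = vertex y [^]\<^bsub>G\<^esub> (k * modulus x)"
proof -
  have "{y, x} \<in> E" using e by (simp add: insert_commute)
  then have "vertex x \<otimes>\<^bsub>G\<^esub> vertex y [^]\<^bsub>G\<^esub> k = vertex y [^]\<^bsub>G\<^esub> k \<otimes>\<^bsub>G\<^esub> vertex x"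
    using edge_pow_commute by simp
  then show ?thesis using edge_in_V[OF e]
    by (simp add: transv_def int_pow_mult_distrib vertex_exponent int_pow_pow)
qed

text \<open>The inclusion of links lets \<open>y\<close> commute with all neighbours of
  \<open>x\<close>. As \<open>x\<close> and \<open>y\<close> commute, \<open>x y^k\<close> raised to
  the order of \<open>x\<close> is a power of \<open>y\<close>, which the divisibility
  kills.\<close>

lemma transv_admissible:
  assumes e: "{x, y} \<in> E" and link: "link x \<subseteq> star y" and dvd: "modulus y dvd k * modulus x"
  shows "admissible (transv x y k)"
  unfolding admissible_def
proof (intro conjI ballI allI impI)
  have xy: "x \<in> V" "y \<in> V" "x \<noteq> y" using edge_in_V[OF e] by auto
  {
    fix z assume z: "z \<in> V"
    then show "transv x y k z \<in> carrier G" using xy by (simp add: transv_def)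
    show "transv x y k z [^]\<^bsub>G\<^esub> modulus z = \<one>\<^bsub>G\<^esub>"
    proof (cases "z = x")
      case True
      then show ?thesis using transv_exponent[OF e] vertex_pow_eq_one_iff[OF xy(2)] dvd by simp
    next
      case False
      then show ?thesis using z vertex_exponent by (simp add: transv_def)
    qed
  }
  have comm: "transv x y k x \<otimes>\<^bsub>G\<^esub> vertex w = vertex w \<otimes>\<^bsub>G\<^esub> transv x y k x" if "{x, w} \<in> E" for w
  proof -
    have w: "w \<in> V" using edge_in_V[OF that] by simp
    have "w \<in> star y" using that link w by (auto simp: link_def)
    then have "vertex y [^]\<^bsub>G\<^esub> k \<otimes>\<^bsub>G\<^esub> vertex w = vertex w \<otimes>\<^bsub>G\<^esub> vertex y [^]\<^bsub>G\<^esub> k"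
      using edge_pow_commute[of y w k] commute_pow[of "vertex y" "vertex y" k] xy unfolding in_star_iff by auto
    then show ?thesis using xy w vertex_commute[OF that] by (simp add: transv_def mult_commute_assoc)
  qed
  fix v w assume vw: "{v, w} \<in> E"
  consider "v = x" "w \<noteq> x" | "w = x" "v \<noteq> x" | "v \<noteq> x" "w \<noteq> x" using edge_in_V[OF vw] by blast
  then show "transv x y k v \<otimes>\<^bsub>G\<^esub> transv x y k w = transv x y k w \<otimes>\<^bsub>G\<^esub> transv x y k v"
  proof cases
    case 1
    then show ?thesis using comm[of w] vw by (simp add: transv_def)
  next
    case 2
    then show ?thesis using comm[of v] vw by (simp add: transv_def insert_commute)
  next
    case 3
    then show ?thesis using vertex_commute[OF vw] by (simp add: transv_def)
  qed
qed

text \<open>The step \<open>q\<close> is kept as a factor because only its multiples are known to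
  satisfy the divisibility.\<close>

lemma transv_one_parameter:
  assumes e: "{x, y} \<in> E" and link: "link x \<subseteq> star y" and dvd: "modulus y dvd q * modulus x"
  shows "one_parameter (\<lambda>j. transv x y (q * j))"
  unfolding one_parameter_def
proof (intro conjI allI ballI)
  have xy: "x \<in> V" "y \<in> V" "x \<noteq> y" using edge_in_V[OF e] by auto
  have "modulus y dvd q * j * modulus x" for j
  proof -
    have "q * j * modulus x = (q * modulus x) * j" by simp
    then show ?thesis using dvd by (metis dvd_mult2)
  qed
  then show ad: "admissible (transv x y (q * j))" for j by (intro transv_admissible[OF e link])
  fix a b v assume v: "v \<in> V"
  interpret \<theta>: group_hom G G "endo (transv x y (q * a))"
    using endo_hom[OF ad] by unfold_locales
  have *: "endo (transv x y (q * a)) (vertex z) = transv x y (q * a) z" if "z \<in> V" for z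
    by (rule endo_vertex[OF ad that])
  show "endo (transv x y (q * a)) (transv x y (q * b) v) = transv x y (q * (a + b)) v"
  proof (cases "v = x")
    case True
    have v_eq: "transv x y (q * b) v = vertex x \<otimes>\<^bsub>G\<^esub> vertex y [^]\<^bsub>G\<^esub> (q * b)" using True by (simp add: transv_def)
    have y_eq: "transv x y (q * a) y = vertex y" using xy by (simp add: transv_def)
    have "endo (transv x y (q * a)) (transv x y (q * b) v) = transv x y (q * a) x \<otimes>\<^bsub>G\<^esub> vertex y [^]\<^bsub>G\<^esub> (q * b)"
      unfolding v_eq using *[OF xy(1)] *[OF xy(2)] y_eq xy by (simp add: \<theta>.hom_int_pow)
    also have "\<dots> = transv x y (q * (a + b)) v"
      using xy True by (simp add: transv_def m_assoc int_pow_mult distrib_left)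
    finally show ?thesis .
  next
    case False
    then show ?thesis using *[OF v] v by (simp add: transv_def)
  qed
next
  show "transv x y (q * 0) v = vertex v" if "v \<in> V" for v
    using edge_in_V[OF e] that by (simp add: transv_def)
qed

lemma transv_maps_to:
  assumes e: "{x, y} \<in> E" and link: "link x \<subseteq> star y" and dvd: "modulus y dvd k * modulus x"
    and B: "B \<subseteq> V" "x \<in> B \<Longrightarrow> y \<in> B"
  shows "maps_to (endo (transv x y k)) B B"
proof -
  have "transv x y (k * j) v \<in> W B" if "v \<in> B" for v j
    using that B vertex_in_W[of _ B] vertex_pow_in_W[OF B(1), of y] subgroup.m_closed[OF W_subgroup[OF B(1)]]
    by (cases "v = x") (simp_all add: transv_def)
  from one_parameter_maps_to[OF transv_one_parameter[OF e link dvd] B(1) this, of 1]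
  show ?thesis by simp
qed

lemma transv_auto:
  assumes "{x, y} \<in> E" "link x \<subseteq> star y" "modulus y dvd k * modulus x"
  shows "endo (transv x y k) \<in> auto G"
  using one_parameter_auto[OF transv_one_parameter[OF assms], of 1] by simp

text \<open>A maximal complete subgraph through \<open>x\<close> lies in \<open>star x\<close>,
  hence in \<open>star y\<close>, and so contains \<open>y\<close> by maximality; its subgroup is
  preserved.\<close>

lemma transv_Aut_star:
  assumes e: "{x, y} \<in> E" and link: "link x \<subseteq> star y" and dvd: "modulus y dvd k * modulus x"
  shows "endo (transv x y k) \<in> Aut_star"
  unfolding Aut_star_iff
proof (intro conjI allI impI transv_auto[OF assms])
  fix \<Delta> assume \<Delta>: "maximal_complete \<Delta>"
  have "y \<in> \<Delta>" if "x \<in> \<Delta>"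
  proof (rule maximal_insert[OF \<Delta>])
    show "y \<in> V" using edge_in_V[OF e] by simp
    have "\<Delta> \<subseteq> star x" by (rule clique_subset_star[OF maximal_complete_clique[OF \<Delta>] that])
    then show "\<Delta> \<subseteq> star y" using link e by (auto simp: star_def[of x] in_star_iff insert_commute)
  qed
  then have "maps_to (endo (transv x y k)) \<Delta> \<Delta>" using maximal_complete_subset[OF \<Delta>] by (intro transv_maps_to[OF assms])
  then show "\<exists>\<Theta>. maximal_complete \<Theta> \<and> maps_to (endo (transv x y k)) \<Delta> \<Theta>" using \<Delta> by blast
qed

lemma transv_admissible_dvd:
  assumes "{x, y} \<in> E" "admissible (transv x y k)"
  shows "modulus y dvd k * modulus x"
proof -
  have "transv x y k x [^]\<^bsub>G\<^esub> modulus x = \<one>\<^bsub>G\<^esub>"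
    using assms(2) edge_in_V[OF assms(1)] by (simp add: admissible_def)
  then show ?thesis using transv_exponent[OF assms(1)] vertex_pow_eq_one_iff edge_in_V[OF assms(1)] by simp
qed

text \<open>A neighbour \<open>w\<close> of \<open>x\<close> outside \<open>star y\<close> commutes
  with \<open>x\<close> and with \<open>x y^k\<close>, hence with \<open>y^k\<close>. Then
  \<open>y^k\<close> lies in \<open>W (star w)\<close>, whose words avoid \<open>y\<close>, and has
  a trivial sector.\<close>

lemma transv_trivial:
  assumes e: "{x, y} \<in> E" and ad: "admissible (transv x y k)" and nlink: "\<not> link x \<subseteq> star y"
  shows "vertex y [^]\<^bsub>G\<^esub> k = \<one>\<^bsub>G\<^esub>"
proof -
  have xy: "x \<in> V" "y \<in> V" "x \<noteq> y" using edge_in_V[OF e] by auto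
  obtain w where w: "w \<in> V" "{x, w} \<in> E" "w \<notin> star y" using nlink by (auto simp: link_def)
  have wx: "w \<noteq> x" using edge_in_V[OF w(2)] by blast
  let ?y = "vertex y [^]\<^bsub>G\<^esub> k"
  have "transv x y k x \<otimes>\<^bsub>G\<^esub> transv x y k w = transv x y k w \<otimes>\<^bsub>G\<^esub> transv x y k x"
    using ad w(2) unfolding admissible_def by blast
  then have "vertex x \<otimes>\<^bsub>G\<^esub> (?y \<otimes>\<^bsub>G\<^esub> vertex w) = vertex w \<otimes>\<^bsub>G\<^esub> vertex x \<otimes>\<^bsub>G\<^esub> ?y"
    using wx xy w(1) by (simp add: transv_def m_assoc)
  also have "\<dots> = vertex x \<otimes>\<^bsub>G\<^esub> (vertex w \<otimes>\<^bsub>G\<^esub> ?y)"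
    unfolding vertex_commute[OF w(2), symmetric] using xy w(1) by (simp add: m_assoc)
  finally have "?y \<otimes>\<^bsub>G\<^esub> vertex w = vertex w \<otimes>\<^bsub>G\<^esub> ?y" using xy w(1) by simp
  then have "?y \<in> W (star w)" using xy w(1) by (intro centralizer_vertex) simp_all
  moreover have "y \<notin> star w" using w(3) star_sym by blast
  ultimately have "sector y (?y \<otimes>\<^bsub>G\<^esub> \<one>\<^bsub>G\<^esub>) = sector y \<one>\<^bsub>G\<^esub>"
    using star_subset[OF w(1)] by (intro sector_outside[OF xy(2)]) simp_all
  then show ?thesis using xy sector_self_pow[OF xy(2), of k] by simp
qed

text \<open>Without domination a minimal \<open>q\<close> may still exist, namely the order of
  \<open>y\<close> if it is finite; the transvection is then the identity.\<close>

lemma star_transvections_subset: "star_transvections \<subseteq> Aut_star"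
proof
  fix \<theta> assume "\<theta> \<in> star_transvections"
  then obtain x y q where e: "{x, y} \<in> E" and \<theta>: "extends_to (transv x y (int q)) \<theta>"
    unfolding star_transvections_def dominated_transvection_def transvection_map_transv by blast
  have ad: "admissible (transv x y (int q))" using \<theta> well_defined_iff by (auto simp: well_defined_def)
  show "\<theta> \<in> Aut_star"
  proof (cases "link x \<subseteq> star y")
    case True
    then show ?thesis using transv_Aut_star[OF e True transv_admissible_dvd[OF e ad]] endo_eq[OF \<theta>] by simp
  next
    case False
    have "\<theta> = \<one>\<^bsub>AG\<^esub>"
      using transv_trivial[OF e ad False] edge_in_V[OF e] by (intro identity_endo[OF \<theta>]) (simp add: transv_def)
    then show ?thesis using subgroup.one_closed[OF subgroup_Aut_star] by simp
  qed
qed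

subsubsection \<open>Partial conjugations\<close>

definition partial_conj :: "'a \<Rightarrow> 'a set \<Rightarrow> int \<Rightarrow> 'a \<Rightarrow> ('a \<times> int) list set set" where
  "partial_conj v K k z = (if z \<in> K then vertex v [^]\<^bsub>G\<^esub> k \<otimes>\<^bsub>G\<^esub> vertex z \<otimes>\<^bsub>G\<^esub> inv\<^bsub>G\<^esub> (vertex v [^]\<^bsub>G\<^esub> k) else vertex z)"

lemma component_cases:
  assumes "K \<in> components (V - star v)"
  obtains x where "x \<in> V - star v" "K = {y. y \<in> V - star v \<and>
    (x, y) \<in> {(a, b). a \<in> V - star v \<and> b \<in> V - star v \<and> {a, b} \<in> E}\<^sup>*}"
  using assms by (auto simp: components_def quotient_def)

lemma component_subset: "K \<in> components (V - star v) \<Longrightarrow> K \<subseteq> V - star v"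
  by (erule component_cases) auto

lemma component_closed:
  assumes "K \<in> components (V - star v)" "z \<in> K" "{z, w} \<in> E" "w \<notin> star v"
  shows "w \<in> K"
proof -
  let ?r = "{(a, b). a \<in> V - star v \<and> b \<in> V - star v \<and> {a, b} \<in> E}"
  obtain x where "x \<in> V - star v" and K: "K = {y. y \<in> V - star v \<and> (x, y) \<in> ?r\<^sup>*}"
    by (rule component_cases[OF assms(1)])
  have w: "w \<in> V - star v" using assms edge_in_V by auto
  then have "(z, w) \<in> ?r" using assms(2,3) K by auto
  moreover have "(x, z) \<in> ?r\<^sup>*" using assms(2) K by simp
  ultimately show ?thesis using w K by (auto intro: rtrancl_into_rtrancl)
qed

text \<open>The third property describes \<open>K\<close> by paths that start at the chosen
  \<open>x\<close>, ready for an induction along such a path.\<close>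

lemma component_exists:
  assumes "x \<in> V - star v"
  obtains K where "K \<in> components (V - star v)" "x \<in> K"
    "K = {y. y \<in> V - star v \<and> (x, y) \<in> {(a, b). a \<in> V - star v \<and> b \<in> V - star v \<and> {a, b} \<in> E}\<^sup>*}"
proof -
  let ?r = "{(a, b). a \<in> V - star v \<and> b \<in> V - star v \<and> {a, b} \<in> E}"
  let ?R = "{(x, y) \<in> (V - star v) \<times> (V - star v). (x, y) \<in> ?r\<^sup>*}"
  have "?R `` {x} \<in> components (V - star v)" unfolding components_def by (rule quotientI[OF assms])
  moreover have "?R `` {x} = {y. y \<in> V - star v \<and> (x, y) \<in> ?r\<^sup>*}" using assms by auto
  ultimately show ?thesis using that assms by simp
qed

context
  fixes v K assumes v: "v \<in> V" and K: "K \<in> components (V - star v)"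
begin

lemma component_vertices: "z \<in> K \<Longrightarrow> z \<in> V" "z \<in> K \<Longrightarrow> z \<notin> star v" "v \<notin> K"
  using component_subset[OF K] by (auto simp: star_def)

text \<open>An edge that leaves \<open>K\<close> ends in the link of \<open>v\<close>, whose
  vertices commute with \<open>v\<close>; an edge inside \<open>K\<close> is conjugated as a
  whole.\<close>

lemma partial_conj_admissible: "admissible (partial_conj v K k)"
  unfolding admissible_def
proof (intro conjI ballI allI impI)
  let ?v = "vertex v [^]\<^bsub>G\<^esub> k"
  have vc: "?v \<in> carrier G" "inv\<^bsub>G\<^esub> ?v \<in> carrier G" using v by simp_all
  {
    fix z assume z: "z \<in> V"
    then show "partial_conj v K k z \<in> carrier G" using v by (simp add: partial_conj_def)
    show "partial_conj v K k z [^]\<^bsub>G\<^esub> modulus z = \<one>\<^bsub>G\<^esub>"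
      using conj_int_pow[OF vc(2), of "vertex z" "modulus z"] z v vertex_exponent[OF z] by (simp add: partial_conj_def)
  }
  have comm: "partial_conj v K k z \<otimes>\<^bsub>G\<^esub> partial_conj v K k w = partial_conj v K k w \<otimes>\<^bsub>G\<^esub> partial_conj v K k z" if e: "{z, w} \<in> E" and z: "z \<in> K" for z w
  proof (cases "w \<in> K")
    case True
    interpret conj: group_hom G G "\<lambda>h. inv\<^bsub>G\<^esub> (inv\<^bsub>G\<^esub> ?v) \<otimes>\<^bsub>G\<^esub> h \<otimes>\<^bsub>G\<^esub> inv\<^bsub>G\<^esub> ?v"
      using conj_hom[OF vc(2)] by unfold_locales
    show ?thesis
      using arg_cong[OF vertex_commute[OF e], of "\<lambda>h. ?v \<otimes>\<^bsub>G\<^esub> h \<otimes>\<^bsub>G\<^esub> inv\<^bsub>G\<^esub> ?v"] z True component_vertices(1) v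
        conj.hom_mult[of "vertex z" "vertex w"] conj.hom_mult[of "vertex w" "vertex z"]
      by (simp add: partial_conj_def)
  next
    case False
    have w: "w \<in> V" using edge_in_V[OF e] by simp
    have "w \<in> star v" using component_closed[OF K z e] False by blast
    moreover have "w \<noteq> v"
      using e component_vertices(2)[OF z] by (auto simp: in_star_iff insert_commute)
    ultimately have "{v, w} \<in> E" by (simp add: in_star_iff)
    then have vw: "?v \<otimes>\<^bsub>G\<^esub> vertex w = vertex w \<otimes>\<^bsub>G\<^esub> ?v" "inv\<^bsub>G\<^esub> ?v \<otimes>\<^bsub>G\<^esub> vertex w = vertex w \<otimes>\<^bsub>G\<^esub> inv\<^bsub>G\<^esub> ?v"
      using edge_pow_commute[of v w k] edge_pow_commute[of v w "- k"] v by (simp_all add: int_pow_neg)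
    have "?v \<otimes>\<^bsub>G\<^esub> vertex z \<otimes>\<^bsub>G\<^esub> inv\<^bsub>G\<^esub> ?v \<otimes>\<^bsub>G\<^esub> vertex w = vertex w \<otimes>\<^bsub>G\<^esub> (?v \<otimes>\<^bsub>G\<^esub> vertex z \<otimes>\<^bsub>G\<^esub> inv\<^bsub>G\<^esub> ?v)"
      using vw vertex_commute[OF e] component_vertices(1)[OF z] w v vc by (intro mult_commute_assoc) simp_all
    then show ?thesis using z False by (simp add: partial_conj_def)
  qed
  fix z w assume e: "{z, w} \<in> E"
  consider "z \<in> K" | "w \<in> K" | "z \<notin> K" "w \<notin> K" by blast
  then show "partial_conj v K k z \<otimes>\<^bsub>G\<^esub> partial_conj v K k w = partial_conj v K k w \<otimes>\<^bsub>G\<^esub> partial_conj v K k z"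
  proof cases
    case 1
    then show ?thesis by (rule comm[OF e])
  next
    case 2
    have "{w, z} \<in> E" using e by (simp add: insert_commute)
    from comm[OF this 2] show ?thesis by (rule HOL.sym)
  next
    case 3
    then show ?thesis using vertex_commute[OF e] by (simp add: partial_conj_def)
  qed
qed

lemma partial_conj_one_parameter: "one_parameter (partial_conj v K)"
  unfolding one_parameter_def
proof (intro conjI allI ballI)
  show "admissible (partial_conj v K k)" for k by (rule partial_conj_admissible)
  fix a b z assume z: "z \<in> V"
  interpret \<theta>: group_hom G G "endo (partial_conj v K a)"
    using endo_hom[OF partial_conj_admissible] by unfold_locales
  have *: "endo (partial_conj v K a) (vertex u) = partial_conj v K a u" if "u \<in> V" for u
    by (rule endo_vertex[OF partial_conj_admissible that])
  have "endo (partial_conj v K a) (vertex v) = vertex v" using *[OF v] component_vertices(3) by (simp add: partial_conj_def)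
  then show "endo (partial_conj v K a) (partial_conj v K b z) = partial_conj v K (a + b) z"
    using *[OF z] z v
    by (simp add: partial_conj_def \<theta>.hom_int_pow add.commute[of a] int_pow_mult inv_mult_group m_assoc)
next
  show "partial_conj v K 0 z = vertex z" if "z \<in> V" for z using that v by (simp add: partial_conj_def)
qed

text \<open>A complete subgraph that meets \<open>K\<close> consists of vertices of \<open>K\<close>
  and neighbours of \<open>v\<close>, so it is conjugated as a whole; one that avoids
  \<open>K\<close> is fixed pointwise.\<close>

lemma partial_conj_maps_to:
  assumes \<Delta>: "maximal_complete \<Delta>"
  shows "maps_to (endo (partial_conj v K k)) \<Delta> \<Delta>"
proof -
  let ?v = "vertex v [^]\<^bsub>G\<^esub> k"
  have sub: "\<Delta> \<subseteq> V" by (rule maximal_complete_subset[OF \<Delta>])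
  note hom = endo_hom[OF partial_conj_admissible, of k]
  have vc: "?v \<in> carrier G" using v by simp
  have \<Delta>c: "vertex ` \<Delta> \<subseteq> carrier G" using sub by auto
  show ?thesis
  proof (cases "\<Delta> \<inter> K = {}")
    case True
    have "endo (partial_conj v K k) w = w" if "w \<in> W \<Delta>" for w
    proof (rule hom_eq_on_generate[OF hom _ group_G \<Delta>c _ that[unfolded W_def]])
      show "(\<lambda>g. g) \<in> hom G G" by (simp add: hom_def)
      show "endo (partial_conj v K k) s = s" if s: "s \<in> vertex ` \<Delta>" for s
      proof -
        obtain u where u: "u \<in> \<Delta>" "s = vertex u" using s by blast
        then have "u \<in> V" "u \<notin> K" using sub True by auto
        then show ?thesis using endo_vertex[OF partial_conj_admissible, of u] u(2) by (simp add: partial_conj_def)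
      qed
    qed
    then show ?thesis by (intro maps_toI sub) simp
  next
    case False
    then obtain x where x: "x \<in> \<Delta>" "x \<in> K" by blast
    have eq: "endo (partial_conj v K k) (vertex z) = ?v \<otimes>\<^bsub>G\<^esub> vertex z \<otimes>\<^bsub>G\<^esub> inv\<^bsub>G\<^esub> ?v" if z: "z \<in> \<Delta>" for z
    proof (cases "z \<in> K")
      case True
      then show ?thesis using endo_vertex[OF partial_conj_admissible, of z] z sub by (auto simp: partial_conj_def)
    next
      case False
      have e: "{x, z} \<in> E" using maximal_edge[OF \<Delta> x(1) z] False x(2) by blast
      have "z \<in> star v" using component_closed[OF K x(2) e] False by blast
      moreover have "z \<noteq> v" using e component_vertices(2)[OF x(2)] by (auto simp: in_star_iff insert_commute)
      ultimately have "{v, z} \<in> E" by (simp add: in_star_iff)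
      then have "?v \<otimes>\<^bsub>G\<^esub> vertex z = vertex z \<otimes>\<^bsub>G\<^esub> ?v" by (rule edge_pow_commute)
      then show ?thesis using endo_vertex[OF partial_conj_admissible, of z] z sub False v
        by (simp add: partial_conj_def m_assoc subset_iff)
    qed
    have "endo (partial_conj v K k) w = ?v \<otimes>\<^bsub>G\<^esub> w \<otimes>\<^bsub>G\<^esub> inv\<^bsub>G\<^esub> ?v" if "w \<in> W \<Delta>" for w
    proof (rule hom_eq_on_generate[OF hom _ group_G \<Delta>c _ that[unfolded W_def]])
      show "(\<lambda>w. ?v \<otimes>\<^bsub>G\<^esub> w \<otimes>\<^bsub>G\<^esub> inv\<^bsub>G\<^esub> ?v) \<in> hom G G"
        using conj_hom[of "inv\<^bsub>G\<^esub> ?v"] vc by simp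
    qed (use eq in auto)
    then show ?thesis unfolding maps_to_def using vc by (intro bexI[of _ ?v] image_cong) simp_all
  qed
qed

lemma partial_conj_Aut_star: "endo (partial_conj v K k) \<in> Aut_star"
  unfolding Aut_star_iff using one_parameter_auto[OF partial_conj_one_parameter] partial_conj_maps_to by blast

end

lemma partial_conj_one: "v \<in> V \<Longrightarrow> partial_conj v K 1 = (\<lambda>z. if z \<in> K then vertex v \<otimes>\<^bsub>G\<^esub> vertex z \<otimes>\<^bsub>G\<^esub> inv\<^bsub>G\<^esub> vertex v else vertex z)"
  by (simp add: partial_conj_def fun_eq_iff)

lemma partial_conjugations_subset: "partial_conjugations \<subseteq> Aut_star"
proof
  fix \<theta> assume "\<theta> \<in> partial_conjugations"
  then obtain v K where v: "v \<in> V" and K: "K \<in> components (V - star v)" and \<theta>: "extends_to (partial_conj v K 1) \<theta>"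
    unfolding partial_conjugations_def using partial_conj_one by fastforce
  show "\<theta> \<in> Aut_star" using partial_conj_Aut_star[OF v K, of 1] endo_eq[OF \<theta>] by simp
qed

lemma star_generators_subset: "star_generators \<subseteq> Aut_star"
proof -
  have "labeled_graph_automorphisms \<subseteq> Aut_star"
  proof
    fix \<theta> assume "\<theta> \<in> labeled_graph_automorphisms"
    then obtain \<pi> where "graph_auto \<pi>" "extends_to (\<lambda>v. vertex (\<pi> v)) \<theta>"
      unfolding labeled_graph_automorphisms_def graph_auto_def by blast
    then show "\<theta> \<in> Aut_star" using graph_auto_endo(2) endo_eq by blast
  qed
  then show ?thesis
    using factor_automorphisms_subset star_transvections_subset partial_conjugations_subset
    by (simp add: star_generators_def)
qed

lemma generate_subset_Aut_star: "S \<subseteq> Aut_star"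
  by (rule group.generate_subgroup_incl[OF AutoGroup star_generators_subset subgroup_Aut_star])

lemma subgroup_S: "subgroup S AG"
  using star_generators_subset Aut_star_auto
  by (intro group.generate_is_subgroup[OF AutoGroup]) auto

lemma partial_conj_in_S:
  assumes v: "v \<in> V" and K: "K \<in> components (V - star v)"
  shows "endo (partial_conj v K k) \<in> S"
proof (rule one_parameter_generate[OF partial_conj_one_parameter[OF assms] subgroup_S])
  have "endo (partial_conj v K 1) \<in> partial_conjugations"
    using v K endo_extends[OF partial_conj_admissible[OF assms, of 1]]
    unfolding partial_conjugations_def partial_conj_one[OF v] by blast
  then show "endo (partial_conj v K 1) \<in> S" by (auto intro: generate.incl simp: star_generators_def)
qed

text \<open>The generating set offers only the least well-defined exponent. The condition on
  exponents is closed under integer combinations, so \<open>k\<close> is a multiple of the least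
  positive one.\<close>

lemma transv_in_S:
  assumes e: "{x, y} \<in> E" and link: "link x \<subseteq> star y" and dvd: "modulus y dvd k * modulus x"
  shows "endo (transv x y k) \<in> S"
proof (cases "k = 0")
  case True
  then have "endo (transv x y k) = \<one>\<^bsub>AG\<^esub>"
    using edge_in_V[OF e] by (intro identity_endo[OF endo_extends[OF transv_admissible[OF assms]]]) (simp add: transv_def)
  then show ?thesis using generate.one[of AG] by simp
next
  case False
  define P where "P r \<longleftrightarrow> 1 \<le> r \<and> modulus y dvd int r * modulus x" for r :: nat
  define q where "q = (LEAST r. P r)"
  have "P (nat \<bar>k\<bar>)" using False dvd by (auto simp: P_def abs_if)
  then have q: "P q" unfolding q_def by (rule LeastI)
  have min: "\<not> P r" if "r < q" for r using that not_less_Least unfolding q_def by blast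
  have qd: "modulus y dvd int q * modulus x" "q \<ge> 1" using q by (auto simp: P_def)
  have "endo (transv x y (int q)) \<in> star_transvections"
    unfolding star_transvections_def dominated_transvection_def transvection_map_transv
  proof (intro CollectI exI conjI allI impI)
    show "x \<in> V" "y \<in> V" "x \<noteq> y" using edge_in_V[OF e] by auto
    show "extends_to (transv x y (int q)) (endo (transv x y (int q)))"
      by (rule endo_extends[OF transv_admissible[OF e link qd(1)]])
    show "\<not> well_defined (transv x y (int r))" if "1 \<le> r \<and> r < q" for r
      using transv_admissible_dvd[OF e, of "int r"] min[of r] that by (auto simp: well_defined_iff P_def)
  qed (use e qd in auto)
  then have gen: "endo (transv x y (int q * 1)) \<in> S" by (auto intro: generate.incl simp: star_generators_def)
  have "k mod int q = 0"
  proof (rule ccontr)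
    assume ne: "k mod int q \<noteq> 0"
    define r where "r = nat (k mod int q)"
    have r: "int r = k mod int q" using qd by (simp add: r_def)
    obtain t where "int r = k - int q * t" unfolding r by (metis minus_mult_div_eq_mod)
    then have "int r * modulus x = (k - int q * t) * modulus x" by (simp only:)
    also have "\<dots> = k * modulus x - t * (int q * modulus x)" by (simp add: algebra_simps)
    finally have "int r * modulus x = k * modulus x - t * (int q * modulus x)" .
    then have "modulus y dvd int r * modulus x" using dvd qd(1) by simp
    moreover have "r < q" using r qd(2) by (simp add: r_def nat_less_iff)
    ultimately show False using min[of r] ne r by (simp add: P_def)
  qed
  then have "k = int q * (k div int q)" by auto
  then show ?thesis
    using one_parameter_generate[OF transv_one_parameter[OF e link qd(1)] subgroup_S gen, of "k div int q"] by simp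
qed

subsection \<open>Automorphisms acting trivially on the abelianisation\<close>

text \<open>The vertices of a maximal complete subgraph are recognised in the abelianisation, so
  each \<open>W \<Delta>\<close> is mapped to a conjugate of itself. Undoing the conjugation leaves
  every vertex of \<open>\<Delta>\<close> in its class, and classes within \<open>W \<Delta>\<close>
  are single elements.\<close>

lemma similar_conjugating:
  assumes \<psi>: "\<psi> \<in> Aut_star" and sim: "\<And>v. v \<in> V \<Longrightarrow> \<psi> (vertex v) \<asymp> vertex v"
  shows "conjugating V E lab \<psi>"
proof -
  note auto = Aut_star_auto[OF \<psi>]
  have key: "\<exists>g\<in>carrier G. \<forall>v\<in>\<Delta>. \<psi> (vertex v) = inv\<^bsub>G\<^esub> g \<otimes>\<^bsub>G\<^esub> vertex v \<otimes>\<^bsub>G\<^esub> g"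
    if \<Delta>: "maximal_complete \<Delta>" for \<Delta>
  proof -
    obtain \<Theta> where \<Theta>: "maximal_complete \<Theta>" "maps_to \<psi> \<Delta> \<Theta>" using \<psi> \<Delta> Aut_star_iff by blast
    note sub = maximal_complete_subset[OF \<Delta>] maximal_complete_subset[OF \<Theta>(1)]
    have "v \<in> \<Theta> \<longleftrightarrow> v \<in> \<Delta>" if v: "v \<in> V" for v
    proof -
      have "vertex v \<in> supp_in \<Theta> \<longleftrightarrow> \<psi> (vertex v) \<in> supp_in \<Theta>"
        using supp_in_similar sim[OF v] similar_sym[OF sim[OF v]] auto_closed[OF auto] vertex_closed[OF v] by blast
      then show ?thesis
        using maps_to_supp[OF auto \<Theta>(2) sub vertex_closed[OF v]] vertex_in_supp[OF v] by simp
    qed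
    then have "\<Theta> = \<Delta>" using sub by blast
    with \<Theta>(2) obtain g where g: "g \<in> carrier G"
      and im: "\<psi> ` W \<Delta> = (\<lambda>w. g \<otimes>\<^bsub>G\<^esub> w \<otimes>\<^bsub>G\<^esub> inv\<^bsub>G\<^esub> g) ` W \<Delta>" by (auto simp: maps_to_def)
    have "\<psi> (vertex v) = inv\<^bsub>G\<^esub> (inv\<^bsub>G\<^esub> g) \<otimes>\<^bsub>G\<^esub> vertex v \<otimes>\<^bsub>G\<^esub> inv\<^bsub>G\<^esub> g" if v: "v \<in> \<Delta>" for v
    proof -
      have "\<psi> (vertex v) \<in> (\<lambda>w. g \<otimes>\<^bsub>G\<^esub> w \<otimes>\<^bsub>G\<^esub> inv\<^bsub>G\<^esub> g) ` W \<Delta>"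
        using imageI[OF vertex_in_W[OF v], of \<psi>] unfolding im .
      then obtain w where w: "w \<in> W \<Delta>" "\<psi> (vertex v) = g \<otimes>\<^bsub>G\<^esub> w \<otimes>\<^bsub>G\<^esub> inv\<^bsub>G\<^esub> g" by blast
      have "\<psi> (vertex v) \<asymp> w"
        unfolding w(2) by (rule similar_conj[OF g W_closed[OF sub(1) w(1)]])
      moreover have "\<psi> (vertex v) \<asymp> vertex v" using sim v sub(1) by blast
      ultimately have "w \<asymp> vertex v" using similar_sym similar_trans by blast
      then have "w = vertex v"
        by (rule clique_similar_eq[OF maximal_complete_clique[OF \<Delta>] sub(1) w(1) vertex_in_W[OF v]])
      then show ?thesis using w(2) g by simp
    qed
    then show ?thesis using g by (intro bexI[of _ "inv\<^bsub>G\<^esub> g"]) simp_all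
  qed
  show ?thesis
  proof unfold_locales
    show "\<psi> \<in> hom G G" by (rule auto_hom[OF auto])
    show "\<exists>g\<in>carrier G. \<psi> (vertex v) = inv\<^bsub>G\<^esub> g \<otimes>\<^bsub>G\<^esub> vertex v \<otimes>\<^bsub>G\<^esub> g" if v: "v \<in> V" for v
    proof -
      obtain \<Delta> where "maximal_complete \<Delta>" "v \<in> \<Delta>" by (rule vertex_in_maximal[OF v])
      then show ?thesis using key by blast
    qed
    show "\<exists>g\<in>carrier G. \<psi> (vertex x) = inv\<^bsub>G\<^esub> g \<otimes>\<^bsub>G\<^esub> vertex x \<otimes>\<^bsub>G\<^esub> g \<and>
      \<psi> (vertex y) = inv\<^bsub>G\<^esub> g \<otimes>\<^bsub>G\<^esub> vertex y \<otimes>\<^bsub>G\<^esub> g" if e: "{x, y} \<in> E" for x y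
    proof -
      obtain \<Delta> where "maximal_complete \<Delta>" "x \<in> \<Delta>" "y \<in> \<Delta>" by (rule edge_in_maximal[OF e])
      then show ?thesis using key by blast
    qed
  qed
qed

text \<open>The length of a shortest word for a point of the wall of \<open>x\<close>, written
  without \<open>wall\<close>, which is available only inside \<open>conjugating\<close>.\<close>

definition wall_distance :: "(('a \<times> int) list set set \<Rightarrow> ('a \<times> int) list set set) \<Rightarrow> 'a \<Rightarrow> nat" where
  "wall_distance \<psi> x = (LEAST n. \<exists>ws\<in>lists (V \<times> UNIV).
    \<psi> (vertex x) = inv\<^bsub>G\<^esub> (ev ws) \<otimes>\<^bsub>G\<^esub> vertex x \<otimes>\<^bsub>G\<^esub> ev ws \<and> length ws = n)"

lemma in_S_if_trivial_on_abelianisation: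
  assumes "\<psi> \<in> Aut_star" "\<And>v. v \<in> V \<Longrightarrow> \<psi> (vertex v) \<asymp> vertex v"
  shows "\<psi> \<in> S"
  using assms
proof (induction "\<Sum>x\<in>V. wall_distance \<psi> x" arbitrary: \<psi> rule: less_induct)
  case less
  note \<psi> = less.prems(1) and sim = less.prems(2)
  note auto = Aut_star_auto[OF \<psi>]
  interpret c: conjugating V E lab \<psi> by (rule similar_conjugating[OF \<psi> sim])
  interpret h: group_hom G G \<psi> by (rule auto_group_hom[OF auto])
  interpret AG: group AG by (rule AutoGroup)
  show ?case
  proof (cases "\<forall>x\<in>V. \<forall>y\<in>V. x \<notin> star y \<longrightarrow> (\<forall>g\<in>c.wall x. c.side y g = \<one>\<^bsub>G\<^esub>)")
    case True
    have surj: "\<psi> ` carrier G = carrier G" using auto_bij[OF auto] by (simp add: bij_betw_def)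
    have "\<psi> (vertex v) = vertex v" if "v \<in> V" for v
      by (rule c.fixes_vertices_if_no_separation[OF surj _ that]) (use True in blast)
    then have "\<psi> = \<one>\<^bsub>AG\<^esub>"
      using AG.one_closed AG_one_apply by (intro auto_eqI[OF auto]) simp_all
    then show ?thesis using generate.one[of AG] by simp
  next
    case False
    then obtain x y g where x: "x \<in> V" and y: "y \<in> V" and xy: "x \<notin> star y" and g: "g \<in> c.wall x"
      and ne: "c.side y g \<noteq> \<one>\<^bsub>G\<^esub>" by blast
    obtain k :: int where k: "c.side y g = vertex y [^]\<^bsub>G\<^esub> k"
      using c.side_pow[OF y c.wall_closed[OF g]] by blast
    let ?r = "{(a, b). a \<in> V - star y \<and> b \<in> V - star y \<and> {a, b} \<in> E}"
    have "x \<in> V - star y" using x xy by simp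
    then obtain K where K: "K \<in> components (V - star y)" "x \<in> K" "K = {z. z \<in> V - star y \<and> (x, z) \<in> ?r\<^sup>*}"
      by (rule component_exists)
    have far: "y \<notin> star z" if "z \<notin> star y" for z using that star_sym by blast
    \<comment> \<open>All walls of \<open>K\<close> lie on one side of the wall of \<open>y\<close>:
      walls of adjacent vertices meet, and no wall of a vertex outside \<open>star y\<close> has
      points on two sides.\<close>
    have "\<forall>h\<in>c.wall z. c.side y h = vertex y [^]\<^bsub>G\<^esub> k" if "(x, z) \<in> ?r\<^sup>*" for z
      using that
    proof (induction rule: rtrancl_induct)
      case base
      then show ?case using c.side_wall_const[OF y x far[OF xy] _ g] k by simp
    next
      case (step z z')
      then have zz: "z' \<in> V" "z' \<notin> star y" "{z, z'} \<in> E" by auto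
      obtain h where h: "h \<in> c.wall z" "h \<in> c.wall z'"
        using c.conj_edge[OF zz(3)] by (auto simp: c.wall_def)
      then have "c.side y h = vertex y [^]\<^bsub>G\<^esub> k" using step.IH by simp
      then show ?case using c.side_wall_const[OF y zz(1) far[OF zz(2)] _ h(2)] by simp
    qed
    then have side_K: "c.side y h = vertex y [^]\<^bsub>G\<^esub> k" if "z \<in> K" "h \<in> c.wall z" for z h
      using that K(3) by blast
    have K_V: "z \<in> V" if "z \<in> K" for z using that component_vertices(1)[OF y K(1)] by blast
    define \<sigma> where "\<sigma> = endo (partial_conj y K k)"
    have \<sigma>: "\<sigma> \<in> auto G" "\<sigma> \<in> Aut_star" "\<sigma> \<in> S" "\<And>v. v \<in> V \<Longrightarrow> \<sigma> (vertex v) = partial_conj y K k v"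
      using Aut_star_auto partial_conj_Aut_star[OF y K(1)] partial_conj_in_S[OF y K(1)] endo_vertex[OF partial_conj_admissible[OF y K(1)]]
      by (simp_all add: \<sigma>_def)
    \<comment> \<open>Precomposition with \<open>\<sigma>\<close> translates the walls of
      \<open>K\<close> on the right by the power \<open>- k\<close> of
      \<open>\<psi> (vertex y)\<close>, with the same \<open>k\<close> that describes their side,
      and leaves all other walls alone.\<close>
    define \<psi>' where "\<psi>' = \<psi> \<otimes>\<^bsub>AG\<^esub> \<sigma>"
    have \<psi>'_vertex: "\<psi>' (vertex v) = \<psi> (partial_conj y K k v)" if "v \<in> V" for v
      using AG_apply[OF auto \<sigma>(1)] \<sigma>(4) that by (simp add: \<psi>'_def)
    have partial_conj_closed: "partial_conj y K k v \<in> carrier G" if "v \<in> V" for v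
      using that y by (simp add: partial_conj_def)
    have \<psi>'_star: "\<psi>' \<in> Aut_star"
      unfolding \<psi>'_def by (rule subgroup.m_closed[OF subgroup_Aut_star \<psi> \<sigma>(2)])
    have \<psi>'_sim: "\<psi>' (vertex v) \<asymp> vertex v" if v: "v \<in> V" for v
    proof -
      have "partial_conj y K k v \<asymp> vertex v"
        using similar_conj[of "vertex y [^]\<^bsub>G\<^esub> k" "vertex v"] v y by (simp add: partial_conj_def)
      then have "\<psi> (partial_conj y K k v) \<asymp> \<psi> (vertex v)"
        by (rule similar_hom[OF auto_hom[OF auto] partial_conj_closed[OF v] vertex_closed[OF v]])
      then show ?thesis using similar_trans[OF _ sim[OF v]] \<psi>'_vertex[OF v] by simp
    qed
    have same: "wall_distance \<psi>' z = wall_distance \<psi> z" if "z \<in> V" "z \<notin> K" for z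
      using that \<psi>'_vertex[of z] by (simp add: wall_distance_def partial_conj_def)
    have closer: "wall_distance \<psi>' z < wall_distance \<psi> z" if z: "z \<in> K" for z
    proof -
      note zV = K_V[OF z]
      let ?P = "\<lambda>n. \<exists>ws\<in>lists (V \<times> UNIV).
        \<psi> (vertex z) = inv\<^bsub>G\<^esub> (ev ws) \<otimes>\<^bsub>G\<^esub> vertex z \<otimes>\<^bsub>G\<^esub> ev ws \<and> length ws = n"
      obtain b where b: "b \<in> carrier G" "\<psi> (vertex z) = inv\<^bsub>G\<^esub> b \<otimes>\<^bsub>G\<^esub> vertex z \<otimes>\<^bsub>G\<^esub> b"
        using c.conj_vertex[OF zV] by blast
      obtain ws0 where "ws0 \<in> lists (V \<times> UNIV)" "ev ws0 = b" by (rule c.ev_surj[OF b(1)])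
      then have "?P (length ws0)" using b(2) by blast
      then have "?P (wall_distance \<psi> z)" unfolding wall_distance_def by (rule LeastI)
      then obtain ws where ws: "ws \<in> lists (V \<times> UNIV)" "length ws = wall_distance \<psi> z"
        and eq: "\<psi> (vertex z) = inv\<^bsub>G\<^esub> (ev ws) \<otimes>\<^bsub>G\<^esub> vertex z \<otimes>\<^bsub>G\<^esub> ev ws" by blast
      have "ev ws \<in> c.wall z" using ws(1) eq by (simp add: c.wall_def)
      then have s: "c.side y (ev ws) = vertex y [^]\<^bsub>G\<^esub> k" by (rule side_K[OF z])
      let ?Y = "\<psi> (vertex y)"
      \<comment> \<open>The side is nontrivial, so the nearest point of the wall moves strictly
        closer to the identity.\<close>
      obtain ws' where ws': "ws' \<in> lists (V \<times> UNIV)" "ev ws' = ev ws \<otimes>\<^bsub>G\<^esub> ?Y [^]\<^bsub>G\<^esub> (- k)"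
        "length ws' < length ws"
        using c.shorten[OF y ws(1) s] s k ne by auto
      have "\<psi>' (vertex z) = ?Y [^]\<^bsub>G\<^esub> k \<otimes>\<^bsub>G\<^esub> \<psi> (vertex z) \<otimes>\<^bsub>G\<^esub> inv\<^bsub>G\<^esub> (?Y [^]\<^bsub>G\<^esub> k)"
        using \<psi>'_vertex[OF zV] z zV y by (simp add: partial_conj_def h.hom_int_pow)
      also have "\<dots> = inv\<^bsub>G\<^esub> (ev ws') \<otimes>\<^bsub>G\<^esub> vertex z \<otimes>\<^bsub>G\<^esub> ev ws'"
        unfolding eq ws'(2) using ws(1) y zV by (simp add: inv_mult_group m_assoc int_pow_neg)
      finally have "wall_distance \<psi>' z \<le> length ws'"
        unfolding wall_distance_def using ws'(1) by (intro Least_le) blast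
      then show ?thesis using ws'(3) ws(2) by simp
    qed
    have le: "wall_distance \<psi>' z \<le> wall_distance \<psi> z" if "z \<in> V" for z
      using same[OF that] closer[of z] by (cases "z \<in> K") simp_all
    have "(\<Sum>z\<in>V. wall_distance \<psi>' z) < (\<Sum>z\<in>V. wall_distance \<psi> z)"
    proof (rule sum_strict_mono_ex1[OF finite_V])
      show "\<forall>z\<in>V. wall_distance \<psi>' z \<le> wall_distance \<psi> z" using le by blast
      show "\<exists>z\<in>V. wall_distance \<psi>' z < wall_distance \<psi> z" using closer[OF K(2)] x by blast
    qed
    from less.hyps[OF this \<psi>'_star \<psi>'_sim] have "\<psi>' \<in> S" .
    then have "\<psi>' \<otimes>\<^bsub>AG\<^esub> inv\<^bsub>AG\<^esub> \<sigma> \<in> S"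
      using subgroup.m_closed[OF subgroup_S] subgroup.m_inv_closed[OF subgroup_S \<sigma>(3)] by blast
    moreover have "\<psi>' \<otimes>\<^bsub>AG\<^esub> inv\<^bsub>AG\<^esub> \<sigma> = \<psi>"
      using auto \<sigma>(1) AG_inv(1)[OF \<sigma>(1)] by (simp add: \<psi>'_def AG.m_assoc)
    ultimately show ?thesis by simp
  qed
qed

subsection \<open>Elimination in the abelianisation\<close>

text \<open>A row operation: \<open>k\<close> times row \<open>t\<close> is added to row
  \<open>s\<close>.\<close>

lemma coord_transv:
  assumes ad: "admissible (transv t s k)" and ts: "t \<in> V" "s \<in> V" "t \<noteq> s" and g: "g \<in> carrier G" and z: "z \<in> V"
  shows "[coord z (endo (transv t s k) g) = coord z g + (if z = s then k * coord t g else 0)] (mod modulus z)"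
proof -
  have "[coord z (endo (transv t s k) g) = (\<Sum>v\<in>V. coord v g * coord z (endo (transv t s k) (vertex v)))] (mod modulus z)"
    by (rule coord_hom_sum[OF endo_hom[OF ad] z g])
  also have "[(\<Sum>v\<in>V. coord v g * coord z (endo (transv t s k) (vertex v))) =
      (\<Sum>v\<in>V. coord v g * ((if v = z then 1 else 0) + (if v = t \<and> z = s then k else 0)))] (mod modulus z)"
  proof (rule cong_sum)
    fix v assume v: "v \<in> V"
    have "coord z (transv t s k v) = ((if v = z then 1 else 0) + (if v = t \<and> z = s then k else 0)) mod modulus z"
      using ts z v coord_mod[OF z, of "vertex v"]
      by (auto simp: transv_def coord_mult coord_vertex coord_vertex_pow mod_simps)
    then show "[coord v g * coord z (endo (transv t s k) (vertex v)) =
        coord v g * ((if v = z then 1 else 0) + (if v = t \<and> z = s then k else 0))] (mod modulus z)"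
      using endo_vertex[OF ad v] by (intro cong_mult) (simp_all add: cong_def)
  qed
  also have "(\<Sum>v\<in>V. coord v g * ((if v = z then 1 else 0) + (if v = t \<and> z = s then k else 0))) =
      (\<Sum>v\<in>V. (if v = z then coord v g else 0) + (if v = t then (if z = s then k * coord v g else 0) else 0))"
    by (intro sum.cong) (auto simp: algebra_simps)
  also have "\<dots> = coord z g + (if z = s then k * coord t g else 0)"
    using finite_V ts z by (simp add: sum.distrib sum.delta)
  finally show ?thesis .
qed

text \<open>A row operation: row \<open>v\<close> is multiplied by \<open>m\<close>.\<close>

lemma coord_factor:
  assumes v: "v \<in> V" and g: "g \<in> carrier G" and z: "z \<in> V"
  shows "[coord z (endo (factor_map v m) g) = (if z = v then m else 1) * coord z g] (mod modulus z)"
proof -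
  note ad = factor_admissible[OF v, of m]
  have "[coord z (endo (factor_map v m) g) = (\<Sum>u\<in>V. coord u g * coord z (endo (factor_map v m) (vertex u)))] (mod modulus z)"
    by (rule coord_hom_sum[OF endo_hom[OF ad] z g])
  also have "[(\<Sum>u\<in>V. coord u g * coord z (endo (factor_map v m) (vertex u))) =
      (\<Sum>u\<in>V. coord u g * (if u = z then (if z = v then m else 1) else 0))] (mod modulus z)"
  proof (rule cong_sum)
    fix u assume u: "u \<in> V"
    have "coord z (factor_map v m u) = (if u = z then (if z = v then m else 1) else 0) mod modulus z"
      using z u v coord_mod[OF z, of "vertex u"]
      by (auto simp: factor_map_def coord_vertex coord_vertex_pow)
    then show "[coord u g * coord z (endo (factor_map v m) (vertex u)) =
        coord u g * (if u = z then (if z = v then m else 1) else 0)] (mod modulus z)"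
      using endo_vertex[OF ad u] by (intro cong_mult) (simp_all add: cong_def)
  qed
  also have "(\<Sum>u\<in>V. coord u g * (if u = z then (if z = v then m else 1) else 0)) = (if z = v then m else 1) * coord z g"
  proof -
    have "(\<Sum>u\<in>V. coord u g * (if u = z then (if z = v then m else 1) else 0)) =
        (\<Sum>u\<in>V. if u = z then (if z = v then m else 1) * coord u g else 0)"
      by (intro sum.cong) (auto simp: algebra_simps)
    then show ?thesis using finite_V z by (simp add: sum.delta)
  qed
  finally show ?thesis .
qed

lemma coord_eqI:
  assumes "z \<in> V" "g \<in> carrier G" "h \<in> carrier G" "[coord z g = coord z h] (mod modulus z)"
  shows "coord z g = coord z h"
  using assms coord_mod[OF assms(1)] by (simp add: cong_def)

text \<open>Row operations with sources in \<open>D\<close> that do not leave \<open>C\<close>. The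
  first condition preserves columns that are unit vectors at a place outside \<open>D\<close>, the
  second keeps the current column supported in \<open>C\<close>.\<close>

definition row_ops :: "'a set \<Rightarrow> 'a set \<Rightarrow> (('a \<times> int) list set set \<Rightarrow> ('a \<times> int) list set set) set" where
  "row_ops D C = {\<alpha> \<in> S. (\<forall>v\<in>V - D. \<alpha> (vertex v) \<asymp> vertex v) \<and> (\<forall>g\<in>supp_in C. \<alpha> g \<in> supp_in C)}"

lemma S_auto: "\<alpha> \<in> S \<Longrightarrow> \<alpha> \<in> auto G"
  using generate_subset_Aut_star Aut_star_auto by blast

lemma row_ops_auto: "\<alpha> \<in> row_ops D C \<Longrightarrow> \<alpha> \<in> auto G"
  by (simp add: row_ops_def S_auto)

lemma supp_closed: "g \<in> supp_in B \<Longrightarrow> g \<in> carrier G"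
  by (simp add: supp_in_def)

lemma one_row_ops: "\<one>\<^bsub>AG\<^esub> \<in> row_ops D C"
  using generate.one[of AG] supp_closed by (simp add: row_ops_def AG_one_apply)

lemma mult_row_ops:
  assumes \<alpha>: "\<alpha> \<in> row_ops D C" and \<beta>: "\<beta> \<in> row_ops D C"
  shows "\<alpha> \<otimes>\<^bsub>AG\<^esub> \<beta> \<in> row_ops D C"
proof -
  note a = row_ops_auto[OF \<alpha>] row_ops_auto[OF \<beta>]
  have "\<alpha> \<otimes>\<^bsub>AG\<^esub> \<beta> \<in> S" using \<alpha> \<beta> subgroup.m_closed[OF subgroup_S] by (simp add: row_ops_def)
  moreover have "(\<alpha> \<otimes>\<^bsub>AG\<^esub> \<beta>) (vertex v) \<asymp> vertex v" if v: "v \<in> V - D" for v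
  proof -
    have "\<beta> (vertex v) \<asymp> vertex v" "\<alpha> (vertex v) \<asymp> vertex v" using v \<alpha> \<beta> by (simp_all add: row_ops_def)
    then have "\<alpha> (\<beta> (vertex v)) \<asymp> vertex v"
      using similar_hom[OF auto_hom[OF a(1)] auto_closed[OF a(2)]] similar_trans v by (metis DiffD1 vertex_closed)
    then show ?thesis using AG_apply[OF a] v by simp
  qed
  moreover have "(\<alpha> \<otimes>\<^bsub>AG\<^esub> \<beta>) g \<in> supp_in C" if "g \<in> supp_in C" for g
    using that \<alpha> \<beta> AG_apply[OF a supp_closed[OF that]] by (simp add: row_ops_def)
  ultimately show ?thesis by (simp add: row_ops_def)
qed

section \<open>Clearing a column by row operations\<close>

context
  fixes D C :: "'a set"
  assumes DC: "D \<subseteq> C" "C \<subseteq> V"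
    and adjacent: "\<forall>t\<in>D. \<forall>s\<in>C. s \<noteq> t \<longrightarrow> {t, s} \<in> E \<and> link t \<subseteq> star s"
begin

abbreviation (input) R where "R \<equiv> row_ops D C"

text \<open>Only the vertex \<open>t\<close>, which is in \<open>D\<close>, is moved, and only row
  \<open>s\<close>, which belongs to \<open>C\<close>, changes.\<close>

lemma transv_row_ops:
  assumes t: "t \<in> D" and s: "s \<in> C" "s \<noteq> t" and dvd: "modulus s dvd k * modulus t"
  shows "endo (transv t s k) \<in> R" and "admissible (transv t s k)"
proof -
  have e: "{t, s} \<in> E" "link t \<subseteq> star s" using adjacent t s by auto
  have V: "t \<in> V" "s \<in> V" using t s DC by auto
  show ad: "admissible (transv t s k)" by (rule transv_admissible[OF e dvd])
  have "endo (transv t s k) g \<in> supp_in C" if "g \<in> supp_in C" for g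
    unfolding supp_in_def
  proof (intro CollectI conjI ballI)
    note auto = transv_auto[OF e dvd]
    show "endo (transv t s k) g \<in> carrier G" using auto_closed[OF auto supp_closed[OF that]] .
    fix z assume z: "z \<in> V - C"
    then have "z \<noteq> s" using s(1) by blast
    with z have "coord z (endo (transv t s k) g) = coord z g"
      using coord_transv[OF ad V s(2)[symmetric] supp_closed[OF that], of z] s(1) auto_closed[OF auto supp_closed[OF that]]
      by (intro coord_eqI supp_closed[OF that]) auto
    then show "coord z (endo (transv t s k) g) = 0" using that z by (simp add: supp_in_def)
  qed
  moreover have "endo (transv t s k) (vertex v) \<asymp> vertex v" if "v \<in> V - D" for v
    using endo_vertex[OF ad, of v] that t by (auto simp: transv_def)
  ultimately show "endo (transv t s k) \<in> R" using transv_in_S[OF e dvd] by (simp add: row_ops_def)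
qed

lemma factor_row_ops:
  assumes t: "t \<in> D" and m: "coprime m (modulus t)"
  shows "endo (factor_map t m) \<in> R"
proof -
  have V: "t \<in> V" using t DC by auto
  note ad = factor_admissible[OF V, of m]
  have "endo (factor_map t m) g \<in> supp_in C" if "g \<in> supp_in C" for g
    unfolding supp_in_def
  proof (intro CollectI conjI ballI)
    note auto = factor_endo(1)[OF V m]
    show "endo (factor_map t m) g \<in> carrier G" using auto_closed[OF auto supp_closed[OF that]] .
    fix z assume z: "z \<in> V - C"
    then have "z \<noteq> t" using t DC by auto
    then have "coord z (endo (factor_map t m) g) = coord z g"
      using coord_factor[OF V supp_closed[OF that], of z m] z auto_closed[OF auto supp_closed[OF that]]
      by (intro coord_eqI supp_closed[OF that]) auto
    then show "coord z (endo (factor_map t m) g) = 0" using that z by (simp add: supp_in_def)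
  qed
  moreover have "endo (factor_map t m) (vertex v) \<asymp> vertex v" if "v \<in> V - D" for v
    using endo_vertex[OF ad, of v] that t by (auto simp: factor_map_def)
  ultimately show ?thesis using factor_endo(3)[OF V m] by (simp add: row_ops_def)
qed

text \<open>With pivot 1, the entry at \<open>z\<close> is cleared by subtracting that multiple of
  row \<open>s\<close>. The divisibility, which holds in any column of order
  \<open>modulus s\<close>, is just what makes this transvection well-defined.\<close>

lemma clear_column:
  assumes s: "s \<in> D" and g: "g \<in> supp_in C" and one: "coord s g = 1"
    and dvd: "\<And>z. z \<in> C \<Longrightarrow> modulus z dvd modulus s * coord z g"
  shows "\<exists>\<alpha>\<in>R. \<alpha> g \<asymp> vertex s"
  using g one dvd
proof (induction "card {z \<in> C - {s}. coord z g \<noteq> 0}" arbitrary: g rule: less_induct)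
  case less
  note g = less.prems(1) and one = less.prems(2) and dvd = less.prems(3)
  note gc = supp_closed[OF g]
  have sV: "s \<in> V" using s DC by auto
  have finC: "finite C" using DC(2) finite_V finite_subset by blast
  show ?case
  proof (cases "\<exists>z\<in>C - {s}. coord z g \<noteq> 0")
    case False
    have "g \<asymp> vertex s"
      unfolding similar_def
    proof
      fix v assume v: "v \<in> V"
      show "coord v g = coord v (vertex s)"
        using False g one v coord_vertex[OF v sV] by (cases "v = s"; cases "v \<in> C") (auto simp: supp_in_def)
    qed
    then show ?thesis using one_row_ops AG_one_apply[OF gc] by (intro bexI[of _ "\<one>\<^bsub>AG\<^esub>"]) simp_all
  next
    case True
    then obtain z where z: "z \<in> C" "z \<noteq> s" "coord z g \<noteq> 0" by blast
    have zV: "z \<in> V" using z DC by auto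
    let ?k = "- coord z g"
    have d: "modulus z dvd ?k * modulus s" using dvd[OF z(1)] by (simp add: mult.commute)
    note \<tau> = transv_row_ops[OF s z(1,2) d]
    let ?\<tau> = "endo (transv s z ?k)" let ?h = "?\<tau> g"
    note auto = row_ops_auto[OF \<tau>(1)]
    have h: "?h \<in> supp_in C" using \<tau>(1) g by (simp add: row_ops_def)
    note hc = supp_closed[OF h]
    have same: "coord v ?h = coord v g" if v: "v \<in> V" "v \<noteq> z" for v
      using coord_transv[OF \<tau>(2) sV zV z(2)[symmetric] gc v(1)] v by (intro coord_eqI[OF v(1) hc gc]) simp
    have zero: "coord z ?h = 0"
    proof -
      have "[coord z ?h = coord z \<one>\<^bsub>G\<^esub>] (mod modulus z)"
        using coord_transv[OF \<tau>(2) sV zV z(2)[symmetric] gc zV] one zV by simp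
      from coord_eqI[OF zV hc one_closed this] show ?thesis using zV by simp
    qed
    have "{v \<in> C - {s}. coord v ?h \<noteq> 0} \<subset> {v \<in> C - {s}. coord v g \<noteq> 0}"
    proof
      show "{v \<in> C - {s}. coord v ?h \<noteq> 0} \<subseteq> {v \<in> C - {s}. coord v g \<noteq> 0}"
      proof
        fix v assume v: "v \<in> {v \<in> C - {s}. coord v ?h \<noteq> 0}"
        then have "v \<in> V" "v \<noteq> z" using DC zero by auto
        then show "v \<in> {v \<in> C - {s}. coord v g \<noteq> 0}" using v same by simp
      qed
      show "{v \<in> C - {s}. coord v ?h \<noteq> 0} \<noteq> {v \<in> C - {s}. coord v g \<noteq> 0}" using z zero by blast
    qed
    then have "card {v \<in> C - {s}. coord v ?h \<noteq> 0} < card {v \<in> C - {s}. coord v g \<noteq> 0}"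
      using finC by (intro psubset_card_mono) auto
    moreover have "modulus v dvd modulus s * coord v ?h" if "v \<in> C" for v
      using dvd[OF that] same[of v] zero that DC by (cases "v = z") auto
    moreover have "coord s ?h = 1" using same[OF sV] z(2) one by simp
    ultimately obtain \<alpha> where \<alpha>: "\<alpha> \<in> R" "\<alpha> ?h \<asymp> vertex s"
      using less.hyps[of ?h] h by blast
    then show ?thesis
      using mult_row_ops[OF \<alpha>(1) \<tau>(1)] AG_apply[OF row_ops_auto[OF \<alpha>(1)] auto gc]
      by (intro bexI[of _ "\<alpha> \<otimes>\<^bsub>AG\<^esub> ?\<tau>"]) simp_all
  qed
qed

text \<open>A unit pivot is scaled to 1 by the factor automorphism belonging to its inverse.\<close>

lemma eliminate_column:
  assumes s: "s \<in> D" and g: "g \<in> supp_in C" and unit: "coprime (coord s g) (modulus s)"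
    and dvd: "\<And>z. z \<in> C \<Longrightarrow> modulus z dvd modulus s * coord z g"
  shows "\<exists>\<alpha>\<in>R. \<alpha> g \<asymp> vertex s"
proof -
  note gc = supp_closed[OF g]
  have sV: "s \<in> V" using s DC by auto
  obtain m where m: "[coord s g * m = 1] (mod modulus s)" using unit cong_solve_coprime_int by blast
  then have cop: "coprime m (modulus s)"
    using coprime_iff_invertible_int[of m "modulus s"] by (auto simp: mult.commute)
  note \<tau> = factor_row_ops[OF s cop]
  let ?\<tau> = "endo (factor_map s m)" let ?h = "?\<tau> g"
  have h: "?h \<in> supp_in C" using \<tau> g by (simp add: row_ops_def)
  note hc = supp_closed[OF h]
  have "[coord s ?h = coord s (vertex s)] (mod modulus s)"
    using cong_trans[OF coord_factor[OF sV gc sV, of m]] m coord_vertex[OF sV sV] by (simp add: mult.commute)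
  from coord_eqI[OF sV hc vertex_closed[OF sV] this] have one: "coord s ?h = 1" using coord_vertex[OF sV sV] by simp
  have "modulus v dvd modulus s * coord v ?h" if v: "v \<in> C" for v
  proof (cases "v = s")
    case False
    have vV: "v \<in> V" using v DC by auto
    have "coord v ?h = coord v g"
      using coord_factor[OF sV gc vV, of m] False by (intro coord_eqI[OF vV hc gc]) simp
    then show ?thesis using dvd[OF v] by simp
  qed simp
  then obtain \<alpha> where \<alpha>: "\<alpha> \<in> R" "\<alpha> ?h \<asymp> vertex s"
    using clear_column[OF s h one] by blast
  then show ?thesis
    using mult_row_ops[OF \<alpha>(1) \<tau>] AG_apply[OF row_ops_auto[OF \<alpha>(1)] row_ops_auto[OF \<tau>] gc]
    by (intro bexI[of _ "\<alpha> \<otimes>\<^bsub>AG\<^esub> ?\<tau>"]) simp_all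
qed

text \<open>Euclid's algorithm on the entries of infinite order, as a minimality argument.\<close>

lemma euclid_column:
  assumes g: "g \<in> supp_in C"
  shows "\<exists>\<alpha>\<in>R. \<forall>s\<in>D. \<forall>t\<in>D. modulus s = 0 \<longrightarrow> modulus t = 0 \<longrightarrow>
    coord s (\<alpha> g) \<noteq> 0 \<longrightarrow> coord t (\<alpha> g) \<noteq> 0 \<longrightarrow> s = t"
proof -
  note gc = supp_closed[OF g]
  let ?D = "{s \<in> D. modulus s = 0}"
  have "finite D" using DC finite_V by (meson finite_subset)
  then have finD: "finite ?D" by simp
  define N where "N \<alpha> = (\<Sum>s\<in>?D. nat \<bar>coord s (\<alpha> g)\<bar>)" for \<alpha> :: "('a \<times> int) list set set \<Rightarrow> ('a \<times> int) list set set"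
  obtain \<alpha> where \<alpha>: "\<alpha> \<in> R" and min: "\<And>\<beta>. \<beta> \<in> R \<Longrightarrow> N \<alpha> \<le> N \<beta>"
    using ex_has_least_nat[of "\<lambda>\<alpha>. \<alpha> \<in> R" "\<one>\<^bsub>AG\<^esub>" N] one_row_ops by blast
  note aa = row_ops_auto[OF \<alpha>]
  have h: "\<alpha> g \<in> supp_in C" using \<alpha> g by (simp add: row_ops_def)
  note hc = supp_closed[OF h]
  have reduce: False if s: "s \<in> ?D" and t: "t \<in> ?D" and st: "s \<noteq> t" and nz: "coord t (\<alpha> g) \<noteq> 0"
    and le: "\<bar>coord t (\<alpha> g)\<bar> \<le> \<bar>coord s (\<alpha> g)\<bar>" for s t
  proof -
    have V: "s \<in> V" "t \<in> V" using s t DC by auto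
    \<comment> \<open>With this sign the new entry in row \<open>s\<close> has absolute value
      \<open>|a_s| - |a_t|\<close>: one subtraction of Euclid's algorithm. The transvection is
      well-defined for every \<open>k\<close> because \<open>t\<close> has infinite order.\<close>
    define k where "k = - sgn (coord s (\<alpha> g)) * sgn (coord t (\<alpha> g))"
    have d: "modulus s dvd k * modulus t" using t by simp
    have sC: "s \<in> C" "t \<in> D" using s t DC by auto
    note \<tau> = transv_row_ops[OF sC(2,1) st d]
    let ?\<tau> = "endo (transv t s k)"
    note ta = row_ops_auto[OF \<tau>(1)]
    have "coord v (?\<tau> (\<alpha> g)) = coord v (\<alpha> g) + (if v = s then k * coord t (\<alpha> g) else 0)" if "v \<in> ?D" for v
    proof -
      have "v \<in> V" using that DC by auto
      from coord_transv[OF \<tau>(2) V(2,1) st[symmetric] hc this] show ?thesis using that by simp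
    qed
    then have new: "coord v ((?\<tau> \<otimes>\<^bsub>AG\<^esub> \<alpha>) g) = coord v (\<alpha> g) + (if v = s then k * coord t (\<alpha> g) else 0)" if "v \<in> ?D" for v
      using that AG_apply[OF ta aa gc] by simp
    have "\<bar>coord s (\<alpha> g) + k * coord t (\<alpha> g)\<bar> < \<bar>coord s (\<alpha> g)\<bar>"
      using nz le unfolding k_def by (auto simp: sgn_if abs_if split: if_splits)
    then have lt: "nat \<bar>coord s ((?\<tau> \<otimes>\<^bsub>AG\<^esub> \<alpha>) g)\<bar> < nat \<bar>coord s (\<alpha> g)\<bar>" using new[OF s] by simp
    have "N (?\<tau> \<otimes>\<^bsub>AG\<^esub> \<alpha>) < N \<alpha>"
      unfolding N_def
    proof (rule sum_strict_mono_ex1[OF finD])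
      show "\<forall>v\<in>?D. nat \<bar>coord v ((?\<tau> \<otimes>\<^bsub>AG\<^esub> \<alpha>) g)\<bar> \<le> nat \<bar>coord v (\<alpha> g)\<bar>"
      proof
        fix v assume v: "v \<in> ?D"
        show "nat \<bar>coord v ((?\<tau> \<otimes>\<^bsub>AG\<^esub> \<alpha>) g)\<bar> \<le> nat \<bar>coord v (\<alpha> g)\<bar>"
          using new[OF v] less_imp_le[OF lt] by (cases "v = s") (simp_all only: if_True if_False add_0_right)
      qed
      show "\<exists>v\<in>?D. nat \<bar>coord v ((?\<tau> \<otimes>\<^bsub>AG\<^esub> \<alpha>) g)\<bar> < nat \<bar>coord v (\<alpha> g)\<bar>" using lt s by blast
    qed
    then show False using min[OF mult_row_ops[OF \<tau>(1) \<alpha>]] by simp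
  qed
  have "s = t" if "s \<in> D" "t \<in> D" "modulus s = 0" "modulus t = 0" "coord s (\<alpha> g) \<noteq> 0" "coord t (\<alpha> g) \<noteq> 0" for s t
    using reduce[of s t] reduce[of t s] that linear[of "\<bar>coord s (\<alpha> g)\<bar>" "\<bar>coord t (\<alpha> g)\<bar>"] by auto
  then show ?thesis using \<alpha> by blast
qed

end

section \<open>Pivots from the inverse matrix\<close>

text \<open>A row of the inverse matrix times a column of the matrix of \<open>\<theta>\<close>.\<close>

lemma inverse_matrix_row:
  assumes \<theta>: "\<theta> \<in> auto G" and x: "x \<in> V" and D: "D \<subseteq> V"
    and outside: "\<And>v. v \<in> V - D \<Longrightarrow> coord v (\<theta> (vertex x)) = 0 \<or> (\<exists>f\<in>V. f \<noteq> x \<and> \<theta> (vertex f) \<asymp> vertex v)"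
  shows "[(\<Sum>s\<in>D. coord s (\<theta> (vertex x)) * coord x ((inv\<^bsub>AG\<^esub> \<theta>) (vertex s))) = 1] (mod modulus x)"
proof -
  let ?\<kappa> = "inv\<^bsub>AG\<^esub> \<theta>"
  note \<kappa> = AG_inv(1)[OF \<theta>]
  \<comment> \<open>Row \<open>x\<close> of the inverse times column \<open>f\<close> of
    \<open>\<theta>\<close> is an off-diagonal entry of the identity matrix. As column
    \<open>f\<close> is the unit vector at \<open>v\<close>, the entry of the inverse at
    \<open>v\<close> vanishes.\<close>
  have zero: "coord v (\<theta> (vertex x)) * coord x (?\<kappa> (vertex v)) = 0" if v: "v \<in> V - D" for v
    using outside[OF v]
  proof
    assume "\<exists>f\<in>V. f \<noteq> x \<and> \<theta> (vertex f) \<asymp> vertex v"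
    then obtain f where f: "f \<in> V" "f \<noteq> x" "\<theta> (vertex f) \<asymp> vertex v" by blast
    have "?\<kappa> (\<theta> (vertex f)) \<asymp> ?\<kappa> (vertex v)"
      using f v by (intro similar_hom[OF auto_hom[OF \<kappa>] auto_closed[OF \<theta>]]) auto
    then have "vertex f \<asymp> ?\<kappa> (vertex v)" using AG_inv(2)[OF \<theta>] f(1) by simp
    then have "coord x (?\<kappa> (vertex v)) = coord x (vertex f)" using x by (simp add: similar_def)
    then show ?thesis using coord_vertex[OF x f(1)] f(2) by simp
  qed simp
  have "[coord x (?\<kappa> (\<theta> (vertex x))) = (\<Sum>v\<in>V. coord v (\<theta> (vertex x)) * coord x (?\<kappa> (vertex v)))] (mod modulus x)"
    using x by (intro coord_hom_sum[OF auto_hom[OF \<kappa>] x] auto_closed[OF \<theta>]) simp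
  also have "(\<Sum>v\<in>V. coord v (\<theta> (vertex x)) * coord x (?\<kappa> (vertex v))) =
      (\<Sum>s\<in>D. coord s (\<theta> (vertex x)) * coord x (?\<kappa> (vertex s)))"
    using zero by (intro sum.mono_neutral_right[OF finite_V D]) blast
  finally show ?thesis using AG_inv(2)[OF \<theta> vertex_closed[OF x]] coord_vertex[OF x x] by (simp add: cong_sym)
qed

text \<open>A sum that is nonzero modulo \<open>p\<close> has a term prime to \<open>p\<close>. Both
  factors of this term are then prime to \<open>p\<close>, and the exponent conditions for
  \<open>\<theta>\<close> and for its inverse make the two orders divide each other.\<close>

lemma finite_pivot:
  assumes \<theta>: "\<theta> \<in> auto G" and x: "x \<in> V" and D: "D \<subseteq> V" and fin: "modulus x \<noteq> 0"
    and row: "[(\<Sum>s\<in>D. coord s (\<theta> (vertex x)) * coord x ((inv\<^bsub>AG\<^esub> \<theta>) (vertex s))) = 1] (mod modulus x)"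
  obtains s where "s \<in> D" "modulus s = modulus x" "coprime (coord s (\<theta> (vertex x))) (modulus s)"
proof -
  let ?P = "\<lambda>s. coord s (\<theta> (vertex x))" and ?Q = "\<lambda>s. coord x ((inv\<^bsub>AG\<^esub> \<theta>) (vertex s))"
  obtain p a where p: "Factorial_Ring.prime p" "a > 0" "modulus x = int p ^ a"
    using modulus_cases[OF x] fin by metis
  have pi: "Factorial_Ring.prime (int p)" using p by simp
  have "\<exists>s\<in>D. \<not> int p dvd ?P s * ?Q s"
  proof (rule ccontr)
    assume "\<not> ?thesis"
    then have "int p dvd (\<Sum>s\<in>D. ?P s * ?Q s)" by (intro dvd_sum) blast
    moreover have "int p dvd modulus x" using p by (simp add: dvd_power)
    then have "[(\<Sum>s\<in>D. ?P s * ?Q s) = 1] (mod int p)" using row cong_dvd_modulus by blast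
    ultimately have "int p dvd 1" using cong_dvd_iff by blast
    then show False using pi not_prime_unit by blast
  qed
  then obtain s where s: "s \<in> D" "\<not> int p dvd ?P s" "\<not> int p dvd ?Q s" by (meson dvd_mult dvd_mult2)
  have sV: "s \<in> V" using s D by auto
  have d1: "modulus s dvd modulus x * ?P s" by (rule hom_coord_exponent[OF auto_hom[OF \<theta>] x sV])
  have d2: "modulus x dvd modulus s * ?Q s" by (rule hom_coord_exponent[OF auto_hom[OF AG_inv(1)[OF \<theta>]] sV x])
  have copP: "coprime (int p) (?P s)" and copQ: "coprime (int p) (?Q s)"
    using s pi by (auto intro: prime_imp_coprime)
  have "int p ^ a dvd modulus s"
    using d2 copQ unfolding p(3) by (metis coprime_dvd_mult_left_iff coprime_power_left_iff)
  moreover have ne: "modulus s \<noteq> 0"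
  proof
    assume "modulus s = 0"
    then have "?P s = 0" using d1 fin by simp
    then show False using s(2) by simp
  qed
  obtain p' b where p': "Factorial_Ring.prime p'" "b > 0" "modulus s = int p' ^ b"
    using modulus_cases[OF sV] ne by metis
  have "int p dvd int p' ^ b" using \<open>int p ^ a dvd modulus s\<close> p(2) unfolding p'(3) by (meson dvd_power dvd_trans)
  then have "p = p'" using p(1) p'(1) by (metis of_nat_dvd_iff of_nat_power prime_dvd_power primes_dvd_imp_eq)
  then have "coprime (modulus s) (?P s)" using copP p'(3) by simp
  then have "modulus s dvd modulus x" using d1 by (metis coprime_dvd_mult_left_iff)
  with calculation have "modulus s = modulus x"
    using modulus_nonneg p(3) by (intro zdvd_antisym_nonneg) simp_all
  then show ?thesis using that[OF s(1)] \<open>coprime (modulus s) (?P s)\<close> by (simp add: coprime_commute)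
qed

text \<open>The row of the inverse vanishes at vertices of finite order, so by \<open>single\<close>
  the sum has just one nonzero term; its value 1 makes the entry a unit.\<close>

lemma infinite_pivot:
  assumes \<theta>: "\<theta> \<in> auto G" and x: "x \<in> V" and D: "D \<subseteq> V" and inf: "modulus x = 0"
    and row: "[(\<Sum>s\<in>D. coord s (\<theta> (vertex x)) * coord x ((inv\<^bsub>AG\<^esub> \<theta>) (vertex s))) = 1] (mod modulus x)"
    and single: "\<forall>s\<in>D. \<forall>t\<in>D. modulus s = 0 \<longrightarrow> modulus t = 0 \<longrightarrow>
      coord s (\<theta> (vertex x)) \<noteq> 0 \<longrightarrow> coord t (\<theta> (vertex x)) \<noteq> 0 \<longrightarrow> s = t"
  obtains s where "s \<in> D" "modulus s = modulus x" "coprime (coord s (\<theta> (vertex x))) (modulus s)"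
proof -
  let ?P = "\<lambda>s. coord s (\<theta> (vertex x))" and ?Q = "\<lambda>s. coord x ((inv\<^bsub>AG\<^esub> \<theta>) (vertex s))"
  have finD: "finite D" using D finite_V finite_subset by blast
  have sum: "(\<Sum>s\<in>D. ?P s * ?Q s) = 1" using row inf by simp
  then have "\<not> (\<forall>s\<in>D. ?P s * ?Q s = 0)" using sum.neutral[of D "\<lambda>s. ?P s * ?Q s"] by linarith
  then obtain s where s: "s \<in> D" "?P s * ?Q s \<noteq> 0" by blast
  have Q: "modulus t = 0" if t: "t \<in> D" "?Q t \<noteq> 0" for t
    using hom_coord_exponent[OF auto_hom[OF AG_inv(1)[OF \<theta>]] subsetD[OF D t(1)] x] inf t(2) by simp
  have "?P t * ?Q t = 0" if "t \<in> D - {s}" for t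
    using single s Q[of s] Q[of t] that by auto
  then have "(\<Sum>t\<in>D - {s}. ?P t * ?Q t) = 0" by (intro sum.neutral) blast
  then have "(\<Sum>t\<in>D. ?P t * ?Q t) = ?P s * ?Q s"
    using sum.remove[OF finD s(1), of "\<lambda>t. ?P t * ?Q t"] by simp
  then have "is_unit (?P s)" using sum by (metis dvd_triv_left)
  moreover have "modulus s = 0" using Q[of s] s by simp
  ultimately show ?thesis using that[OF s(1)] inf by simp
qed

text \<open>The columns that are already unit vectors, wherever the entry 1 stands.\<close>

definition settled :: "(('a \<times> int) list set set \<Rightarrow> ('a \<times> int) list set set) \<Rightarrow> 'a set" where
  "settled \<theta> = {x \<in> V. \<exists>y\<in>V. \<theta> (vertex x) \<asymp> vertex y}"

text \<open>
  The column of \<open>x\<close> is cleared where \<open>x\<close> is an unsettled vertex for which the intersection \<open>U x\<close> of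
  all maximal complete subgraphs through \<open>x\<close> is as small as possible. Then the part of \<open>C\<close> (the
  image of \<open>U x\<close>) not yet hit by settled vertices consists of vertices that lie in the same
  maximal complete subgraphs, so that all transvections needed are available.
\<close>

lemma unsettled_block:
  assumes \<theta>: "\<theta> \<in> Aut_star" and unsettled: "settled \<theta> \<noteq> V"
  obtains x C where "x \<in> V" "x \<notin> settled \<theta>" "C \<subseteq> V" "\<theta> (vertex x) \<in> supp_in C"
    "\<And>t s. t \<in> C \<Longrightarrow> (\<And>f. f \<in> V \<Longrightarrow> \<not> \<theta> (vertex f) \<asymp> vertex t) \<Longrightarrow> s \<in> C \<Longrightarrow> s \<noteq> t \<Longrightarrow>
      {t, s} \<in> E \<and> link t \<subseteq> star s"
proof -
  note auto = Aut_star_auto[OF \<theta>]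
  define U where "U x = \<Inter>{\<Delta>. maximal_complete \<Delta> \<and> x \<in> \<Delta>}" for x
  have U_V: "U x \<subseteq> V" if x: "x \<in> V" for x
  proof -
    obtain \<Delta> where "maximal_complete \<Delta>" "x \<in> \<Delta>" by (rule vertex_in_maximal[OF x])
    then show ?thesis using maximal_complete_subset by (auto simp: U_def)
  qed
  obtain x0 where "x0 \<in> V - settled \<theta>" using unsettled by (auto simp: settled_def)
  then obtain x where x: "x \<in> V - settled \<theta>" and least: "\<And>r. r \<in> V - settled \<theta> \<Longrightarrow> card (U x) \<le> card (U r)"
    using ex_has_least_nat[of "\<lambda>x. x \<in> V - settled \<theta>" x0 "\<lambda>x. card (U x)"] by blast
  have xV: "x \<in> V" using x by simp
  define \<C> where "\<C> = {\<Theta>. maximal_complete \<Theta> \<and> (\<exists>\<Delta>. maximal_complete \<Delta> \<and> x \<in> \<Delta> \<and> maps_to \<theta> \<Delta> \<Theta>)}"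
  define C where "C = \<Inter>\<C>"
  obtain \<Delta>0 where \<Delta>0: "maximal_complete \<Delta>0" "x \<in> \<Delta>0" by (rule vertex_in_maximal[OF xV])
  then obtain \<Theta>0 where \<Theta>0: "\<Theta>0 \<in> \<C>" using \<theta> unfolding Aut_star_iff \<C>_def by blast
  have C_V: "C \<subseteq> V" using \<Theta>0 maximal_complete_subset by (auto simp: C_def \<C>_def)
  \<comment> \<open>\<open>C\<close> is to the image what \<open>U x\<close> is to the source: an
    intersection of matching maximal complete subgraphs, so supports correspond.\<close>
  have supp_C: "\<theta> g \<in> supp_in C \<longleftrightarrow> g \<in> supp_in (U x)" if g: "g \<in> carrier G" for g
  proof -
    have "\<theta> g \<in> supp_in C \<longleftrightarrow> (\<forall>\<Theta>\<in>\<C>. \<theta> g \<in> supp_in \<Theta>)"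
      unfolding C_def using supp_in_Inter[of \<C>] \<Theta>0 by auto
    also have "\<dots> \<longleftrightarrow> (\<forall>\<Delta>. maximal_complete \<Delta> \<and> x \<in> \<Delta> \<longrightarrow> g \<in> supp_in \<Delta>)"
    proof (intro iffI allI impI ballI)
      fix \<Delta> assume all: "\<forall>\<Theta>\<in>\<C>. \<theta> g \<in> supp_in \<Theta>" and \<Delta>: "maximal_complete \<Delta> \<and> x \<in> \<Delta>"
      then obtain \<Theta> where "maximal_complete \<Theta>" "maps_to \<theta> \<Delta> \<Theta>" using \<theta> Aut_star_iff by blast
      then show "g \<in> supp_in \<Delta>"
        using maps_to_supp[OF auto _ _ _ g, of \<Delta> \<Theta>] all \<Delta> maximal_complete_subset by (auto simp: \<C>_def)
    next
      fix \<Theta> assume all: "\<forall>\<Delta>. maximal_complete \<Delta> \<and> x \<in> \<Delta> \<longrightarrow> g \<in> supp_in \<Delta>" and "\<Theta> \<in> \<C>"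
      then obtain \<Delta> where "maximal_complete \<Theta>" "maximal_complete \<Delta>" "x \<in> \<Delta>" "maps_to \<theta> \<Delta> \<Theta>"
        by (auto simp: \<C>_def)
      then show "\<theta> g \<in> supp_in \<Theta>"
        using maps_to_supp[OF auto _ _ _ g, of \<Delta> \<Theta>] all maximal_complete_subset by auto
    qed
    also have "\<dots> \<longleftrightarrow> g \<in> supp_in (U x)"
      unfolding U_def using supp_in_Inter[of "{\<Delta>. maximal_complete \<Delta> \<and> x \<in> \<Delta>}"] \<Delta>0 by auto
    finally show ?thesis .
  qed
  have "vertex x \<in> supp_in (U x)" using vertex_in_supp[OF xV] by (simp add: U_def)
  then have x_C: "\<theta> (vertex x) \<in> supp_in C" using supp_C xV by simp
  \<comment> \<open>If \<open>y\<close> in \<open>C\<close> is not hit, then every maximal complete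
    subgraph through \<open>y\<close> contains all of \<open>C\<close>; this yields adjacency and
    domination at once.\<close>
  have in_all: "z \<in> \<Theta>" if y: "y \<in> C" "\<And>f. f \<in> V \<Longrightarrow> \<not> \<theta> (vertex f) \<asymp> vertex y"
    and z: "z \<in> C" and \<Theta>: "maximal_complete \<Theta>" "y \<in> \<Theta>" for y z \<Theta>
  proof -
    have yV: "y \<in> V" using y C_V by blast
    obtain \<Delta> where \<Delta>: "maximal_complete \<Delta>" "maps_to \<theta> \<Delta> \<Theta>" by (rule maps_to_surj[OF \<theta> \<Theta>(1)])
    have "x \<in> \<Delta>"
    proof (rule ccontr)
      assume x\<Delta>: "x \<notin> \<Delta>"
      \<comment> \<open>An unsettled \<open>r\<close> would have \<open>U r = U x\<close> by
        minimality, but \<open>U r\<close> is contained in \<open>\<Delta>\<close>, which misses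
        \<open>x\<close>.\<close>
      have F: "r \<in> settled \<theta>" if r: "r \<in> U x" "r \<in> \<Delta>" for r
      proof (rule ccontr)
        assume nr: "r \<notin> settled \<theta>"
        have rV: "r \<in> V" using r U_V[OF xV] by blast
        have "U r \<subseteq> U x" using r(1) by (auto simp: U_def)
        moreover have "card (U x) \<le> card (U r)" using least[of r] nr rV by simp
        moreover have "finite (U x)" using U_V[OF xV] finite_V finite_subset by blast
        ultimately have "U r = U x" using card_seteq by blast
        moreover have "x \<in> U x" by (simp add: U_def)
        moreover have "U r \<subseteq> \<Delta>" using r(2) \<Delta>(1) by (auto simp: U_def)
        ultimately show False using x\<Delta> by blast
      qed
      \<comment> \<open>In the abelianisation the preimage of \<open>y\<close> is supported on
        settled vertices only, none of which goes to \<open>y\<close>; so its image cannot have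
        coordinate 1 at \<open>y\<close>.\<close>
      let ?u = "(inv\<^bsub>AG\<^esub> \<theta>) (vertex y)"
      have u: "?u \<in> carrier G" "\<theta> ?u = vertex y"
        using AG_inv(1,3)[OF auto] auto_closed yV vertex_closed by blast+
      have "?u \<in> supp_in (U x)" using supp_C[OF u(1)] u(2) vertex_in_supp[OF yV] y(1) by simp
      moreover have "?u \<in> supp_in \<Delta>"
        using maps_to_supp[OF auto \<Delta>(2) _ _ u(1)] maximal_complete_subset \<Delta> \<Theta> u(2) vertex_in_supp[OF yV] by simp
      ultimately have u_supp: "?u \<in> supp_in (U x \<inter> \<Delta>)" by (simp add: supp_in_Int)
      have "coord v ?u * coord y (\<theta> (vertex v)) = 0" if v: "v \<in> V" for v
      proof (cases "v \<in> U x \<inter> \<Delta>")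
        case True
        then obtain w where w: "w \<in> V" "\<theta> (vertex v) \<asymp> vertex w" using F by (auto simp: settled_def)
        then have "w \<noteq> y" using y(2)[OF v] by auto
        then show ?thesis using w coord_vertex[OF yV w(1)] yV by (simp add: similar_def)
      next
        case False
        then show ?thesis using u_supp v by (simp add: supp_in_def)
      qed
      then have "(\<Sum>v\<in>V. coord v ?u * coord y (\<theta> (vertex v))) = 0" by (intro sum.neutral) blast
      then have "[1 = 0] (mod modulus y)"
        using coord_hom_sum[OF auto_hom[OF auto] yV u(1)] u(2) coord_vertex[OF yV yV] by simp
      then have "modulus y dvd 1" by (simp add: cong_0_iff)
      then show False using modulus_neq_1[OF yV] modulus_nonneg[of y] by (auto simp: zdvd1_eq)
    qed
    then have "\<Theta> \<in> \<C>" using \<Delta> \<Theta>(1) by (auto simp: \<C>_def)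
    then show ?thesis using z by (auto simp: C_def)
  qed
  have adj: "{t, s} \<in> E \<and> link t \<subseteq> star s"
    if t: "t \<in> C" "\<And>f. f \<in> V \<Longrightarrow> \<not> \<theta> (vertex f) \<asymp> vertex t" and s: "s \<in> C" "s \<noteq> t" for t s
  proof
    have tV: "t \<in> V" using t C_V by blast
    obtain \<Theta> where \<Theta>: "maximal_complete \<Theta>" "t \<in> \<Theta>" by (rule vertex_in_maximal[OF tV])
    show "{t, s} \<in> E" using maximal_edge[OF \<Theta> in_all[OF t s(1) \<Theta>]] s(2) by blast
    show "link t \<subseteq> star s"
    proof
      fix w assume "w \<in> link t"
      then have "{t, w} \<in> E" by (simp add: link_def)
      then obtain \<Theta> where \<Theta>: "maximal_complete \<Theta>" "t \<in> \<Theta>" "w \<in> \<Theta>" by (rule edge_in_maximal)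
      have "s \<in> \<Theta>" by (rule in_all[OF t s(1) \<Theta>(1,2)])
      then show "w \<in> star s" using maximal_edge[OF \<Theta>(1) _ \<Theta>(3)] by (auto simp: in_star_iff)
    qed
  qed
  show ?thesis using that[OF xV _ C_V x_C adj] x by blast
qed

text \<open>The pivot is sought among the rows \<open>D\<close> of \<open>C\<close> that no unit
  vector occupies. Entries in the other rows of \<open>C\<close> are cleared too, but these rows
  never serve as sources, so settled columns survive.\<close>

lemma settle_one:
  assumes \<theta>: "\<theta> \<in> Aut_star" and unsettled: "settled \<theta> \<noteq> V"
  shows "\<exists>\<alpha>\<in>S. settled \<theta> \<subset> settled (\<alpha> \<otimes>\<^bsub>AG\<^esub> \<theta>)"
proof -
  note auto = Aut_star_auto[OF \<theta>]
  obtain x C where x: "x \<in> V" "x \<notin> settled \<theta>" and C: "C \<subseteq> V" "\<theta> (vertex x) \<in> supp_in C"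
    and adj: "\<And>t s. t \<in> C \<Longrightarrow> (\<And>f. f \<in> V \<Longrightarrow> \<not> \<theta> (vertex f) \<asymp> vertex t) \<Longrightarrow> s \<in> C \<Longrightarrow> s \<noteq> t \<Longrightarrow>
      {t, s} \<in> E \<and> link t \<subseteq> star s"
    by (rule unsettled_block[OF assms]) blast
  define D where "D = {t \<in> C. \<forall>f\<in>V. \<not> \<theta> (vertex f) \<asymp> vertex t}"
  have D: "D \<subseteq> C" "D \<subseteq> V" using C by (auto simp: D_def)
  have adjD: "\<forall>t\<in>D. \<forall>s\<in>C. s \<noteq> t \<longrightarrow> {t, s} \<in> E \<and> link t \<subseteq> star s"
    using adj unfolding D_def by blast
  let ?R = "row_ops D C"
  have keep: "(\<alpha> \<otimes>\<^bsub>AG\<^esub> \<theta>) (vertex f) \<asymp> vertex w"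
    if \<alpha>: "\<alpha> \<in> ?R" and f: "f \<in> V" "w \<in> V" "\<theta> (vertex f) \<asymp> vertex w" for \<alpha> f w
  proof -
    have "w \<notin> D" using f by (auto simp: D_def)
    then have "\<alpha> (vertex w) \<asymp> vertex w" using \<alpha> f(2) by (simp add: row_ops_def)
    moreover have "\<alpha> (\<theta> (vertex f)) \<asymp> \<alpha> (vertex w)"
      using f by (intro similar_hom[OF auto_hom[OF row_ops_auto[OF \<alpha>]] auto_closed[OF auto]]) simp_all
    ultimately show ?thesis
      using AG_apply[OF row_ops_auto[OF \<alpha>] auto] f(1) similar_trans by (metis vertex_closed)
  qed
  \<comment> \<open>Stated for all row operations, because Euclid's algorithm may change the column
    before a pivot is chosen.\<close>
  have row: "[(\<Sum>s\<in>D. coord s (\<eta> (vertex x)) * coord x ((inv\<^bsub>AG\<^esub> \<eta>) (vertex s))) = 1] (mod modulus x)"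
    and \<eta>_auto: "\<eta> \<in> auto G" and \<eta>_C: "\<eta> (vertex x) \<in> supp_in C"
    if \<alpha>: "\<alpha> \<in> ?R" and \<eta>: "\<eta> = \<alpha> \<otimes>\<^bsub>AG\<^esub> \<theta>" for \<alpha> \<eta>
  proof -
    show a: "\<eta> \<in> auto G" unfolding \<eta> by (rule AG_mult_closed[OF row_ops_auto[OF \<alpha>] auto])
    show c: "\<eta> (vertex x) \<in> supp_in C"
      unfolding \<eta> using AG_apply[OF row_ops_auto[OF \<alpha>] auto] x(1) C(2) \<alpha> by (simp add: row_ops_def)
    show "[(\<Sum>s\<in>D. coord s (\<eta> (vertex x)) * coord x ((inv\<^bsub>AG\<^esub> \<eta>) (vertex s))) = 1] (mod modulus x)"
    proof (rule inverse_matrix_row[OF a x(1) D(2)])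
      fix v assume v: "v \<in> V - D"
      show "coord v (\<eta> (vertex x)) = 0 \<or> (\<exists>f\<in>V. f \<noteq> x \<and> \<eta> (vertex f) \<asymp> vertex v)"
      proof (cases "v \<in> C")
        case True
        then obtain f where f: "f \<in> V" "\<theta> (vertex f) \<asymp> vertex v" using v by (auto simp: D_def)
        then have "f \<noteq> x" using x v by (auto simp: settled_def)
        then show ?thesis using keep[OF \<alpha> f(1) _ f(2)] v f(1) unfolding \<eta> by blast
      next
        case False
        then show ?thesis using c v by (simp add: supp_in_def)
      qed
    qed
  qed
  \<comment> \<open>A column of finite order has a pivot at once; for infinite order Euclid's
    algorithm comes first.\<close>
  obtain \<alpha> s where \<alpha>: "\<alpha> \<in> ?R" and s: "s \<in> D" "modulus s = modulus x"
    "coprime (coord s ((\<alpha> \<otimes>\<^bsub>AG\<^esub> \<theta>) (vertex x))) (modulus s)"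
  proof (cases "modulus x = 0")
    case True
    obtain \<alpha> where \<alpha>: "\<alpha> \<in> ?R" and single: "\<forall>s\<in>D. \<forall>t\<in>D. modulus s = 0 \<longrightarrow> modulus t = 0 \<longrightarrow>
      coord s (\<alpha> (\<theta> (vertex x))) \<noteq> 0 \<longrightarrow> coord t (\<alpha> (\<theta> (vertex x))) \<noteq> 0 \<longrightarrow> s = t"
      using euclid_column[OF D(1) C(1) adjD C(2)] by blast
    have eq: "\<alpha> (\<theta> (vertex x)) = (\<alpha> \<otimes>\<^bsub>AG\<^esub> \<theta>) (vertex x)"
      using AG_apply[OF row_ops_auto[OF \<alpha>] auto] x(1) by simp
    show ?thesis
      by (rule infinite_pivot[OF \<eta>_auto[OF \<alpha> HOL.refl] x(1) D(2) True row[OF \<alpha> HOL.refl] single[unfolded eq]])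
        (rule that[OF \<alpha>])
  next
    case False
    have \<alpha>: "\<one>\<^bsub>AG\<^esub> \<in> ?R" by (rule one_row_ops)
    show ?thesis
      by (rule finite_pivot[OF \<eta>_auto[OF \<alpha> HOL.refl] x(1) D(2) False row[OF \<alpha> HOL.refl]]) (rule that[OF \<alpha>])
  qed
  let ?\<eta> = "\<alpha> \<otimes>\<^bsub>AG\<^esub> \<theta>"
  note \<eta> = \<eta>_auto[OF \<alpha> HOL.refl] \<eta>_C[OF \<alpha> HOL.refl]
  have "modulus z dvd modulus s * coord z (?\<eta> (vertex x))" if "z \<in> C" for z
    using hom_coord_exponent[OF auto_hom[OF \<eta>(1)] x(1), of z] that C(1) s(2) by auto
  then obtain \<beta> where \<beta>: "\<beta> \<in> ?R" "\<beta> (?\<eta> (vertex x)) \<asymp> vertex s"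
    using eliminate_column[OF D(1) C(1) adjD s(1) \<eta>(2) s(3)] by blast
  let ?\<gamma> = "\<beta> \<otimes>\<^bsub>AG\<^esub> \<alpha>"
  have \<gamma>: "?\<gamma> \<in> ?R" by (rule mult_row_ops[OF \<beta>(1) \<alpha>])
  have "(?\<gamma> \<otimes>\<^bsub>AG\<^esub> \<theta>) (vertex x) = \<beta> (?\<eta> (vertex x))"
    using AG_apply[OF row_ops_auto[OF \<gamma>] auto] AG_apply[OF row_ops_auto[OF \<beta>(1)] row_ops_auto[OF \<alpha>]]
      AG_apply[OF row_ops_auto[OF \<alpha>] auto] auto_closed[OF auto] x(1) by simp
  then have "x \<in> settled (?\<gamma> \<otimes>\<^bsub>AG\<^esub> \<theta>)" using \<beta>(2) x(1) s(1) D(2) by (auto simp: settled_def)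
  moreover have "settled \<theta> \<subseteq> settled (?\<gamma> \<otimes>\<^bsub>AG\<^esub> \<theta>)" using keep[OF \<gamma>] by (auto simp: settled_def)
  moreover have "?\<gamma> \<in> S" using \<gamma> by (simp add: row_ops_def)
  ultimately show ?thesis using x(2) by blast
qed

lemma settle_all:
  assumes "\<theta> \<in> Aut_star"
  shows "\<exists>\<alpha>\<in>S. settled (\<alpha> \<otimes>\<^bsub>AG\<^esub> \<theta>) = V"
  using assms
proof (induction "card (V - settled \<theta>)" arbitrary: \<theta> rule: less_induct)
  case less
  interpret AG: group AG by (rule AutoGroup)
  note \<theta> = less.prems
  note auto = Aut_star_auto[OF \<theta>]
  show ?case
  proof (cases "settled \<theta> = V")
    case True
    then show ?thesis using generate.one[of AG] auto by (intro bexI[of _ "\<one>\<^bsub>AG\<^esub>"]) simp_all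
  next
    case False
    then obtain \<alpha> where \<alpha>: "\<alpha> \<in> S" "settled \<theta> \<subset> settled (\<alpha> \<otimes>\<^bsub>AG\<^esub> \<theta>)" using settle_one[OF \<theta>] by blast
    have \<alpha>s: "\<alpha> \<in> Aut_star" using \<alpha>(1) generate_subset_Aut_star by blast
    have "settled \<eta> \<subseteq> V" for \<eta> by (auto simp: settled_def)
    then have "V - settled (\<alpha> \<otimes>\<^bsub>AG\<^esub> \<theta>) \<subset> V - settled \<theta>" using \<alpha>(2) by blast
    then have "card (V - settled (\<alpha> \<otimes>\<^bsub>AG\<^esub> \<theta>)) < card (V - settled \<theta>)"
      using finite_V by (intro psubset_card_mono) auto
    from less.hyps[OF this subgroup.m_closed[OF subgroup_Aut_star \<alpha>s \<theta>]] obtain \<beta> where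
      \<beta>: "\<beta> \<in> S" "settled (\<beta> \<otimes>\<^bsub>AG\<^esub> (\<alpha> \<otimes>\<^bsub>AG\<^esub> \<theta>)) = V" by blast
    have \<beta>s: "\<beta> \<in> Aut_star" using \<beta>(1) generate_subset_Aut_star by blast
    have "\<beta> \<otimes>\<^bsub>AG\<^esub> (\<alpha> \<otimes>\<^bsub>AG\<^esub> \<theta>) = (\<beta> \<otimes>\<^bsub>AG\<^esub> \<alpha>) \<otimes>\<^bsub>AG\<^esub> \<theta>"
      using Aut_star_auto[OF \<alpha>s] Aut_star_auto[OF \<beta>s] auto by (simp add: AG.m_assoc)
    then show ?thesis using \<beta> subgroup.m_closed[OF subgroup_S \<beta>(1) \<alpha>(1)] by (intro bexI[of _ "\<beta> \<otimes>\<^bsub>AG\<^esub> \<alpha>"]) simp_all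
  qed
qed

text \<open>Unit columns define a map on vertices, injective because the inverse automorphism
  recovers the vertex. It respects edges in both directions because \<open>\<theta>\<close> matches
  the maximal complete subgraphs, and labels because entries 1 in the matrices of
  \<open>\<theta>\<close> and its inverse make the orders divide each other.\<close>

lemma settled_permutation:
  assumes \<theta>: "\<theta> \<in> Aut_star" and all: "settled \<theta> = V"
  shows "\<exists>\<beta>\<in>S. \<forall>v\<in>V. (\<beta> \<otimes>\<^bsub>AG\<^esub> \<theta>) (vertex v) \<asymp> vertex v"
proof -
  note auto = Aut_star_auto[OF \<theta>]
  note \<kappa> = AG_inv(1)[OF auto]
  have "\<forall>v\<in>V. \<exists>w\<in>V. \<theta> (vertex v) \<asymp> vertex w" using all by (auto simp: settled_def)
  then obtain \<pi> where \<pi>: "\<And>v. v \<in> V \<Longrightarrow> \<pi> v \<in> V" "\<And>v. v \<in> V \<Longrightarrow> \<theta> (vertex v) \<asymp> vertex (\<pi> v)" by metis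
  have preim: "vertex v \<asymp> (inv\<^bsub>AG\<^esub> \<theta>) (vertex (\<pi> v))" if v: "v \<in> V" for v
    using similar_hom[OF auto_hom[OF \<kappa>] auto_closed[OF auto vertex_closed[OF v]] vertex_closed[OF \<pi>(1)[OF v]] \<pi>(2)[OF v]]
      AG_inv(2)[OF auto vertex_closed[OF v]] by simp
  have inj: "v = w" if "v \<in> V" "w \<in> V" "\<pi> v = \<pi> w" for v w
  proof -
    have "vertex v \<asymp> vertex w" using preim[OF that(1)] preim[OF that(2)] that(3) similar_sym similar_trans by metis
    then have "coord v (vertex v) = coord v (vertex w)" using that(1) by (simp add: similar_def)
    then show ?thesis using coord_vertex[OF that(1)] that by (auto split: if_splits)
  qed
  have in_max: "\<pi> v \<in> \<Theta> \<longleftrightarrow> v \<in> \<Delta>"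
    if m: "maps_to \<theta> \<Delta> \<Theta>" "maximal_complete \<Delta>" "maximal_complete \<Theta>" and v: "v \<in> V" for \<Delta> \<Theta> v
  proof -
    have "vertex (\<pi> v) \<in> supp_in \<Theta> \<longleftrightarrow> \<theta> (vertex v) \<in> supp_in \<Theta>"
      using supp_in_similar \<pi>(2)[OF v] similar_sym[OF \<pi>(2)[OF v]] auto_closed[OF auto vertex_closed[OF v]]
        vertex_closed[OF \<pi>(1)[OF v]] by blast
    then show ?thesis
      using maps_to_supp[OF auto m(1) _ _ vertex_closed[OF v]] maximal_complete_subset m(2,3)
        vertex_in_supp[OF v] vertex_in_supp[OF \<pi>(1)[OF v]] by simp
  qed
  have graph: "graph_auto \<pi>"
    unfolding graph_auto_def
  proof (intro conjI ballI)
    have "inj_on \<pi> V" using inj by (auto intro: inj_onI)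
    moreover have "\<pi> ` V \<subseteq> V" using \<pi>(1) by blast
    ultimately show "bij_betw \<pi> V V" using endo_inj_surj[OF finite_V] by (simp add: bij_betw_def)
  next
    fix v w assume vw: "v \<in> V" "w \<in> V"
    show "{v, w} \<in> E \<longleftrightarrow> {\<pi> v, \<pi> w} \<in> E"
    proof
      assume e: "{v, w} \<in> E"
      obtain \<Delta> where \<Delta>: "maximal_complete \<Delta>" "v \<in> \<Delta>" "w \<in> \<Delta>" by (rule edge_in_maximal[OF e])
      obtain \<Theta> where \<Theta>: "maximal_complete \<Theta>" "maps_to \<theta> \<Delta> \<Theta>" using \<theta> \<Delta>(1) Aut_star_iff by blast
      have "\<pi> v \<noteq> \<pi> w" using inj[OF vw] edge_in_V[OF e] by blast
      then show "{\<pi> v, \<pi> w} \<in> E"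
        using maximal_edge[OF \<Theta>(1)] in_max[OF \<Theta>(2) \<Delta>(1) \<Theta>(1)] vw \<Delta>(2,3) by blast
    next
      assume e: "{\<pi> v, \<pi> w} \<in> E"
      obtain \<Theta> where \<Theta>: "maximal_complete \<Theta>" "\<pi> v \<in> \<Theta>" "\<pi> w \<in> \<Theta>" by (rule edge_in_maximal[OF e])
      obtain \<Delta> where \<Delta>: "maximal_complete \<Delta>" "maps_to \<theta> \<Delta> \<Theta>" by (rule maps_to_surj[OF \<theta> \<Theta>(1)])
      have "v \<noteq> w" using edge_in_V[OF e] by blast
      then show "{v, w} \<in> E"
        using maximal_edge[OF \<Delta>(1)] in_max[OF \<Delta>(2,1) \<Theta>(1)] vw \<Theta>(2,3) by blast
    qed
  next
    fix v assume v: "v \<in> V"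
    have "coord (\<pi> v) (\<theta> (vertex v)) = 1"
      using \<pi>[OF v] coord_vertex[OF \<pi>(1)[OF v] \<pi>(1)[OF v]] by (simp add: similar_def)
    then have "modulus (\<pi> v) dvd modulus v"
      using hom_coord_exponent[OF auto_hom[OF auto] v \<pi>(1)[OF v]] by simp
    moreover have "coord v ((inv\<^bsub>AG\<^esub> \<theta>) (vertex (\<pi> v))) = 1"
      using preim[OF v] v coord_vertex[OF v v] by (simp add: similar_def)
    then have "modulus v dvd modulus (\<pi> v)"
      using hom_coord_exponent[OF auto_hom[OF \<kappa>] \<pi>(1)[OF v] v] by simp
    ultimately have "modulus (\<pi> v) = modulus v" using modulus_nonneg by (intro zdvd_antisym_nonneg)
    then show "lab (\<pi> v) = lab v" by (rule modulus_eq_imp_lab[OF \<pi>(1)[OF v] v])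
  qed
  let ?\<rho> = "inv_into V \<pi>" let ?\<beta> = "endo (\<lambda>v. vertex (?\<rho> v))"
  note \<rho> = graph_auto_inv[OF graph]
  note \<beta> = graph_auto_endo[OF \<rho>]
  have "(?\<beta> \<otimes>\<^bsub>AG\<^esub> \<theta>) (vertex v) \<asymp> vertex v" if v: "v \<in> V" for v
  proof -
    have "?\<beta> (\<theta> (vertex v)) \<asymp> ?\<beta> (vertex (\<pi> v))"
      by (rule similar_hom[OF auto_hom[OF \<beta>(1)] auto_closed[OF auto vertex_closed[OF v]] vertex_closed[OF \<pi>(1)[OF v]] \<pi>(2)[OF v]])
    also have "?\<beta> (vertex (\<pi> v)) = vertex v"
      using endo_vertex[OF graph_auto_admissible[OF \<rho>] \<pi>(1)[OF v]] graph v by (simp add: graph_auto_def bij_betw_def)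
    finally show ?thesis using AG_apply[OF \<beta>(1) auto vertex_closed[OF v]] by simp
  qed
  then show ?thesis using \<beta>(3) by blast
qed

lemma Aut_star_subset_generate: "Aut_star \<subseteq> S"
proof
  interpret AG: group AG by (rule AutoGroup)
  fix \<theta> assume \<theta>: "\<theta> \<in> Aut_star"
  have S_star: "\<alpha> \<in> Aut_star" if "\<alpha> \<in> S" for \<alpha> using that generate_subset_Aut_star by blast
  obtain \<alpha> where \<alpha>: "\<alpha> \<in> S" "settled (\<alpha> \<otimes>\<^bsub>AG\<^esub> \<theta>) = V" using settle_all[OF \<theta>] by blast
  have 1: "\<alpha> \<otimes>\<^bsub>AG\<^esub> \<theta> \<in> Aut_star" by (rule subgroup.m_closed[OF subgroup_Aut_star S_star[OF \<alpha>(1)] \<theta>])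
  obtain \<beta> where \<beta>: "\<beta> \<in> S" "\<And>v. v \<in> V \<Longrightarrow> (\<beta> \<otimes>\<^bsub>AG\<^esub> (\<alpha> \<otimes>\<^bsub>AG\<^esub> \<theta>)) (vertex v) \<asymp> vertex v"
    using settled_permutation[OF 1 \<alpha>(2)] by blast
  let ?\<psi> = "\<beta> \<otimes>\<^bsub>AG\<^esub> (\<alpha> \<otimes>\<^bsub>AG\<^esub> \<theta>)"
  have "?\<psi> \<in> Aut_star" by (rule subgroup.m_closed[OF subgroup_Aut_star S_star[OF \<beta>(1)] 1])
  then have \<psi>: "?\<psi> \<in> S" by (rule in_S_if_trivial_on_abelianisation) (rule \<beta>(2))
  note cl = Aut_star_auto[OF \<theta>] Aut_star_auto[OF S_star[OF \<alpha>(1)]] Aut_star_auto[OF S_star[OF \<beta>(1)]]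
  have "inv\<^bsub>AG\<^esub> \<alpha> \<otimes>\<^bsub>AG\<^esub> (inv\<^bsub>AG\<^esub> \<beta> \<otimes>\<^bsub>AG\<^esub> ?\<psi>) = \<theta>"
    using cl AG_inv(1) AG_mult_closed by simp
  moreover have "inv\<^bsub>AG\<^esub> \<alpha> \<otimes>\<^bsub>AG\<^esub> (inv\<^bsub>AG\<^esub> \<beta> \<otimes>\<^bsub>AG\<^esub> ?\<psi>) \<in> S"
    using subgroup.m_closed[OF subgroup_S] subgroup.m_inv_closed[OF subgroup_S] \<alpha>(1) \<beta>(1) \<psi> by blast
  ultimately show "\<theta> \<in> S" by simp
qed

lemma Aut_star_eq_generate: "Aut_star = S"
  using Aut_star_subset_generate generate_subset_Aut_star by (rule subset_antisym)

end

theorem theorem6p3: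
  fixes V :: "'a set" and E :: "'a set set" and lab :: "'a \<Rightarrow> enat"
  assumes "labeled_graph V E lab"
  shows "labeled_graph.Aut_star V E lab =
    generate (AutoGroup (labeled_graph.graph_product V E lab))
      (labeled_graph.star_generators V E lab)"
  by (rule labeled_graph.Aut_star_eq_generate[OF assms])

end
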